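(* Let $k$ be a field of characteristic $0$ and $V$ a finitely generated $\mathrm{FI}^m$-module. Then there is some $\mathbf a\in\mathbb{N}^m$ such that $S_{+\mathbf a}V$ is filtered. Furthermore, there are filtered $\mathrm{FI}^m$-modules $J^0,\dots,J^N$ and a complex $0\to V\to J^0\to\cdots\to J^N\to0$ which is exact in high enough degree, i.e. $0\to V_{\mathbf d}\to J^0_{\mathbf d}\to\cdots\to J^N_{\mathbf d}\to0$ is exact for all sufficiently large $\mathbf d$.
   Context: $\mathrm{FI}^m$-modules are functors from the product category $\mathrm{FI}^m$ (objects $\mathbf d\in\mathbb{N}^m$, morphisms tuples of injections) to $k$-vector spaces; $M(\mathbf c)=k[\mathrm{Hom}_{\mathrm{FI}^m}(\mathbf c,-)]$; $S_{+\mathbf a}(V)_{\mathbf d}=V_{\mathbf d+\mathbf a}$. A module is projective iff it is a direct sum of modules $\mathrm{Ind}^{\mathrm{FI}^m}(W)$, where for an $S_{\mathbf c}$-representation $W$, $\mathrm{Ind}^{\mathrm{FI}^m}(W)_{\mathbf c+\mathbf b}=\mathrm{Ind}^{S_{\mathbf c+\mathbf b}}_{S_{\mathbf c}\times S_{\mathbf b}}W\boxtimes k$. A finitely generated $\mathrm{FI}^m$-module $V$ is filtered if it admits a surjection $\Pi:\bigoplus_{i=1}^gM(\mathbf d_i)\twoheadrightarrow V$ such that, with $V^r=\Pi(\bigoplus_{i=1}^rM(\mathbf d_i))$, all successive quotients $V^r/V^{r-1}$ are projective $\mathrm{FI}^m$-modules. *)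

theory Defs
  imports Complex_Main "HOL-Library.Function_Algebras"
begin

text \<open>Objects of FI^m: tuples d = (d_0,...,d_{m-1}) of naturals, encoded as functions
  nat => nat vanishing from m on.  A morphism d -> e is a tuple of injections
  f_i : {..<d_i} -> {..<e_i}, encoded extensionally (value 0 outside the domain).\<close>

type_synonym idx = "nat \<Rightarrow> nat"
type_synonym mor = "nat \<Rightarrow> nat \<Rightarrow> nat"

definition obj :: "nat \<Rightarrow> idx set" where
  "obj m = {d. \<forall>i\<ge>m. d i = 0}"

definition le_idx :: "nat \<Rightarrow> idx \<Rightarrow> idx \<Rightarrow> bool" where
  "le_idx m d e \<longleftrightarrow> (\<forall>i<m. d i \<le> e i)"

definition hom :: "nat \<Rightarrow> idx \<Rightarrow> idx \<Rightarrow> mor set" where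
  "hom m d e = {f. (\<forall>i<m. inj_on (f i) {..<d i} \<and> f i ` {..<d i} \<subseteq> {..<e i})
                  \<and> (\<forall>i j. (m \<le> i \<or> d i \<le> j) \<longrightarrow> f i j = 0)}"

definition idm :: "nat \<Rightarrow> idx \<Rightarrow> mor" where
  "idm m d = (\<lambda>i j. if i < m \<and> j < d i then j else 0)"

definition mcomp :: "nat \<Rightarrow> idx \<Rightarrow> mor \<Rightarrow> mor \<Rightarrow> mor" where
  "mcomp m d g f = (\<lambda>i j. if i < m \<and> j < d i then g i (f i j) else 0)"

text \<open>An FI^m-module with values in the ambient k-vector space 'v (scalar multiplication sc):
  V_d is the subspace sp V d, and act V d e f is the linear map V_d -> V_e induced by f.\<close>

record 'v fim =
  sp :: "idx \<Rightarrow> 'v set"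
  act :: "idx \<Rightarrow> idx \<Rightarrow> mor \<Rightarrow> 'v \<Rightarrow> 'v"

definition is_fim :: "nat \<Rightarrow> ('k::field \<Rightarrow> 'v::ab_group_add \<Rightarrow> 'v) \<Rightarrow> 'v fim \<Rightarrow> bool" where
  "is_fim m sc V \<longleftrightarrow> vector_space sc \<and>
     (\<forall>d\<in>obj m. 0 \<in> sp V d \<and> (\<forall>x\<in>sp V d. \<forall>y\<in>sp V d. x + y \<in> sp V d) \<and> (\<forall>a. \<forall>x\<in>sp V d. sc a x \<in> sp V d)) \<and>
     (\<forall>d\<in>obj m. \<forall>e\<in>obj m. \<forall>f\<in>hom m d e.
        (\<forall>x\<in>sp V d. act V d e f x \<in> sp V e) \<and>
        (\<forall>x\<in>sp V d. \<forall>y\<in>sp V d. act V d e f (x + y) = act V d e f x + act V d e f y) \<and>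
        (\<forall>a. \<forall>x\<in>sp V d. act V d e f (sc a x) = sc a (act V d e f x))) \<and>
     (\<forall>d\<in>obj m. \<forall>x\<in>sp V d. act V d d (idm m d) x = x) \<and>
     (\<forall>d\<in>obj m. \<forall>e\<in>obj m. \<forall>c\<in>obj m. \<forall>f\<in>hom m d e. \<forall>g\<in>hom m e c. \<forall>x\<in>sp V d.
        act V d c (mcomp m d g f) x = act V e c g (act V d e f x))"

definition is_hom :: "nat \<Rightarrow> ('k::field \<Rightarrow> 'v::ab_group_add \<Rightarrow> 'v) \<Rightarrow> 'v fim
     \<Rightarrow> ('k \<Rightarrow> 'w::ab_group_add \<Rightarrow> 'w) \<Rightarrow> 'w fim \<Rightarrow> (idx \<Rightarrow> 'v \<Rightarrow> 'w) \<Rightarrow> bool" where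
  "is_hom m s1 V s2 W \<phi> \<longleftrightarrow>
     (\<forall>d\<in>obj m. (\<forall>x\<in>sp V d. \<phi> d x \<in> sp W d) \<and>
        (\<forall>x\<in>sp V d. \<forall>y\<in>sp V d. \<phi> d (x + y) = \<phi> d x + \<phi> d y) \<and>
        (\<forall>a. \<forall>x\<in>sp V d. \<phi> d (s1 a x) = s2 a (\<phi> d x))) \<and>
     (\<forall>d\<in>obj m. \<forall>e\<in>obj m. \<forall>f\<in>hom m d e. \<forall>x\<in>sp V d.
        \<phi> e (act V d e f x) = act W d e f (\<phi> d x))"

text \<open>The free module M(c_0) + ... + M(c_{g-1}) = sum of k[Hom(c_i,-)]; an element of degree d is
  a function x with x i f the coefficient of the basis vector f in Hom(c_i, d).\<close>

type_synonym 'k freev = "nat \<Rightarrow> mor \<Rightarrow> 'k"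

definition free_sc :: "'k::field \<Rightarrow> 'k freev \<Rightarrow> 'k freev" where
  "free_sc a x = (\<lambda>i f. a * x i f)"

definition free :: "nat \<Rightarrow> idx list \<Rightarrow> ('k::field) freev fim" where
  "free m cs = \<lparr> sp = (\<lambda>d. {x. \<forall>i f. x i f \<noteq> 0 \<longrightarrow> i < length cs \<and> f \<in> hom m (cs ! i) d}),
                act = (\<lambda>d e g x. (\<lambda>i h. if i < length cs then
                          (\<Sum>f\<in>{f\<in>hom m (cs ! i) d. mcomp m (cs ! i) g f = h}. x i f) else 0)) \<rparr>"

definition fin_gen :: "nat \<Rightarrow> ('k::field \<Rightarrow> 'v::ab_group_add \<Rightarrow> 'v) \<Rightarrow> 'v fim \<Rightarrow> bool" where
  "fin_gen m sc V \<longleftrightarrow> is_fim m sc V \<and>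
     (\<exists>cs \<Pi>. set cs \<subseteq> obj m \<and> is_hom m free_sc (free m cs) sc V \<Pi> \<and>
        (\<forall>d\<in>obj m. \<Pi> d ` sp (free m cs) d = sp V d))"

text \<open>Quotient W/U (U a submodule of W) is projective.  Since W/U is finitely generated here,
  this is expressed as: W/U is a retract of a finitely generated free module
  F = M(c_0)+...+M(c_{g-1}), i.e. there are maps i : W/U -> F (given by s : W -> F vanishing on U)
  and pi : F -> W/U (given by a lift p : F -> W) with pi o i = id.\<close>

definition quot_proj :: "nat \<Rightarrow> ('k::field \<Rightarrow> 'v::ab_group_add \<Rightarrow> 'v) \<Rightarrow> 'v fim \<Rightarrow> (idx \<Rightarrow> 'v set) \<Rightarrow> bool" where
  "quot_proj m sc W U \<longleftrightarrow>
     (\<exists>cs p s. set cs \<subseteq> obj m \<and>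
        is_hom m free_sc (free m cs) sc W p \<and> is_hom m sc W free_sc (free m cs) s \<and>
        (\<forall>d\<in>obj m. \<forall>u\<in>U d. s d u = 0) \<and>
        (\<forall>d\<in>obj m. \<forall>v\<in>sp W d. p d (s d v) - v \<in> U d))"

definition filt_piece :: "nat \<Rightarrow> idx list \<Rightarrow> (idx \<Rightarrow> ('k::field) freev \<Rightarrow> 'v) \<Rightarrow> nat \<Rightarrow> idx \<Rightarrow> 'v set" where
  "filt_piece m cs \<Pi> r d = \<Pi> d ` {x \<in> sp (free m cs) d. \<forall>i\<ge>r. \<forall>f. x i f = 0}"

definition filtered :: "nat \<Rightarrow> ('k::field \<Rightarrow> 'v::ab_group_add \<Rightarrow> 'v) \<Rightarrow> 'v fim \<Rightarrow> bool" where
  "filtered m sc V \<longleftrightarrow> is_fim m sc V \<and>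
     (\<exists>cs (\<Pi> :: idx \<Rightarrow> 'k freev \<Rightarrow> 'v). set cs \<subseteq> obj m \<and>
        is_hom m free_sc (free m cs) sc V \<Pi> \<and>
        (\<forall>d\<in>obj m. \<Pi> d ` sp (free m cs) d = sp V d) \<and>
        (\<forall>r\<in>{1..length cs}.
           quot_proj m sc (V\<lparr>sp := filt_piece m cs \<Pi> r\<rparr>) (filt_piece m cs \<Pi> (r - 1))))"

text \<open>Shift functor: (S_{+a} V)_d = V_{d+a}; a morphism f : d -> e acts as f + id_a, the
  extra a_i points being sent to the extra a_i points.\<close>

definition shift_mor :: "nat \<Rightarrow> idx \<Rightarrow> idx \<Rightarrow> idx \<Rightarrow> mor \<Rightarrow> mor" where
  "shift_mor m a d e f = (\<lambda>i j. if i < m \<and> j < d i then f i j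
                               else if i < m \<and> j < d i + a i then e i + (j - d i) else 0)"

definition shift :: "nat \<Rightarrow> idx \<Rightarrow> 'v fim \<Rightarrow> 'v fim" where
  "shift m a V = \<lparr> sp = (\<lambda>d. sp V (\<lambda>i. d i + a i)),
                   act = (\<lambda>d e f. act V (\<lambda>i. d i + a i) (\<lambda>i. e i + a i) (shift_mor m a d e f)) \<rparr>"

text \<open>Ambient space used for the modules J^i: nat => k with pointwise scaling.\<close>

definition jsc :: "'k::field \<Rightarrow> (nat \<Rightarrow> 'k) \<Rightarrow> (nat \<Rightarrow> 'k)" where
  "jsc a x = (\<lambda>n. a * x n)"

end

theory Submission
  imports Defs "HOL-Library.FuncSet"
begin

text \<open>
  For a finite set A of points of d, the quotient of V_d by the images of all maps into d that miss a
  point of A is an iterated derivative of V. Two facts give the theorem.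

  (1) After a large shift all iterated derivatives are torsion free. If V is generated by elements of
  size below n, the derivatives along sets with at least n points vanish, so one can induct downwards
  on the size of A: once the derivatives along larger sets are torsion free, a torsion element can be
  moved to a smaller degree by dropping a point outside A, hence it comes from one of finitely many
  small degrees, where finite dimension bounds how long torsion can survive. No Noetherianity is needed.

  (2) If all derivatives are torsion free, list generators by increasing size. Torsion freeness
  makes each successive quotient induced from its value in the degree c of the new generator, and that
  value is a direct summand of k[Aut(c)] by averaging, so the quotient is projective.

  The inclusion of V into its shift is injective in high degrees and its cokernel is generated in
  smaller sizes; splicing by induction on the generation size gives the complex.
\<close>

section \<open>Injections and subobjects\<close>

text \<open>All m coordinates are pooled into one finite set of points, so that derivatives in the m
  directions are indexed by a single set \<open>A\<close> and one induction on \<open>card A\<close>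
  treats them together. The obstacle is that torsion freeness holds only in degrees above some
  \<open>a\<close>, while the filtration argument wants it in every degree. Shifting removes the
  discrepancy: a map into d + a misses a point of \<open>A\<close> inside d exactly when its part
  landing in d does, so the derivative of the shift in degree d along \<open>A\<close> is that of V
  in degree d + a along the same \<open>A\<close>. After the shift the case
  \<open>A = pts m c\<close> is used, which inside c + a is in general a proper subset; hence all
  sets of points must be controlled and not only the full one. The case \<open>A = {}\<close> yields
  injectivity of the structure maps. The invariants carried through the construction are pointwise
  finite dimension and a bound on the size of generators; both pass to shifts and quotients, and the
  bound drops by one from V to the cokernel, so the resolution terminates. Characteristic 0 enters
  through the division by the order of Aut(c).\<close>

definition pts :: "nat \<Rightarrow> idx \<Rightarrow> (nat \<times> nat) set" where
  "pts m d = {(i, j). i < m \<and> j < d i}"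

definition mapp :: "mor \<Rightarrow> nat \<times> nat \<Rightarrow> nat \<times> nat" where
  "mapp f p = (fst p, f (fst p) (snd p))"

definition rng :: "nat \<Rightarrow> idx \<Rightarrow> mor \<Rightarrow> (nat \<times> nat) set" where
  "rng m d f = mapp f ` pts m d"

definition idx_add :: "idx \<Rightarrow> idx \<Rightarrow> idx" where
  "idx_add d a = (\<lambda>i. d i + a i)"

lemma finite_pts [simp]: "finite (pts m d)"
proof -
  have "pts m d = Sigma {..<m} (\<lambda>i. {..<d i})" by (auto simp: pts_def)
  then show ?thesis by simp
qed

lemma finite_rng [simp]: "finite (rng m d f)"
  by (simp add: rng_def)

lemma mapp_Pair [simp]: "mapp f (i, j) = (i, f i j)"
  by (simp add: mapp_def)

text \<open>\<open>mapp f\<close> keeps the first coordinate, so injectivity and range in each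
  coordinate separately amount to injectivity and range on the pooled points. From here on tuples
  are handled as single injections.\<close>

lemma hom_iff:
  "f \<in> hom m d e \<longleftrightarrow> inj_on (mapp f) (pts m d) \<and> rng m d f \<subseteq> pts m e
     \<and> (\<forall>i j. (i, j) \<notin> pts m d \<longrightarrow> f i j = 0)"
proof -
  have 1: "inj_on (mapp f) (pts m d) \<longleftrightarrow> (\<forall>i<m. inj_on (f i) {..<d i})"
    by (auto simp: inj_on_def pts_def)
  have 2: "rng m d f \<subseteq> pts m e \<longleftrightarrow> (\<forall>i<m. f i ` {..<d i} \<subseteq> {..<e i})"
    by (fastforce simp: rng_def pts_def image_subset_iff)
  have 3: "(\<forall>i j. (i, j) \<notin> pts m d \<longrightarrow> f i j = 0) \<longleftrightarrow> (\<forall>i j. (m \<le> i \<or> d i \<le> j) \<longrightarrow> f i j = 0)"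
    by (auto simp: pts_def not_less)
  show ?thesis unfolding 1 2 3 hom_def by auto
qed

lemma hom_inj: "f \<in> hom m d e \<Longrightarrow> inj_on (mapp f) (pts m d)"
  and hom_rng: "f \<in> hom m d e \<Longrightarrow> rng m d f \<subseteq> pts m e"
  by (simp_all add: hom_iff)

lemma hom_mapp_in: "f \<in> hom m d e \<Longrightarrow> p \<in> pts m d \<Longrightarrow> mapp f p \<in> pts m e"
  using hom_rng[of f m d e] by (auto simp: rng_def)

lemma card_rng: "f \<in> hom m d e \<Longrightarrow> card (rng m d f) = card (pts m d)"
  unfolding rng_def using hom_inj card_image by blast

lemma hom_ext:
  assumes "f \<in> hom m d e" "g \<in> hom m d e'" "\<And>p. p \<in> pts m d \<Longrightarrow> mapp f p = mapp g p"
  shows "f = g"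
proof (intro ext)
  fix i j
  show "f i j = g i j"
  proof (cases "(i, j) \<in> pts m d")
    case True
    then show ?thesis using assms(3)[OF True] by simp
  next
    case False
    then show ?thesis using assms(1,2) by (simp add: hom_iff)
  qed
qed

lemma mapp_mcomp: "p \<in> pts m d \<Longrightarrow> mapp (mcomp m d g f) p = mapp g (mapp f p)"
  by (auto simp: pts_def mcomp_def)

lemma rng_mcomp: "rng m d (mcomp m d g f) = mapp g ` rng m d f"
  by (auto simp: rng_def mapp_mcomp image_image)

lemma mapp_idm: "p \<in> pts m d \<Longrightarrow> mapp (idm m d) p = p"
  by (auto simp: pts_def idm_def)

lemma rng_idm: "rng m d (idm m d) = pts m d"
  by (simp add: rng_def mapp_idm)

lemma pts_mono: "le_idx m d e \<longleftrightarrow> pts m d \<subseteq> pts m e"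
proof
  assume "pts m d \<subseteq> pts m e"
  show "le_idx m d e" unfolding le_idx_def
  proof (intro allI impI, rule ccontr)
    fix i assume "i < m" "\<not> d i \<le> e i"
    then have "(i, e i) \<in> pts m d" "(i, e i) \<notin> pts m e" by (auto simp: pts_def)
    then show False using \<open>pts m d \<subseteq> pts m e\<close> by blast
  qed
qed (force simp: pts_def le_idx_def)

lemma idm_hom: "le_idx m d e \<Longrightarrow> idm m d \<in> hom m d e"
  unfolding hom_iff by (auto simp: inj_on_def mapp_idm rng_idm pts_mono) (auto simp: idm_def pts_def)

lemma idm_hom_self [simp]: "idm m d \<in> hom m d d"
  by (simp add: idm_hom le_idx_def)

lemma mcomp_hom:
  assumes "f \<in> hom m d e" "g \<in> hom m e c"
  shows "mcomp m d g f \<in> hom m d c"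
  unfolding hom_iff
proof (intro conjI)
  show "inj_on (mapp (mcomp m d g f)) (pts m d)"
    using hom_inj[OF assms(1)] hom_inj[OF assms(2)] hom_mapp_in[OF assms(1)]
    by (auto simp: inj_on_def mapp_mcomp)
  show "rng m d (mcomp m d g f) \<subseteq> pts m c"
    using hom_rng[OF assms(1)] hom_mapp_in[OF assms(2)] by (auto simp: rng_mcomp)
qed (auto simp: mcomp_def pts_def)

lemma mcomp_assoc:
  assumes "f \<in> hom m d e" "g \<in> hom m e c" "h \<in> hom m c b"
  shows "mcomp m d h (mcomp m d g f) = mcomp m d (mcomp m e h g) f"
proof (rule hom_ext)
  show "mcomp m d h (mcomp m d g f) \<in> hom m d b" "mcomp m d (mcomp m e h g) f \<in> hom m d b"
    using assms by (auto intro: mcomp_hom)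
qed (use hom_mapp_in[OF assms(1)] in \<open>simp add: mapp_mcomp\<close>)

lemma mcomp_idm_right: "f \<in> hom m d e \<Longrightarrow> mcomp m d f (idm m d) = f"
  by (rule hom_ext[of _ m d e _ e]) (auto intro: mcomp_hom[OF idm_hom_self] simp: mapp_mcomp mapp_idm)

lemma finite_hom [simp]: "finite (hom m d e)"
proof -
  let ?F = "PiE (pts m d) (\<lambda>_. pts m e)"
  have "inj_on (\<lambda>f. restrict (mapp f) (pts m d)) (hom m d e)"
  proof (rule inj_onI)
    fix f g assume fg: "f \<in> hom m d e" "g \<in> hom m d e"
      "restrict (mapp f) (pts m d) = restrict (mapp g) (pts m d)"
    show "f = g" by (rule hom_ext[OF fg(1,2)]) (metis fg(3) restrict_apply')
  qed
  moreover have "(\<lambda>f. restrict (mapp f) (pts m d)) ` hom m d e \<subseteq> ?F"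
    using hom_mapp_in by fastforce
  moreover have "finite ?F" by (simp add: finite_PiE)
  ultimately show ?thesis by (meson finite_imageD finite_subset)
qed

text \<open>An injection can be inverted on its range, so containment of ranges already gives a lift
  through \<open>h\<close>. This criterion turns statements about morphisms into statements about
  sets of points.\<close>

lemma hom_factor:
  assumes f: "f \<in> hom m e d" and h: "h \<in> hom m c d" and sub: "rng m e f \<subseteq> rng m c h"
  obtains k where "k \<in> hom m e c" "mcomp m e h k = f"
proof -
  define q where "q = (\<lambda>p. inv_into (pts m c) (mapp h) (mapp f p))"
  define k where "k = (\<lambda>i j. if (i, j) \<in> pts m e then snd (q (i, j)) else 0)"
  have q: "q p \<in> pts m c \<and> mapp h (q p) = mapp f p" if "p \<in> pts m e" for p
  proof -
    have "mapp f p \<in> mapp h ` pts m c" using that sub unfolding rng_def by blast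
    then show ?thesis unfolding q_def by (auto intro: inv_into_into f_inv_into_f)
  qed
  \<comment> \<open>\<open>mapp\<close> keeps first coordinates, so \<open>q p\<close> lies over the
    same coordinate as \<open>p\<close> and storing only its second entry loses nothing.\<close>
  have kq: "mapp k p = q p" if "p \<in> pts m e" for p
    using q[OF that] that by (cases p; cases "q p") (auto simp: k_def mapp_def)
  have "k \<in> hom m e c" unfolding hom_iff
  proof (intro conjI)
    show "inj_on (mapp k) (pts m e)"
      by (rule inj_onI) (metis f hom_inj inj_on_eq_iff kq q)
    show "rng m e k \<subseteq> pts m c" using q kq by (auto simp: rng_def)
  qed (auto simp: k_def)
  moreover have "mcomp m e h k = f"
    by (rule hom_ext[of _ m e d _ d]) (use calculation f h q kq in \<open>auto intro: mcomp_hom simp: mapp_mcomp\<close>)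
  ultimately show ?thesis by (rule that)
qed

text \<open>Enumerating the fibre of \<open>A\<close> over each coordinate gives the source object.
  Deleting points from an object can thus be expressed by a morphism whose range is the set of
  remaining points.\<close>

lemma subobject:
  assumes "A \<subseteq> pts m d"
  obtains c h where "c \<in> obj m" "h \<in> hom m c d" "rng m c h = A"
proof -
  define B where "B i = {j. (i, j) \<in> A}" for i
  have fin: "finite (B i)" for i
    by (rule finite_subset[of _ "{..<d i}"]) (use assms in \<open>auto simp: B_def pts_def\<close>)
  define c where "c i = (if i < m then card (B i) else 0)" for i
  have "\<forall>i. \<exists>b. bij_betw b {0..<card (B i)} (B i)"
    using ex_bij_betw_nat_finite[OF fin] by blast
  then obtain b where b: "\<And>i. bij_betw (b i) {0..<card (B i)} (B i)" by metis
  define h where "h i j = (if (i, j) \<in> pts m c then b i j else 0)" for i j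
  have bi: "b i j \<in> B i" if "(i, j) \<in> pts m c" for i j
    using that b[of i] by (auto simp: bij_betw_def pts_def c_def)
  have r: "rng m c h = A"
  proof
    show "rng m c h \<subseteq> A" using bi by (auto simp: rng_def h_def B_def)
    show "A \<subseteq> rng m c h"
    proof
      fix p assume p: "p \<in> A"
      obtain i j where ij: "p = (i, j)" by (cases p)
      then have "j \<in> B i" "i < m" using p assms by (auto simp: B_def pts_def)
      then obtain l where "l < card (B i)" "b i l = j"
        using b[of i] unfolding bij_betw_def by (metis atLeastLessThan_iff imageE)
      then have "(i, l) \<in> pts m c" "mapp h (i, l) = p"
        using ij \<open>i < m\<close> by (auto simp: pts_def c_def h_def)
      then show "p \<in> rng m c h" unfolding rng_def by (metis image_eqI)
    qed
  qed
  have "h \<in> hom m c d" unfolding hom_iff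
  proof (intro conjI)
    show "inj_on (mapp h) (pts m c)"
      using b by (auto simp: inj_on_def h_def bij_betw_def pts_def c_def)
  qed (use r assms in \<open>auto simp: h_def\<close>)
  moreover have "c \<in> obj m" by (auto simp: c_def obj_def)
  ultimately show ?thesis using r that by blast
qed

text \<open>After \<open>S\<close> has been placed, what is left of \<open>R\<close> is still at
  least as large as \<open>T - S\<close>, so the rest can be placed injectively.\<close>

lemma extend_inj_finite:
  assumes "inj_on f S" "finite T" "S \<subseteq> T" "f ` S \<subseteq> R" "finite R" "card T \<le> card R"
  shows "\<exists>g. inj_on g T \<and> g ` T \<subseteq> R \<and> (\<forall>x\<in>S. g x = f x)"
proof -
  have "card (T - S) \<le> card (R - f ` S)"
    using assms by (simp add: card_Diff_subset finite_subset card_image)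
  then obtain u where u: "u ` (T - S) \<subseteq> R - f ` S" "inj_on u (T - S)"
    using card_le_inj[of "T - S" "R - f ` S"] assms by auto
  let ?g = "\<lambda>x. if x \<in> S then f x else u x"
  have "inj_on ?g T"
    using assms(1) u unfolding inj_on_def by (auto split: if_splits) 
  moreover have "?g ` T \<subseteq> R" using u assms by auto
  ultimately show ?thesis by (intro exI[of _ ?g]) auto
qed

text \<open>In each coordinate the map prescribed on the range of \<open>g1\<close> is injective,
  and it extends because e is at least as large as d. Consequently an element killed by one map into
  d is killed by every map into a degree above d.\<close>

lemma hom_extend:
  assumes g1: "g1 \<in> hom m c d" and g: "g \<in> hom m c e" and le: "le_idx m d e"
  obtains h where "h \<in> hom m d e" "mcomp m c h g1 = g"
proof -
  have "\<exists>u. inj_on u {..<d i} \<and> u ` {..<d i} \<subseteq> {..<e i} \<and> (\<forall>j<c i. u (g1 i j) = g i j)"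
    if "i < m" for i
  proof -
    have i1: "inj_on (g1 i) {..<c i}" "g1 i ` {..<c i} \<subseteq> {..<d i}"
      and i2: "inj_on (g i) {..<c i}" "g i ` {..<c i} \<subseteq> {..<e i}"
      using g1 g that by (auto simp: hom_def)
    let ?f = "\<lambda>y. g i (inv_into {..<c i} (g1 i) y)"
    have "\<exists>u. inj_on u {..<d i} \<and> u ` {..<d i} \<subseteq> {..<e i} \<and> (\<forall>y\<in>g1 i ` {..<c i}. u y = ?f y)"
    proof (rule extend_inj_finite)
      show "inj_on ?f (g1 i ` {..<c i})"
        using i1 i2 by (auto simp: inj_on_def)
      show "?f ` g1 i ` {..<c i} \<subseteq> {..<e i}" using i1 i2 by (auto simp: image_subset_iff)
      show "card {..<d i} \<le> card {..<e i}" using le that by (simp add: le_idx_def)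
    qed (use i1 in auto)
    then obtain u where u: "inj_on u {..<d i}" "u ` {..<d i} \<subseteq> {..<e i}"
      "\<forall>y\<in>g1 i ` {..<c i}. u y = ?f y" by blast
    then have "\<forall>j<c i. u (g1 i j) = g i j" using i1 by auto
    then show ?thesis using u by blast
  qed
  then obtain u where u: "\<And>i. i < m \<Longrightarrow> inj_on (u i) {..<d i} \<and> u i ` {..<d i} \<subseteq> {..<e i} \<and>
      (\<forall>j<c i. u i (g1 i j) = g i j)" by metis
  define h where "h i j = (if i < m \<and> j < d i then u i j else 0)" for i j
  have "h \<in> hom m d e"
    using u unfolding hom_def by (auto simp: h_def inj_on_def image_subset_iff)
  moreover have "mcomp m c h g1 = g"
  proof (rule hom_ext[OF mcomp_hom[OF g1 calculation] g])
    fix p assume "p \<in> pts m c"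
    moreover have "\<And>i j. i < m \<Longrightarrow> j < c i \<Longrightarrow> g1 i j < d i" using g1 by (auto simp: hom_def)
    ultimately show "mapp (mcomp m c h g1) p = mapp g p"
      using u by (auto simp: pts_def mcomp_def h_def)
  qed
  ultimately show ?thesis by (rule that)
qed

text \<open>An injective endomorphism of a finite object is bijective, so \<open>s\<close> is an
  automorphism. This reindexing is what makes the average in the splitting count every term equally
  often.\<close>

lemma mcomp_right_bij:
  assumes s: "s \<in> hom m c c"
  shows "bij_betw (\<lambda>h. mcomp m c h s) (hom m c d) (hom m c d)"
proof -
  have r: "rng m c s = pts m c"
    using hom_rng[OF s] card_rng[OF s] by (simp add: card_subset_eq)
  have "inj_on (\<lambda>h. mcomp m c h s) (hom m c d)"
  proof (rule inj_onI)
    fix h h' assume h: "h \<in> hom m c d" "h' \<in> hom m c d" "mcomp m c h s = mcomp m c h' s"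
    show "h = h'"
    proof (rule hom_ext[OF h(1,2)])
      fix p assume "p \<in> pts m c"
      then obtain q where "q \<in> pts m c" "p = mapp s q" using r unfolding rng_def by blast
      then show "mapp h p = mapp h' p" using h(3) by (metis mapp_mcomp)
    qed
  qed
  moreover have "(\<lambda>h. mcomp m c h s) ` hom m c d \<subseteq> hom m c d" using mcomp_hom[OF s] by auto
  ultimately show ?thesis by (simp add: bij_betw_def endo_inj_surj)
qed

lemma mcomp_left_inj:
  assumes h: "h \<in> hom m c d" and k: "k \<in> hom m e c" "k' \<in> hom m e c" "mcomp m e h k = mcomp m e h k'"
  shows "k = k'"
proof (rule hom_ext[OF k(1,2)])
  fix p assume p: "p \<in> pts m e"
  then have "mapp h (mapp k p) = mapp h (mapp k' p)" using k(3) by (metis mapp_mcomp)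
  then show "mapp k p = mapp k' p"
    using hom_inj[OF h] hom_mapp_in[OF k(1) p] hom_mapp_in[OF k(2) p] by (simp add: inj_on_eq_iff)
qed

section \<open>Finiteness and upper bounds for sets of objects\<close>

lemma finite_objs_bounded: "finite {d \<in> obj m. le_idx m d e}"
proof (rule finite_subset)
  show "{d \<in> obj m. le_idx m d e} \<subseteq> {d. \<forall>i. (i \<in> {..<m} \<longrightarrow> d i \<in> {..Max (e ` {..<m})}) \<and> (i \<notin> {..<m} \<longrightarrow> d i = 0)}"
  proof (clarsimp simp: obj_def le_idx_def)
    fix d i assume "\<forall>i<m. d i \<le> e i" "i < m"
    then show "d i \<le> Max (e ` {..<m})" by (meson Max_ge finite_imageI finite_lessThan imageI lessThan_iff order_trans)
  qed
  show "finite {d. \<forall>i. (i \<in> {..<m} \<longrightarrow> d i \<in> {..Max (e ` {..<m})}) \<and> (i \<notin> {..<m} \<longrightarrow> d i = 0)}"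
    by (rule finite_set_of_finite_funs) auto
qed

lemma finite_objs_card: "finite {d \<in> obj m. card (pts m d) < n}"
proof (rule finite_subset[OF _ finite_objs_bounded[of m "\<lambda>_. n"]], clarsimp simp: le_idx_def)
  fix d i assume d: "card (pts m d) < n" "i < m"
  have "Pair i ` {..<d i} \<subseteq> pts m d" using d by (auto simp: pts_def)
  then have "card (Pair i ` {..<d i}) \<le> card (pts m d)" by (simp add: card_mono)
  then show "d i \<le> n" using d by (simp add: card_image inj_on_def)
qed

lemma idx_add_obj: "d \<in> obj m \<Longrightarrow> a \<in> obj m \<Longrightarrow> idx_add d a \<in> obj m"
  by (auto simp: obj_def idx_add_def)

lemma le_idx_add: "le_idx m d (idx_add d a)" "le_idx m a (idx_add d a)"
  by (auto simp: le_idx_def idx_add_def)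

lemma le_idx_trans: "le_idx m d e \<Longrightarrow> le_idx m e c \<Longrightarrow> le_idx m d c"
  unfolding le_idx_def by (meson order_trans)

lemma idx_upper_bound:
  assumes "finite S" "S \<subseteq> obj m"
  obtains a where "a \<in> obj m" "\<And>s. s \<in> S \<Longrightarrow> le_idx m s a"
proof -
  have "\<exists>a\<in>obj m. \<forall>s\<in>S. le_idx m s a" using assms
  proof (induction S)
    case empty
    have "(\<lambda>_. 0) \<in> obj m" by (simp add: obj_def)
    then show ?case by auto
  next
    case (insert x S)
    then obtain a where a: "a \<in> obj m" "\<forall>s\<in>S. le_idx m s a" by auto
    then show ?case using insert le_idx_add[of m x a] le_idx_add[of m _ x]
      by (intro bexI[of _ "idx_add x a"]) (auto intro: idx_add_obj le_idx_trans)
  qed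
  then show ?thesis using that by blast
qed

section \<open>Morphisms extended by the identity on appended points\<close>

lemma shift_mor_mapp:
  "p \<in> pts m d \<Longrightarrow> mapp (shift_mor m a d e f) p = mapp f p"
  "i < m \<Longrightarrow> j < a i \<Longrightarrow> mapp (shift_mor m a d e f) (i, d i + j) = (i, e i + j)"
  by (auto simp: pts_def shift_mor_def)

lemma pts_add_cases:
  assumes "p \<in> pts m (idx_add d a)"
  obtains "p \<in> pts m d" | i j where "i < m" "j < a i" "p = (i, d i + j)"
proof -
  obtain i j where p: "p = (i, j)" by (cases p)
  show ?thesis
  proof (cases "j < d i")
    case True then show ?thesis using p assms that(1) by (auto simp: pts_def)
  next
    case False then show ?thesis using p assms that(2)[of i "j - d i"] by (auto simp: pts_def idx_add_def)
  qed
qed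

lemma pts_add_new: "i < m \<Longrightarrow> j < a i \<Longrightarrow> (i, d i + j) \<in> pts m (idx_add d a)"
  by (auto simp: pts_def idx_add_def)

lemma pts_add_old: "pts m d \<subseteq> pts m (idx_add d a)"
  using le_idx_add pts_mono by blast

text \<open>The appended points are always hit, so the points missed by the extended map are exactly
  those missed by \<open>f\<close>.\<close>

lemma rng_shift_mor:
  assumes f: "f \<in> hom m d e"
  shows "rng m (idx_add d a) (shift_mor m a d e f) = rng m d f \<union> (pts m (idx_add e a) - pts m e)"
proof
  show "rng m (idx_add d a) (shift_mor m a d e f) \<subseteq> rng m d f \<union> (pts m (idx_add e a) - pts m e)"
  proof
    fix q assume "q \<in> rng m (idx_add d a) (shift_mor m a d e f)"
    then obtain p where p: "p \<in> pts m (idx_add d a)" "q = mapp (shift_mor m a d e f) p" by (auto simp: rng_def)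
    show "q \<in> rng m d f \<union> (pts m (idx_add e a) - pts m e)"
      using p(1)
    proof (cases rule: pts_add_cases)
      case 1
      then show ?thesis using p by (auto simp: shift_mor_mapp rng_def)
    next
      case (2 i j)
      then show ?thesis using p pts_add_new[of i m j a e]
        by (simp add: shift_mor_mapp del: mapp_Pair) (simp add: pts_def)
    qed
  qed
  have "mapp f p \<in> rng m (idx_add d a) (shift_mor m a d e f)" if "p \<in> pts m d" for p
    using that pts_add_old[of m d a] unfolding rng_def by (metis image_eqI shift_mor_mapp(1) subsetD)
  moreover have "q \<in> rng m (idx_add d a) (shift_mor m a d e f)" if "q \<in> pts m (idx_add e a)" "q \<notin> pts m e" for q
    using that(1)
  proof (cases rule: pts_add_cases)
    case (2 i j)
    then show ?thesis using pts_add_new[of i m j a d] shift_mor_mapp(2)[of i m j a d e f] unfolding rng_def by (metis image_eqI)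
  qed (use that in auto)
  ultimately show "rng m d f \<union> (pts m (idx_add e a) - pts m e) \<subseteq> rng m (idx_add d a) (shift_mor m a d e f)"
    unfolding rng_def by auto
qed

lemma shift_mor_hom:
  assumes f: "f \<in> hom m d e"
  shows "shift_mor m a d e f \<in> hom m (idx_add d a) (idx_add e a)"
  unfolding hom_iff
proof (intro conjI)
  show "rng m (idx_add d a) (shift_mor m a d e f) \<subseteq> pts m (idx_add e a)"
    using rng_shift_mor[OF f] hom_rng[OF f] pts_add_old[of m e a] by auto
  show "inj_on (mapp (shift_mor m a d e f)) (pts m (idx_add d a))"
  proof (rule inj_onI)
    fix p q assume p: "p \<in> pts m (idx_add d a)" and q: "q \<in> pts m (idx_add d a)"
      and eq: "mapp (shift_mor m a d e f) p = mapp (shift_mor m a d e f) q"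
    \<comment> \<open>Old points land in e and appended ones outside it, so no collision can occur
      between the two kinds.\<close>
    have new: "(i, e i + j) \<notin> pts m e" for i j by (auto simp: pts_def)
    from p show "p = q"
    proof (cases rule: pts_add_cases)
      case 1
      from q show ?thesis
      proof (cases rule: pts_add_cases)
        case q1: 1
        then show ?thesis using 1 eq hom_inj[OF f] by (simp add: shift_mor_mapp inj_on_eq_iff)
      next
        case (2 i j)
        then show ?thesis using 1 eq hom_mapp_in[OF f 1] new by (metis shift_mor_mapp)
      qed
    next
      case p2: (2 i j)
      from q show ?thesis
      proof (cases rule: pts_add_cases)
        case 1
        then show ?thesis using p2 eq hom_mapp_in[OF f 1] new by (metis shift_mor_mapp)
      next
        case (2 i' j')
        then have "(i, e i + j) = (i', e i' + j')" using p2 eq by (metis shift_mor_mapp(2))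
        then show ?thesis using p2 2 by auto
      qed
    qed
  qed
qed (auto simp: shift_mor_def pts_def idx_add_def)

lemma shift_mor_mcomp:
  assumes f: "f \<in> hom m d e" and g: "g \<in> hom m e c"
  shows "shift_mor m a d c (mcomp m d g f) = mcomp m (idx_add d a) (shift_mor m a e c g) (shift_mor m a d e f)"
proof (rule hom_ext[OF shift_mor_hom[OF mcomp_hom[OF f g]] mcomp_hom[OF shift_mor_hom[OF f] shift_mor_hom[OF g]]])
  fix p assume p: "p \<in> pts m (idx_add d a)"
  from p show "mapp (shift_mor m a d c (mcomp m d g f)) p =
         mapp (mcomp m (idx_add d a) (shift_mor m a e c g) (shift_mor m a d e f)) p"
    unfolding mapp_mcomp[OF p]
    by (cases rule: pts_add_cases) (use hom_mapp_in[OF f] in \<open>simp_all add: shift_mor_mapp mapp_mcomp del: mapp_Pair\<close>)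
qed

lemma shift_mor_idm: "shift_mor m a d d (idm m d) = idm m (idx_add d a)"
  by (intro ext) (auto simp: shift_mor_def idm_def idx_add_def)

text \<open>Appended points come after the old ones, so the identity on indices includes d into d +
  a compatibly with all morphisms. This is the naturality behind the map from V to its
  shift.\<close>

lemma shift_mor_natural:
  assumes f: "f \<in> hom m d e"
  shows "mcomp m d (shift_mor m a d e f) (idm m d) = mcomp m d (idm m e) f"
proof (rule hom_ext)
  show "mcomp m d (shift_mor m a d e f) (idm m d) \<in> hom m d (idx_add e a)"
    by (rule mcomp_hom[OF idm_hom[OF le_idx_add(1)] shift_mor_hom[OF f]])
  show "mcomp m d (idm m e) f \<in> hom m d (idx_add e a)"
    by (rule mcomp_hom[OF f idm_hom[OF le_idx_add(1)]])
qed (use hom_mapp_in[OF f] in \<open>simp add: mapp_mcomp mapp_idm shift_mor_mapp\<close>)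

section \<open>Torsion of iterated derivatives\<close>

text \<open>The i-th component of \<open>h\<close> is a bijection onto the fibre of its range over
  i. This reads off the source degree from the range, as required when a single point is
  deleted.\<close>

lemma card_fibre:
  assumes h: "h \<in> hom m c d" and "i < m"
  shows "c i = card {j. (i, j) \<in> rng m c h}"
proof -
  have "{j. (i, j) \<in> rng m c h} = h i ` {..<c i}"
    using \<open>i < m\<close> by (auto simp: rng_def pts_def image_iff)
  moreover have "inj_on (h i) {..<c i}" using h \<open>i < m\<close> by (auto simp: hom_def)
  ultimately show ?thesis by (simp add: card_image)
qed

lemma mapp_mcomp_image: "B \<subseteq> pts m c \<Longrightarrow> mapp (mcomp m c g h) ` B = mapp g ` mapp h ` B"
  unfolding image_image by (intro image_cong refl mapp_mcomp) auto

lemma mapp_idm_image: "B \<subseteq> pts m c \<Longrightarrow> mapp (idm m c) ` B = B"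
proof -
  assume "B \<subseteq> pts m c"
  then have "mapp (idm m c) ` B = id ` B" by (intro image_cong) (auto simp: mapp_idm simp del: mapp_Pair)
  then show ?thesis by simp
qed

text \<open>A maximal independent subset of \<open>K\<close> lies in the span of a finite set, hence
  is finite. The spanning vectors are taken in \<open>K\<close> itself, so that in the application
  each of them is torsion.\<close>

lemma (in vector_space) finite_spanning_subset:
  assumes "subspace K" "finite S" "K \<subseteq> span S"
  obtains T where "finite T" "T \<subseteq> K" "K \<subseteq> span T"
proof -
  obtain B where B: "B \<subseteq> K" "independent B" "K \<subseteq> span B" using maximal_independent_subset by blast
  then have "finite B" using independent_span_bound[OF assms(2) B(2)] assms(3) by auto
  then show ?thesis using B that by blast
qed

section \<open>Structure maps as linear maps\<close>

locale fim_module = vector_space sc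
  for sc :: "'k::field \<Rightarrow> 'v::ab_group_add \<Rightarrow> 'v" +
  fixes m :: nat and V :: "'v fim"
  assumes fim: "is_fim m sc V"
begin

lemma sp_subspace: "d \<in> obj m \<Longrightarrow> subspace (sp V d)"
  using fim unfolding is_fim_def by (intro subspaceI) auto

lemma act_in: "\<lbrakk>d \<in> obj m; e \<in> obj m; f \<in> hom m d e; x \<in> sp V d\<rbrakk> \<Longrightarrow> act V d e f x \<in> sp V e"
  and act_add: "\<lbrakk>d \<in> obj m; e \<in> obj m; f \<in> hom m d e; x \<in> sp V d; y \<in> sp V d\<rbrakk>
    \<Longrightarrow> act V d e f (x + y) = act V d e f x + act V d e f y"
  and act_scale: "\<lbrakk>d \<in> obj m; e \<in> obj m; f \<in> hom m d e; x \<in> sp V d\<rbrakk>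
    \<Longrightarrow> act V d e f (sc a x) = sc a (act V d e f x)"
  and act_id: "\<lbrakk>d \<in> obj m; x \<in> sp V d\<rbrakk> \<Longrightarrow> act V d d (idm m d) x = x"
  and act_comp: "\<lbrakk>d \<in> obj m; e \<in> obj m; c \<in> obj m; f \<in> hom m d e; g \<in> hom m e c; x \<in> sp V d\<rbrakk>
    \<Longrightarrow> act V e c g (act V d e f x) = act V d c (mcomp m d g f) x"
  using fim unfolding is_fim_def by auto

lemma act_zero: "\<lbrakk>d \<in> obj m; e \<in> obj m; f \<in> hom m d e\<rbrakk> \<Longrightarrow> act V d e f 0 = 0"
  using act_scale[of d e f 0 0] subspace_0[OF sp_subspace] by auto

lemma act_diff:
  assumes "d \<in> obj m" "e \<in> obj m" "f \<in> hom m d e" "x \<in> sp V d" "y \<in> sp V d"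
  shows "act V d e f (x - y) = act V d e f x - act V d e f y"
  using act_add[OF assms(1-3), of "x - y" y] assms subspace_diff[OF sp_subspace]
  by (simp add: algebra_simps)

lemma act_sum:
  assumes "d \<in> obj m" "e \<in> obj m" "f \<in> hom m d e" "\<And>i. i \<in> I \<Longrightarrow> x i \<in> sp V d"
  shows "act V d e f (\<Sum>i\<in>I. x i) = (\<Sum>i\<in>I. act V d e f (x i))"
  using assms(4)
proof (induction I rule: infinite_finite_induct)
  case (insert i I)
  then have "(\<Sum>i\<in>I. x i) \<in> sp V d" using subspace_sum[OF sp_subspace[OF assms(1)]] by blast
  then show ?case using insert act_add[OF assms(1-3)] by simp
qed (use act_zero[OF assms(1-3)] in auto)

lemma act_vimage_subspace:
  assumes "d \<in> obj m" "e \<in> obj m" "f \<in> hom m d e" "subspace T"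
  shows "subspace {x \<in> sp V d. act V d e f x \<in> T}"
  using assms act_zero act_add act_scale sp_subspace[OF assms(1)]
  by (intro subspaceI) (auto simp: subspace_0 subspace_add subspace_scale)

lemma act_span:
  assumes "d \<in> obj m" "e \<in> obj m" "f \<in> hom m d e" "subspace T" "S \<subseteq> sp V d"
    "\<And>x. x \<in> S \<Longrightarrow> act V d e f x \<in> T" "v \<in> span S"
  shows "act V d e f v \<in> T"
proof -
  have "span S \<subseteq> {x \<in> sp V d. act V d e f x \<in> T}"
    using assms by (intro span_minimal act_vimage_subspace) auto
  then show ?thesis using assms by auto
qed

text \<open>The quotient of degree d by low d A is the iterated derivative of V along A, and tfree d A
  says that this derivative has no torsion in degree d.\<close>

definition low :: "idx \<Rightarrow> (nat \<times> nat) set \<Rightarrow> 'v set" where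
  "low d A = span {act V e d f v | e f v. e \<in> obj m \<and> f \<in> hom m e d \<and> v \<in> sp V e \<and> \<not> A \<subseteq> rng m e f}"

definition tfree :: "idx \<Rightarrow> (nat \<times> nat) set \<Rightarrow> bool" where
  "tfree d A \<longleftrightarrow> (\<forall>d'\<in>obj m. \<forall>g\<in>hom m d d'. \<forall>v\<in>sp V d.
     act V d d' g v \<in> low d' (mapp g ` A) \<longrightarrow> v \<in> low d A)"

text \<open>The bound is strict so that n = 0 describes the zero module, which starts the induction
  on n for resolutions.\<close>

definition gen_below :: "nat \<Rightarrow> bool" where
  "gen_below n \<longleftrightarrow> (\<forall>d\<in>obj m. sp V d \<subseteq>
     span {act V e d f v | e f v. e \<in> obj m \<and> card (pts m e) < n \<and> f \<in> hom m e d \<and> v \<in> sp V e})"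

definition fin_dim :: bool where
  "fin_dim \<longleftrightarrow> (\<forall>d\<in>obj m. \<exists>S. finite S \<and> S \<subseteq> sp V d \<and> sp V d \<subseteq> span S)"

lemma subspace_low [simp]: "subspace (low d A)"
  by (simp add: low_def)

lemma lowI: "\<lbrakk>e \<in> obj m; f \<in> hom m e d; v \<in> sp V e; \<not> A \<subseteq> rng m e f\<rbrakk> \<Longrightarrow> act V e d f v \<in> low d A"
  unfolding low_def by (rule span_base) blast

lemma low_sub: "d \<in> obj m \<Longrightarrow> low d A \<subseteq> sp V d"
  unfolding low_def by (rule span_minimal) (auto simp: act_in sp_subspace)

lemma low_least:
  assumes "subspace T" "\<And>e f v. \<lbrakk>e \<in> obj m; f \<in> hom m e d; v \<in> sp V e; \<not> A \<subseteq> rng m e f\<rbrakk> \<Longrightarrow> act V e d f v \<in> T"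
  shows "low d A \<subseteq> T"
  unfolding low_def by (rule span_minimal) (use assms in auto)

lemma low_mono: "A \<subseteq> B \<Longrightarrow> low d A \<subseteq> low d B"
  by (rule low_least) (auto intro!: lowI)

text \<open>By injectivity of \<open>g\<close>, a point of \<open>A\<close> missed by
  \<open>f\<close> goes to a point of the image of \<open>A\<close> missed by the composite. So
  derivatives are functorial along injections.\<close>

lemma low_act:
  assumes d: "d \<in> obj m" "d' \<in> obj m" and g: "g \<in> hom m d d'" and A: "A \<subseteq> pts m d" and v: "v \<in> low d A"
  shows "act V d d' g v \<in> low d' (mapp g ` A)"
proof -
  have "low d A \<subseteq> {x \<in> sp V d. act V d d' g x \<in> low d' (mapp g ` A)}"
  proof (rule low_least)
    fix e f v assume e: "e \<in> obj m" "f \<in> hom m e d" "v \<in> sp V e" "\<not> A \<subseteq> rng m e f"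
    have "\<not> mapp g ` A \<subseteq> mapp g ` rng m e f"
      using inj_on_image_mem_iff[OF hom_inj[OF g] _ hom_rng[OF e(2)]] A e(4) by blast
    then show "act V e d f v \<in> {x \<in> sp V d. act V d d' g x \<in> low d' (mapp g ` A)}"
      using e d g by (auto simp: act_in act_comp rng_mcomp intro!: lowI mcomp_hom)
  qed (use d g act_vimage_subspace in auto)
  then show ?thesis using v by auto
qed

text \<open>A map that misses a point of the enlarged set but no point of \<open>A\<close> misses
  \<open>x\<close>, hence factors through the inclusion \<open>h\<close> of the remaining points. So
  enlarging \<open>A\<close> by \<open>x\<close> adds to \<open>low\<close> only the image of the
  degree with \<open>x\<close> deleted.\<close>

lemma low_insert:
  assumes d: "d \<in> obj m" and c: "c \<in> obj m" "h \<in> hom m c d" "rng m c h = pts m d - {x}"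
    and v: "v \<in> low d (insert x A)"
  obtains w where "w \<in> sp V c" "v - act V c d h w \<in> low d A"
proof -
  let ?T = "{v. \<exists>w\<in>sp V c. v - act V c d h w \<in> low d A}"
  have "low d (insert x A) \<subseteq> ?T"
  proof (rule low_least)
    show "subspace ?T"
    proof (rule subspaceI)
      show "0 \<in> ?T" using subspace_0[OF sp_subspace[OF c(1)]] act_zero[OF c(1) d c(2)]
        by (simp add: subspace_0 bexI[of _ 0])
    next
      fix y z assume "y \<in> ?T" "z \<in> ?T"
      then obtain w w' where w: "w \<in> sp V c" "w' \<in> sp V c" "y - act V c d h w \<in> low d A" "z - act V c d h w' \<in> low d A"
        by auto
      have "(y - act V c d h w) + (z - act V c d h w') \<in> low d A" using w by (simp add: subspace_add)
      then have "y + z - act V c d h (w + w') \<in> low d A"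
        using act_add[OF c(1) d c(2) w(1,2)] by (simp add: algebra_simps)
      then show "y + z \<in> ?T" using w subspace_add[OF sp_subspace[OF c(1)] w(1,2)] by blast
    next
      fix a y assume "y \<in> ?T"
      then obtain w where w: "w \<in> sp V c" "y - act V c d h w \<in> low d A" by auto
      have "sc a (y - act V c d h w) \<in> low d A" using w by (simp add: subspace_scale)
      then have "sc a y - act V c d h (sc a w) \<in> low d A"
        using act_scale[OF c(1) d c(2) w(1)] by (simp add: scale_right_diff_distrib)
      then show "sc a y \<in> ?T" using subspace_scale[OF sp_subspace[OF c(1)] w(1)] by blast
    qed
  next
    fix e f u assume e: "e \<in> obj m" "f \<in> hom m e d" "u \<in> sp V e" "\<not> insert x A \<subseteq> rng m e f"
    show "act V e d f u \<in> ?T"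
    proof (cases "A \<subseteq> rng m e f")
      case True
      then have "rng m e f \<subseteq> rng m c h" using e hom_rng[OF e(2)] c(3) by auto
      then obtain k where k: "k \<in> hom m e c" "mcomp m e h k = f" using hom_factor[OF e(2) c(2)] by blast
      have "act V e d f u - act V c d h (act V e c k u) = 0" using act_comp[OF e(1) c(1) d k(1) c(2) e(3)] k by simp
      then have "act V e d f u - act V c d h (act V e c k u) \<in> low d A" by (simp add: subspace_0)
      then show ?thesis using act_in[OF e(1) c(1) k(1) e(3)] by blast
    next
      case False
      then have "act V e d f u - act V c d h 0 \<in> low d A" using lowI[OF e(1-3)] act_zero[OF c(1) d c(2)] by simp
      then show ?thesis using subspace_0[OF sp_subspace[OF c(1)]] by blast
    qed
  qed
  then show ?thesis using v that by blast
qed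

text \<open>Generators have fewer than n points, so their images never cover \<open>A\<close>: the
  derivative along \<open>A\<close> vanishes. This starts the descending induction.\<close>

lemma low_eq_sp:
  assumes "gen_below n" "d \<in> obj m" "A \<subseteq> pts m d" "n \<le> card A"
  shows "low d A = sp V d"
proof
  show "sp V d \<subseteq> low d A"
  proof -
    have "span {act V e d f v | e f v. e \<in> obj m \<and> card (pts m e) < n \<and> f \<in> hom m e d \<and> v \<in> sp V e} \<subseteq> low d A"
    proof (rule span_minimal; clarsimp)
      fix e f v assume e: "e \<in> obj m" "card (pts m e) < n" "f \<in> hom m e d" "v \<in> sp V e"
      have "\<not> A \<subseteq> rng m e f"
        using card_mono[of "rng m e f" A] card_rng[OF e(3)] e(2) assms(4) by auto
      then show "act V e d f v \<in> low d A" using e by (auto intro: lowI)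
    qed
    then show ?thesis using assms unfolding gen_below_def by blast
  qed
qed (rule low_sub[OF assms(2)])

text \<open>By \<open>hom_extend\<close> the map \<open>k\<close> is \<open>g\<close> followed by a
  map from d to e, and \<open>low\<close> is functorial. So torsion that dies in degree d dies in
  every degree above d, along every map.\<close>

lemma torsion_persists:
  assumes o: "c \<in> obj m" "d \<in> obj m" "e \<in> obj m" and A: "A \<subseteq> pts m c" and u: "u \<in> sp V c"
    and g: "g \<in> hom m c d" "act V c d g u \<in> low d (mapp g ` A)" and le: "le_idx m d e" and k: "k \<in> hom m c e"
  shows "act V c e k u \<in> low e (mapp k ` A)"
proof -
  obtain h where h: "h \<in> hom m d e" "mcomp m c h g = k" using hom_extend[OF g(1) k le] by blast
  have "mapp g ` A \<subseteq> pts m d" using A hom_mapp_in[OF g(1)] by auto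
  then have "act V d e h (act V c d g u) \<in> low e (mapp h ` mapp g ` A)"
    using low_act[OF o(2,3) h(1) _ g(2)] by blast
  moreover have "mapp h ` mapp g ` A = mapp k ` A"
    using mapp_mcomp_image[OF A, of h g] h(2) by simp
  ultimately show ?thesis using act_comp[OF o g(1) h(1) u] h(2) by simp
qed

text \<open>Torsion elements of degree c form a subspace of a finite-dimensional space. Each of
  finitely many spanning vectors has its own bound by \<open>torsion_persists\<close>, and a common
  upper bound serves all of them.\<close>

lemma torsion_bound:
  assumes fd: "fin_dim" and c: "c \<in> obj m" and A: "A \<subseteq> pts m c"
  shows "\<exists>a\<in>obj m. \<forall>u\<in>sp V c. (\<exists>d\<in>obj m. \<exists>g\<in>hom m c d. act V c d g u \<in> low d (mapp g ` A)) \<longrightarrow>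
     (\<forall>d\<in>obj m. \<forall>g\<in>hom m c d. le_idx m a d \<longrightarrow> act V c d g u \<in> low d (mapp g ` A))"
proof -
  let ?P = "\<lambda>u a. \<forall>d\<in>obj m. \<forall>g\<in>hom m c d. le_idx m a d \<longrightarrow> act V c d g u \<in> low d (mapp g ` A)"
  define K where "K = {u \<in> sp V c. \<exists>d\<in>obj m. \<exists>g\<in>hom m c d. act V c d g u \<in> low d (mapp g ` A)}"
  have bound: "\<exists>a\<in>obj m. ?P u a" if u: "u \<in> K" for u
  proof -
    obtain d g where d: "u \<in> sp V c" "d \<in> obj m" "g \<in> hom m c d" "act V c d g u \<in> low d (mapp g ` A)"
      using u unfolding K_def by blast
    have "?P u d"
    proof (intro ballI impI)
      fix e k assume e: "e \<in> obj m" "k \<in> hom m c e" "le_idx m d e"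
      show "act V c e k u \<in> low e (mapp k ` A)" by (rule torsion_persists[OF c d(2) e(1) A d(1) d(3,4) e(3,2)])
    qed
    then show ?thesis using d(2) by (rule bexI)
  qed
  have subK: "subspace K"
  proof (rule subspaceI)
    have "act V c c (idm m c) 0 \<in> low c (mapp (idm m c) ` A)"
      using act_zero[OF c c idm_hom_self] by (simp add: subspace_0)
    then show "0 \<in> K" using c subspace_0[OF sp_subspace[OF c]] idm_hom_self unfolding K_def by blast
  next
    fix x y assume xy: "x \<in> K" "y \<in> K"
    then have sp: "x \<in> sp V c" "y \<in> sp V c" by (auto simp: K_def)
    obtain a where a: "a \<in> obj m" "?P x a" using bound[OF xy(1)] by blast
    obtain b where b: "b \<in> obj m" "?P y b" using bound[OF xy(2)] by blast
    \<comment> \<open>A degree above c and both bounds lets one and the same map kill both vectors,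
      so that additivity applies.\<close>
    define d where "d = idx_add c (idx_add a b)"
    have d: "d \<in> obj m" "le_idx m c d" "le_idx m a d" "le_idx m b d"
      using a b c by (auto simp: d_def le_idx_def idx_add_def obj_def)
    note g = idm_hom[OF d(2)]
    have "act V c d (idm m c) x \<in> low d (mapp (idm m c) ` A)" "act V c d (idm m c) y \<in> low d (mapp (idm m c) ` A)"
      using a(2)[rule_format, OF d(1) g d(3)] b(2)[rule_format, OF d(1) g d(4)] by this+
    then have "act V c d (idm m c) (x + y) \<in> low d (mapp (idm m c) ` A)"
      using act_add[OF c d(1) g sp] by (simp add: subspace_add)
    then show "x + y \<in> K" using g d sp subspace_add[OF sp_subspace[OF c] sp] unfolding K_def by blast
  next
    fix r x assume "x \<in> K"
    then obtain d g where d: "x \<in> sp V c" "d \<in> obj m" "g \<in> hom m c d" "act V c d g x \<in> low d (mapp g ` A)"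
      by (auto simp: K_def)
    then have "act V c d g (sc r x) \<in> low d (mapp g ` A)" using act_scale[OF c d(2,3,1)] by (simp add: subspace_scale)
    then show "sc r x \<in> K" using d subspace_scale[OF sp_subspace[OF c] d(1)] unfolding K_def by blast
  qed
  have Ksp: "K \<subseteq> sp V c" by (auto simp: K_def)
  obtain S where S: "finite S" "sp V c \<subseteq> span S" using fd c by (auto simp: fin_dim_def)
  obtain T where T: "finite T" "T \<subseteq> K" "K \<subseteq> span T"
    by (rule finite_spanning_subset[OF subK S(1) subset_trans[OF Ksp S(2)]])
  have "\<forall>t\<in>T. \<exists>a. a \<in> obj m \<and> ?P t a" using bound T(2) by blast
  then obtain b where b: "\<forall>t\<in>T. b t \<in> obj m \<and> ?P t (b t)" by (rule bchoice[THEN exE])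
  have "finite (b ` T)" "b ` T \<subseteq> obj m" using T(1) b by blast+
  then obtain a where a: "a \<in> obj m" "\<And>s. s \<in> b ` T \<Longrightarrow> le_idx m s a"
    by (rule idx_upper_bound) blast
  have "act V c d g u \<in> low d (mapp g ` A)"
    if u: "u \<in> K" and d: "d \<in> obj m" "g \<in> hom m c d" "le_idx m a d" for u d g
  proof (rule act_span[OF c d(1,2) subspace_low])
    show "T \<subseteq> sp V c" using T Ksp by auto
    show "u \<in> span T" using u T by auto
    fix t assume "t \<in> T"
    then show "act V c d g t \<in> low d (mapp g ` A)" using b a(2)[of "b t"] d le_idx_trans by blast
  qed
  then have "\<forall>u\<in>sp V c. (\<exists>d\<in>obj m. \<exists>g\<in>hom m c d. act V c d g u \<in> low d (mapp g ` A)) \<longrightarrow> ?P u a"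
    unfolding K_def by simp
  then show ?thesis using a(1) by (rule bexI)
qed

text \<open>If some coordinate of d exceeds that of \<open>a\<close> by more than b, it contains a
  point outside \<open>A\<close>, which has b elements. Torsion freeness along \<open>A\<close> with
  this point added puts \<open>v\<close> into the larger \<open>low\<close>, so modulo
  \<open>low d A\<close> it comes from the degree with the point deleted, which is still above
  \<open>a\<close>. Repeating this ends in the finite box below a + b.\<close>

lemma torsion_reduce:
  assumes TF: "\<And>d A. \<lbrakk>d \<in> obj m; le_idx m a d; A \<subseteq> pts m d; Suc b \<le> card A\<rbrakk> \<Longrightarrow> tfree d A"
    and e: "e \<in> obj m"
    and d: "d \<in> obj m" "le_idx m a d" and A: "A \<subseteq> pts m d" "card A = b" and v: "v \<in> sp V d"
    and g: "g \<in> hom m d e" "act V d e g v \<in> low e (mapp g ` A)"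
  shows "\<exists>c B h u. c \<in> obj m \<and> le_idx m c (\<lambda>i. a i + b) \<and> B \<subseteq> pts m c \<and> h \<in> hom m c d \<and> mapp h ` B = A
      \<and> u \<in> sp V c \<and> v - act V c d h u \<in> low d A"
  using d A v g
proof (induction "card (pts m d)" arbitrary: d A v g rule: less_induct)
  case less
  note d = less.prems(1,2) and A = less.prems(3,4) and v = less.prems(5) and g = less.prems(6,7)
  show ?case
  proof (cases "le_idx m d (\<lambda>i. a i + b)")
    case True
    have "mapp (idm m d) ` A = A" using mapp_idm_image[OF A(1)] .
    then show ?thesis using True d A v act_id[OF d(1) v] idm_hom_self[of m d] subspace_0[OF subspace_low]
      by (intro exI[of _ d] exI[of _ A] exI[of _ "idm m d"] exI[of _ v]) simp
  next
    case False
    then obtain i where i: "i < m" "a i + b < d i" by (auto simp: le_idx_def not_le)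
    have "\<exists>j<d i. (i, j) \<notin> A"
    proof (rule ccontr)
      assume "\<not> ?thesis"
      then have "Pair i ` {..<d i} \<subseteq> A" by auto
      moreover have "finite A" by (rule finite_subset[OF A(1) finite_pts])
      ultimately have "card (Pair i ` {..<d i}) \<le> card A" by (rule card_mono[rotated])
      then show False using A(2) i by (simp add: card_image inj_on_def)
    qed
    then obtain j where j: "j < d i" "(i, j) \<notin> A" by blast
    let ?x = "(i, j)"
    have x: "?x \<in> pts m d" using i j by (simp add: pts_def)
    have finA: "finite A" by (rule finite_subset[OF A(1) finite_pts])
    have "tfree d (insert ?x A)"
      using TF[OF d, of "insert ?x A"] A x j finA by simp
    moreover have "act V d e g v \<in> low e (mapp g ` insert ?x A)" using g(2) low_mono[of "mapp g ` A" "mapp g ` insert ?x A" e] by auto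
    ultimately have vi: "v \<in> low d (insert ?x A)" using e g(1) v unfolding tfree_def by blast
    obtain c h where c: "c \<in> obj m" "h \<in> hom m c d" "rng m c h = pts m d - {?x}"
      by (rule subobject[of "pts m d - {?x}" m d]) auto
    obtain w where w: "w \<in> sp V c" "v - act V c d h w \<in> low d A" by (rule low_insert[OF d(1) c vi])
    have cc: "card (pts m c) < card (pts m d)"
      using card_rng[OF c(2)] c(3) x card_Diff1_less[OF finite_pts x] by simp
    have le: "le_idx m a c" unfolding le_idx_def
    proof (intro allI impI)
      fix i' assume i': "i' < m"
      have *: "c i' = card {j'. (i', j') \<in> rng m c h}" by (rule card_fibre[OF c(2) i'])
      show "a i' \<le> c i'"
      proof (cases "i' = i")
        case True
        have "{j'. (i', j') \<in> rng m c h} = {..<d i} - {j}" using True c(3) i by (auto simp: pts_def)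
        then show ?thesis using * True i j by simp
      next
        case False
        have "{j'. (i', j') \<in> rng m c h} = {..<d i'}" using False c(3) i' by (auto simp: pts_def)
        then show ?thesis using * d(2) i' by (simp add: le_idx_def)
      qed
    qed
    \<comment> \<open>The deleted point is outside \<open>A\<close>, so all of \<open>A\<close>
      lifts along \<open>h\<close>.\<close>
    define B where "B = {p \<in> pts m c. mapp h p \<in> A}"
    have Bp: "B \<subseteq> pts m c" by (auto simp: B_def)
    have hB: "mapp h ` B = A"
    proof
      show "A \<subseteq> mapp h ` B"
      proof
        fix p assume "p \<in> A"
        then have "p \<in> rng m c h" using c(3) A(1) j by auto
        then show "p \<in> mapp h ` B" using \<open>p \<in> A\<close> by (auto simp: rng_def B_def)
      qed
    qed (auto simp: B_def)
    have "card B = b" using A(2) card_image[OF inj_on_subset[OF hom_inj[OF c(2)] Bp]] hB by simp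
    have img: "mapp (mcomp m c g h) ` B = mapp g ` A"
      using mapp_mcomp_image[OF Bp] hB by simp
    have hw: "act V c d h w \<in> sp V d" using act_in[OF c(1) d(1) c(2) w(1)] .
    have "act V d e g (v - act V c d h w) \<in> low e (mapp g ` A)" by (rule low_act[OF d(1) e g(1) A(1) w(2)])
    then have "act V d e g v - act V d e g (v - act V c d h w) \<in> low e (mapp g ` A)"
      using g(2) by (simp add: subspace_diff)
    \<comment> \<open>\<open>w\<close> inherits torsion from \<open>v\<close>: the difference of
      \<open>v\<close> and the image of \<open>w\<close> lies in \<open>low d A\<close>, which
      \<open>g\<close> sends into the corresponding \<open>low\<close> of degree e.\<close>
    then have gw: "act V c e (mcomp m c g h) w \<in> low e (mapp (mcomp m c g h) ` B)"
      using act_diff[OF d(1) e g(1) v hw] act_comp[OF c(1) d(1) e c(2) g(1) w(1)] img by simp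
    obtain c' B' h' u where c': "c' \<in> obj m" "le_idx m c' (\<lambda>i. a i + b)" "B' \<subseteq> pts m c'" "h' \<in> hom m c' c"
      "mapp h' ` B' = B" "u \<in> sp V c'" "w - act V c' c h' u \<in> low c B"
      using less.hyps[OF cc c(1) le Bp \<open>card B = b\<close> w(1) mcomp_hom[OF c(2) g(1)] gw] by blast
    \<comment> \<open>\<open>h\<close> carries the error of the recursive approximation from
      \<open>low c B\<close> into \<open>low d A\<close>, where it is added to the error of the
      first deletion.\<close>
    have "act V c d h (w - act V c' c h' u) \<in> low d (mapp h ` B)" by (rule low_act[OF c(1) d(1) c(2) Bp c'(7)])
    then have "(v - act V c d h w) + act V c d h (w - act V c' c h' u) \<in> low d A"
      using w(2) hB by (simp add: subspace_add)
    then have "v - act V c' d (mcomp m c' h h') u \<in> low d A"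
      using act_diff[OF c(1) d(1) c(2) w(1) act_in[OF c'(1) c(1) c'(4,6)]] act_comp[OF c'(1) c(1) d(1) c'(4) c(2) c'(6)]
      by (simp add: algebra_simps)
    moreover have "mapp (mcomp m c' h h') ` B' = A"
      using mapp_mcomp_image[OF c'(3)] hB c'(5) by simp
    ultimately show ?thesis using c' mcomp_hom[OF c'(4) c(2)] by blast
  qed
qed

text \<open>Descending induction on the size of \<open>A\<close> is phrased as induction on k
  through the truncated difference \<open>n - k\<close>; at k = n no set is excluded.\<close>

theorem eventually_tfree:
  assumes gen: "gen_below n" and fd: "fin_dim"
  shows "\<exists>a\<in>obj m. \<forall>d\<in>obj m. le_idx m a d \<longrightarrow> (\<forall>A\<subseteq>pts m d. tfree d A)"
proof -
  have "\<exists>a\<in>obj m. \<forall>d\<in>obj m. le_idx m a d \<longrightarrow> (\<forall>A\<subseteq>pts m d. n - k \<le> card A \<longrightarrow> tfree d A)" for k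
  proof (induction k)
    case 0
    have "(\<lambda>_. 0) \<in> obj m" by (simp add: obj_def)
    moreover have "tfree d A" if "d \<in> obj m" "A \<subseteq> pts m d" "n \<le> card A" for d A
      using low_eq_sp[OF gen that] by (simp add: tfree_def)
    ultimately show ?case by auto
  next
    case (Suc k)
    show ?case
    proof (cases "n \<le> k")
      case True then show ?thesis using Suc by simp
    next
      case False
      \<comment> \<open>The one size of \<open>A\<close> not yet covered.\<close>
      define b where "b = n - Suc k"
      have b: "n - k = Suc b" using False by (simp add: b_def)
      obtain a where a: "a \<in> obj m" "\<And>d A. \<lbrakk>d \<in> obj m; le_idx m a d; A \<subseteq> pts m d; Suc b \<le> card A\<rbrakk> \<Longrightarrow> tfree d A"
        using Suc unfolding b by blast
      \<comment> \<open>By \<open>torsion_reduce\<close> every torsion element comes, modulo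
        \<open>low\<close>, from a degree in the box below a + b, so only finitely many pairs of a
        degree and a set of points have to be bounded.\<close>
      define T where "T = Sigma {c \<in> obj m. le_idx m c (\<lambda>i. a i + b)} (\<lambda>c. Pow (pts m c))"
      have "finite T" unfolding T_def using finite_objs_bounded by (intro finite_SigmaI) auto
      let ?Q = "\<lambda>c A a. a \<in> obj m \<and> (\<forall>u\<in>sp V c. (\<exists>d\<in>obj m. \<exists>g\<in>hom m c d. act V c d g u \<in> low d (mapp g ` A)) \<longrightarrow>
     (\<forall>d\<in>obj m. \<forall>g\<in>hom m c d. le_idx m a d \<longrightarrow> act V c d g u \<in> low d (mapp g ` A)))"
      have "\<forall>t\<in>T. \<exists>a. ?Q (fst t) (snd t) a"
        using torsion_bound[OF fd] unfolding T_def Bex_def by (clarsimp simp del: mapp_Pair)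
      then obtain z where z: "\<forall>t\<in>T. ?Q (fst t) (snd t) (z t)" by (rule bchoice[THEN exE])
      have "finite (insert a (z ` T))" "insert a (z ` T) \<subseteq> obj m" using \<open>finite T\<close> z a(1) by blast+
      then obtain a' where a': "a' \<in> obj m" "\<And>s. s \<in> insert a (z ` T) \<Longrightarrow> le_idx m s a'"
        by (rule idx_upper_bound) blast
      have "tfree d A" if d: "d \<in> obj m" "le_idx m a' d" and A: "A \<subseteq> pts m d" "b \<le> card A" for d A
      proof (cases "Suc b \<le> card A")
        case True
        then show ?thesis using a(2) d A a'(2)[of a] le_idx_trans by blast
      next
        case False
        then have cA: "card A = b" using A by simp
        have ad: "le_idx m a d" using a'(2)[of a] d le_idx_trans by blast
        show ?thesis unfolding tfree_def
        proof (intro ballI impI)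
          fix e g v assume e: "e \<in> obj m" and g: "g \<in> hom m d e" and v: "v \<in> sp V d"
            and gv: "act V d e g v \<in> low e (mapp g ` A)"
          obtain c B h u where c: "c \<in> obj m" "le_idx m c (\<lambda>i. a i + b)" "B \<subseteq> pts m c" "h \<in> hom m c d" "mapp h ` B = A"
            "u \<in> sp V c" "v - act V c d h u \<in> low d A"
            using torsion_reduce[OF a(2) e d(1) ad A(1) cA v g gv] by blast
          have cB: "(c, B) \<in> T" using c by (auto simp: T_def)
          have img: "mapp (mcomp m c g h) ` B = mapp g ` A"
            using mapp_mcomp_image[OF c(3)] c(5) by simp
          have hu: "act V c d h u \<in> sp V d" using act_in[OF c(1) d(1) c(4,6)] .
          have "act V d e g v - act V d e g (v - act V c d h u) \<in> low e (mapp g ` A)"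
            using gv low_act[OF d(1) e g A(1) c(7)] by (simp add: subspace_diff)
          then have "act V c e (mcomp m c g h) u \<in> low e (mapp (mcomp m c g h) ` B)"
            using act_diff[OF d(1) e g v hu] act_comp[OF c(1) d(1) e c(4) g c(6)] img by simp
          \<comment> \<open>The small-degree element \<open>u\<close> is torsion and d lies above
            the bound attached to its pair, so the image of \<open>u\<close> already vanishes modulo
            \<open>low\<close> in degree d itself.\<close>
          moreover have "le_idx m (z (c, B)) d" using a'(2)[of "z (c, B)"] cB d le_idx_trans by blast
          ultimately have "act V c d h u \<in> low d (mapp h ` B)"
            using z[rule_format, OF cB] c(1,4,6) d(1) e mcomp_hom[OF c(4) g] unfolding fst_conv snd_conv by blast
          then have "(v - act V c d h u) + act V c d h u \<in> low d A" using c(5,7) by (intro subspace_add) auto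
          then show "v \<in> low d A" by simp
        qed
      qed
      then show ?thesis using a'(1) unfolding b_def by blast
    qed
  qed
  from this[of n] show ?thesis by simp
qed

end

section \<open>Shifts\<close>

lemma shift_sp [simp]: "sp (shift m a V) d = sp V (idx_add d a)"
  and shift_act [simp]: "act (shift m a V) d e f = act V (idx_add d a) (idx_add e a) (shift_mor m a d e f)"
  by (simp_all add: shift_def idx_add_def)

text \<open>The points of d hit by \<open>f\<close> form a subobject \<open>g\<close>; together with
  the appended points they contain the range of \<open>f\<close>, so \<open>f\<close> lifts through
  the extension of \<open>g\<close>. This reduces arbitrary maps into d + a to maps that act on the
  shifted module.\<close>

lemma shift_factor:
  assumes f: "f \<in> hom m e (idx_add d a)"
  obtains c g k where "c \<in> obj m" "g \<in> hom m c d" "rng m c g = rng m e f \<inter> pts m d"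
    "k \<in> hom m e (idx_add c a)" "mcomp m e (shift_mor m a c d g) k = f"
proof -
  obtain c g where c: "c \<in> obj m" "g \<in> hom m c d" "rng m c g = rng m e f \<inter> pts m d"
    by (rule subobject[of "rng m e f \<inter> pts m d" m d]) auto
  have "rng m e f \<subseteq> rng m (idx_add c a) (shift_mor m a c d g)"
    using hom_rng[OF f] unfolding rng_shift_mor[OF c(2)] c(3) by blast
  then obtain k where "k \<in> hom m e (idx_add c a)" "mcomp m e (shift_mor m a c d g) k = f"
    by (rule hom_factor[OF f shift_mor_hom[OF c(2)]])
  then show ?thesis by (rule that[OF c])
qed

lemma mapp_shift_mor_image: "A \<subseteq> pts m d \<Longrightarrow> mapp (shift_mor m a d e f) ` A = mapp f ` A"
  by (intro image_cong refl shift_mor_mapp(1)) auto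

context fim_module
begin

lemma shift_fim:
  assumes a: "a \<in> obj m"
  shows "fim_module sc m (shift m a V)"
proof
  show "is_fim m sc (shift m a V)" unfolding is_fim_def shift_sp shift_act
  proof (intro conjI ballI allI)
    show "vector_space sc" by (rule vector_space_axioms)
  qed (use a in \<open>auto simp: idx_add_obj act_in act_add act_scale act_id act_comp shift_mor_hom shift_mor_idm
      shift_mor_mcomp subspace_0 subspace_add subspace_scale sp_subspace\<close>)
qed

lemma shift_fin_dim:
  assumes a: "a \<in> obj m" and "fin_dim"
  shows "fim_module.fin_dim sc m (shift m a V)"
proof -
  interpret S: fim_module sc m "shift m a V" by (rule shift_fim[OF a])
  show ?thesis using assms idx_add_obj by (auto simp: fin_dim_def S.fin_dim_def)
qed

text \<open>The source of the shifted map in \<open>shift_factor\<close> has only as many points as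
  \<open>f\<close> hits inside d, at most the number in e. Hence shifting never increases the size
  of generators.\<close>

lemma shift_gen_below:
  assumes a: "a \<in> obj m" and gen: "gen_below n"
  shows "fim_module.gen_below sc m (shift m a V) n"
proof -
  interpret S: fim_module sc m "shift m a V" by (rule shift_fim[OF a])
  show ?thesis unfolding S.gen_below_def
  proof
    fix d assume d: "d \<in> obj m"
    let ?G = "{act (shift m a V) e d f v | e f v. e \<in> obj m \<and> card (pts m e) < n \<and> f \<in> hom m e d \<and> v \<in> sp (shift m a V) e}"
    have da: "idx_add d a \<in> obj m" by (rule idx_add_obj[OF d a])
    have "sp V (idx_add d a) \<subseteq> span {act V e (idx_add d a) f v | e f v. e \<in> obj m \<and> card (pts m e) < n
        \<and> f \<in> hom m e (idx_add d a) \<and> v \<in> sp V e}"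
      using gen da unfolding gen_below_def by blast
    also have "\<dots> \<subseteq> span ?G"
    proof (rule span_minimal[OF _ subspace_span], rule subsetI, elim CollectE exE conjE)
      fix x e f v assume x: "x = act V e (idx_add d a) f v" "e \<in> obj m" "card (pts m e) < n"
        "f \<in> hom m e (idx_add d a)" "v \<in> sp V e"
      obtain c g k where c: "c \<in> obj m" "g \<in> hom m c d" "rng m c g = rng m e f \<inter> pts m d"
        "k \<in> hom m e (idx_add c a)" "mcomp m e (shift_mor m a c d g) k = f" by (rule shift_factor[OF x(4)])
      have ca: "idx_add c a \<in> obj m" by (rule idx_add_obj[OF c(1) a])
      have "card (pts m c) \<le> card (pts m e)"
        using card_rng[OF c(2)] card_rng[OF x(4)] c(3) card_mono[OF finite_rng, of "rng m e f \<inter> pts m d" m e f] by simp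
      moreover have "x = act (shift m a V) c d g (act V e (idx_add c a) k v)"
        using x(1) c(5) act_comp[OF x(2) ca da c(4) shift_mor_hom[OF c(2)] x(5)] by simp
      moreover have "act V e (idx_add c a) k v \<in> sp (shift m a V) c" using act_in[OF x(2) ca c(4) x(5)] by simp
      ultimately have "x \<in> ?G" using c(1,2) x(3) by fastforce
      then show "x \<in> span ?G" by (rule span_base)
    qed
    finally show "sp (shift m a V) d \<subseteq> span ?G" by simp
  qed
qed

text \<open>Since \<open>A\<close> lies in d, a map into d + a and the shifted map it passes through
  in \<open>shift_factor\<close> miss the same points of \<open>A\<close>. So each spanning vector
  on one side is also one on the other.\<close>

lemma low_shift:
  assumes a: "a \<in> obj m" and d: "d \<in> obj m" and A: "A \<subseteq> pts m d"
  shows "fim_module.low sc m (shift m a V) d A = low (idx_add d a) A"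
proof -
  interpret S: fim_module sc m "shift m a V" by (rule shift_fim[OF a])
  have da: "idx_add d a \<in> obj m" by (rule idx_add_obj[OF d a])
  show ?thesis
  proof
    show "S.low d A \<subseteq> low (idx_add d a) A"
    proof (rule S.low_least[OF subspace_low])
      fix e f v assume e: "e \<in> obj m" "f \<in> hom m e d" "v \<in> sp (shift m a V) e" "\<not> A \<subseteq> rng m e f"
      have "\<not> A \<subseteq> rng m (idx_add e a) (shift_mor m a e d f)"
        using e(4) A unfolding rng_shift_mor[OF e(2)] by blast
      then show "act (shift m a V) e d f v \<in> low (idx_add d a) A"
        using lowI[OF idx_add_obj[OF e(1) a] shift_mor_hom[OF e(2)]] e(3) by simp
    qed
    show "low (idx_add d a) A \<subseteq> S.low d A"
    proof (rule low_least[OF S.subspace_low])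
      fix e f v assume e: "e \<in> obj m" "f \<in> hom m e (idx_add d a)" "v \<in> sp V e" "\<not> A \<subseteq> rng m e f"
      obtain c g k where c: "c \<in> obj m" "g \<in> hom m c d" "rng m c g = rng m e f \<inter> pts m d"
        "k \<in> hom m e (idx_add c a)" "mcomp m e (shift_mor m a c d g) k = f" by (rule shift_factor[OF e(2)])
      have ca: "idx_add c a \<in> obj m" by (rule idx_add_obj[OF c(1) a])
      have "act V e (idx_add d a) f v = act (shift m a V) c d g (act V e (idx_add c a) k v)"
        using c(5) act_comp[OF e(1) ca da c(4) shift_mor_hom[OF c(2)] e(3)] by simp
      moreover have "act V e (idx_add c a) k v \<in> sp (shift m a V) c" using act_in[OF e(1) ca c(4) e(3)] by simp
      ultimately show "act V e (idx_add d a) f v \<in> S.low d A"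
        using S.lowI[OF c(1,2)] c(3) e(4) by simp
    qed
  qed
qed

text \<open>The maps acting on the shift are maps out of d + a of a special form, so torsion
  freeness of V in degree d + a restricts to them.\<close>

lemma shift_tfree:
  assumes a: "a \<in> obj m" and d: "d \<in> obj m" and A: "A \<subseteq> pts m d" and tf: "tfree (idx_add d a) A"
  shows "fim_module.tfree sc m (shift m a V) d A"
proof -
  interpret S: fim_module sc m "shift m a V" by (rule shift_fim[OF a])
  show ?thesis unfolding S.tfree_def
  proof (intro ballI impI)
    fix e g v assume e: "e \<in> obj m" and g: "g \<in> hom m d e" and v: "v \<in> sp (shift m a V) d"
      and gv: "act (shift m a V) d e g v \<in> S.low e (mapp g ` A)"
    have "mapp g ` A \<subseteq> pts m e" using A hom_mapp_in[OF g] by blast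
    then have "act V (idx_add d a) (idx_add e a) (shift_mor m a d e g) v
        \<in> low (idx_add e a) (mapp (shift_mor m a d e g) ` A)"
      using gv low_shift[OF a e] mapp_shift_mor_image[OF A] by simp
    then have "v \<in> low (idx_add d a) A"
      using tf v idx_add_obj[OF e a] shift_mor_hom[OF g] unfolding tfree_def shift_sp by blast
    then show "v \<in> S.low d A" using low_shift[OF a d A] by simp
  qed
qed

end

section \<open>Filtrations by generators\<close>

lemma free_sp: "sp (free m cs) d = {x. \<forall>i f. x i f \<noteq> 0 \<longrightarrow> i < length cs \<and> f \<in> hom m (cs ! i) d}"
  and free_act: "act (free m cs) d e g x = (\<lambda>i h. if i < length cs then
      (\<Sum>f\<in>{f \<in> hom m (cs ! i) d. mcomp m (cs ! i) g f = h}. x i f) else 0)"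
  by (simp_all add: free_def)

text \<open>The coefficient map t is a linear section, modulo U, of the map sending a formal combination of G
  to the corresponding combination of the vectors z s.\<close>

lemma (in vector_space) section_mod_subspace:
  assumes U: "subspace U" and fin: "finite G"
  obtains t :: "'b \<Rightarrow> 'i \<Rightarrow> 'a" where
    "\<And>w w'. \<lbrakk>w \<in> span (U \<union> z ` G); w' \<in> span (U \<union> z ` G)\<rbrakk> \<Longrightarrow> t (w + w') = t w + t w'"
    "\<And>w r. w \<in> span (U \<union> z ` G) \<Longrightarrow> t (scale r w) = (\<lambda>s. r * t w s)"
    "\<And>u. u \<in> U \<Longrightarrow> t u = (\<lambda>_. 0)"
    "\<And>w. w \<in> span (U \<union> z ` G) \<Longrightarrow> (\<Sum>s\<in>G. scale (t w s) (z s)) - w \<in> U"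
proof -
  obtain B where B: "B \<subseteq> U" "independent B" "U \<subseteq> span B" using maximal_independent_subset by blast
  have sB: "span B = U" using B U by (metis span_minimal subset_antisym)
  \<comment> \<open>Extending a basis of \<open>U\<close> by vectors among the \<open>z s\<close>
    makes \<open>U\<close> the common kernel of the coordinates outside \<open>B\<close>.\<close>
  obtain B' where B': "B \<subseteq> B'" "B' \<subseteq> B \<union> z ` G" "independent B'" "B \<union> z ` G \<subseteq> span B'"
    using maximal_independent_subset_extend[of B "B \<union> z ` G"] B(2) by blast
  have "U \<subseteq> span B'" using sB B'(1) span_mono by blast
  then have sp: "span (U \<union> z ` G) \<subseteq> span B'" using B'(4) by (intro span_minimal) auto
  define C where "C = B' - B"
  have C: "C \<subseteq> z ` G" "finite C" using B'(2) fin finite_subset[of C "z ` G"] by (auto simp: C_def)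
  have "\<forall>y\<in>C. \<exists>s. s \<in> G \<and> z s = y" using C by auto
  \<comment> \<open>Different indices may give the same vector, so one index is chosen for each new
    basis vector and carries its coordinate.\<close>
  then obtain sg where sg: "\<forall>y\<in>C. sg y \<in> G \<and> z (sg y) = y" by (rule bchoice[THEN exE])
  define t where "t w s = (if s \<in> sg ` C then representation B' w (z s) else 0)" for w s
  show ?thesis
  proof
    fix w w' assume "w \<in> span (U \<union> z ` G)" "w' \<in> span (U \<union> z ` G)"
    then show "t (w + w') = t w + t w'"
      using sp B'(3) by (intro ext) (auto simp: t_def representation_add subset_iff)
  next
    fix w r assume "w \<in> span (U \<union> z ` G)"
    then show "t (scale r w) = (\<lambda>s. r * t w s)"
      using sp B'(3) by (intro ext) (auto simp: t_def representation_scale subset_iff)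
  next
    fix u assume "u \<in> U"
    then have r: "representation B' u = representation B u"
      using representation_extend[OF B'(3) _ B'(1)] sB by blast
    have "representation B u y = 0" if "y \<in> C" for y
      using that representation_ne_zero[of B u y] by (auto simp: C_def)
    then show "t u = (\<lambda>_. 0)" using r sg by (intro ext) (auto simp: t_def)
  next
    fix w assume w: "w \<in> span (U \<union> z ` G)"
    let ?r = "representation B' w"
    have inj: "inj_on sg C" using sg by (metis inj_onI)
    have "(\<Sum>s\<in>G. scale (t w s) (z s)) = (\<Sum>s\<in>sg ` C. scale (?r (z s)) (z s))"
      using sg fin by (intro sum.mono_neutral_cong_right) (auto simp: t_def)
    also have "\<dots> = (\<Sum>y\<in>C. scale (?r y) y)"
      using sg by (simp add: sum.reindex[OF inj])
    finally have 1: "(\<Sum>s\<in>G. scale (t w s) (z s)) = (\<Sum>y\<in>C. scale (?r y) y)" .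
    have alg: "x = p + q \<Longrightarrow> p - x = - q" for x p q :: 'b by simp
    let ?R = "{b. ?r b \<noteq> 0}"
    have finR: "finite ?R" by (rule finite_representation)
    have RB: "?R \<subseteq> B'" using representation_ne_zero by blast
    have "w = (\<Sum>b\<in>?R. scale (?r b) b)" using sum_nonzero_representation_eq[OF B'(3)] w sp by force
    also have "\<dots> = (\<Sum>b\<in>C \<union> (?R \<inter> B). scale (?r b) b)"
      using finR C(2) RB by (intro sum.mono_neutral_left) (auto simp: C_def)
    also have "\<dots> = (\<Sum>b\<in>C. scale (?r b) b) + (\<Sum>b\<in>?R \<inter> B. scale (?r b) b)"
      using finR C(2) by (intro sum.union_disjoint) (auto simp: C_def)
    finally have "(\<Sum>s\<in>G. scale (t w s) (z s)) - w = - (\<Sum>b\<in>?R \<inter> B. scale (?r b) b)" unfolding 1 by (rule alg)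
    moreover have "(\<Sum>b\<in>?R \<inter> B. scale (?r b) b) \<in> U"
      using B(1) U by (intro subspace_sum subspace_scale) auto
    ultimately show "(\<Sum>s\<in>G. scale (t w s) (z s)) - w \<in> U" using U by (simp add: subspace_neg)
  qed
qed

section \<open>Submodules generated by elements\<close>

context fim_module
begin

text \<open>By Yoneda an element of degree c is a map out of M(c); this is the map out of the free
  module given by a list of elements together with their degrees.\<close>

definition gmap :: "(idx \<times> 'v) list \<Rightarrow> idx \<Rightarrow> 'k freev \<Rightarrow> 'v" where
  "gmap gs d y = (\<Sum>i<length gs. \<Sum>f\<in>hom m (fst (gs ! i)) d. sc (y i f) (act V (fst (gs ! i)) d f (snd (gs ! i))))"

definition gsub :: "(idx \<times> 'v) set \<Rightarrow> idx \<Rightarrow> 'v set" where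
  "gsub G d = span {act V c d f x | c x f. (c, x) \<in> G \<and> f \<in> hom m c d}"

definition valid_gens :: "(idx \<times> 'v) set \<Rightarrow> bool" where
  "valid_gens G \<longleftrightarrow> (\<forall>(c, x)\<in>G. c \<in> obj m \<and> x \<in> sp V c)"

lemma subspace_gsub [simp]: "subspace (gsub G d)"
  by (simp add: gsub_def)

lemma gsubI: "(c, x) \<in> G \<Longrightarrow> f \<in> hom m c d \<Longrightarrow> act V c d f x \<in> gsub G d"
  unfolding gsub_def by (rule span_base) blast

lemma gsub_least:
  assumes "subspace T" "\<And>c x f. (c, x) \<in> G \<Longrightarrow> f \<in> hom m c d \<Longrightarrow> act V c d f x \<in> T"
  shows "gsub G d \<subseteq> T"
  unfolding gsub_def by (rule span_minimal) (use assms in auto)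

lemma gsub_mono: "G \<subseteq> H \<Longrightarrow> gsub G d \<subseteq> gsub H d"
  by (rule gsub_least) (auto intro: gsubI)

lemma gsub_sub: "valid_gens G \<Longrightarrow> d \<in> obj m \<Longrightarrow> gsub G d \<subseteq> sp V d"
  by (rule gsub_least) (auto simp: valid_gens_def act_in sp_subspace)

lemma gsub_act:
  assumes G: "valid_gens G" and d: "d \<in> obj m" "e \<in> obj m" and g: "g \<in> hom m d e" and v: "v \<in> gsub G d"
  shows "act V d e g v \<in> gsub G e"
proof -
  have "gsub G d \<subseteq> {x \<in> sp V d. act V d e g x \<in> gsub G e}"
  proof (rule gsub_least)
    fix c x f assume c: "(c, x) \<in> G" "f \<in> hom m c d"
    then have "c \<in> obj m" "x \<in> sp V c" using G by (auto simp: valid_gens_def)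
    then show "act V c d f x \<in> {x \<in> sp V d. act V d e g x \<in> gsub G e}"
      using c d g by (auto simp: act_in act_comp intro!: gsubI mcomp_hom)
  qed (use d g act_vimage_subspace in auto)
  then show ?thesis using v by auto
qed

lemma gmap_add: "gmap gs d (y + z) = gmap gs d y + gmap gs d z"
  by (simp add: gmap_def scale_left_distrib sum.distrib)

lemma gmap_scale: "gmap gs d (free_sc a y) = sc a (gmap gs d y)"
  by (simp add: gmap_def free_sc_def scale_sum_right)

text \<open>Regrouping coefficients along the fibres of composition with \<open>g\<close> matches
  the action on the free module with the action on V.\<close>

lemma gmap_act:
  assumes G: "valid_gens (set gs)" and d: "d \<in> obj m" "e \<in> obj m" and g: "g \<in> hom m d e"
  shows "gmap gs e (act (free m (map fst gs)) d e g y) = act V d e g (gmap gs d y)"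
proof -
  have gi: "fst (gs ! i) \<in> obj m" "snd (gs ! i) \<in> sp V (fst (gs ! i))" if "i < length gs" for i
    using G that nth_mem[of i gs] by (auto simp: valid_gens_def case_prod_unfold)
  have "(\<Sum>h\<in>hom m c e. sc (\<Sum>f\<in>{f \<in> hom m c d. mcomp m c g f = h}. y i f) (act V c e h x))
      = act V d e g (\<Sum>f\<in>hom m c d. sc (y i f) (act V c d f x))" if c: "c \<in> obj m" "x \<in> sp V c" for c x i
  proof -
    have "(\<Sum>h\<in>hom m c e. sc (\<Sum>f\<in>{f \<in> hom m c d. mcomp m c g f = h}. y i f) (act V c e h x))
       = (\<Sum>h\<in>hom m c e. \<Sum>f\<in>{f \<in> hom m c d. mcomp m c g f = h}. sc (y i f) (act V c e (mcomp m c g f) x))"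
      by (intro sum.cong refl) (simp add: scale_sum_left)
    also have "\<dots> = (\<Sum>f\<in>hom m c d. sc (y i f) (act V c e (mcomp m c g f) x))"
      by (rule sum.group) (auto intro: mcomp_hom g)
    also have "\<dots> = (\<Sum>f\<in>hom m c d. act V d e g (sc (y i f) (act V c d f x)))"
      using c d g by (intro sum.cong refl) (simp add: act_scale act_in act_comp)
    also have "\<dots> = act V d e g (\<Sum>f\<in>hom m c d. sc (y i f) (act V c d f x))"
      using c d by (intro act_sum[symmetric] d g) (simp add: act_in subspace_scale sp_subspace)
    finally show ?thesis .
  qed
  then have "gmap gs e (act (free m (map fst gs)) d e g y) =
      (\<Sum>i<length gs. act V d e g (\<Sum>f\<in>hom m (fst (gs ! i)) d. sc (y i f) (act V (fst (gs ! i)) d f (snd (gs ! i)))))"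
    unfolding gmap_def free_act by (intro sum.cong refl) (simp add: gi)
  also have "\<dots> = act V d e g (gmap gs d y)" unfolding gmap_def
    using gi d by (intro act_sum[symmetric] d g) (simp add: act_in subspace_scale subspace_sum sp_subspace)
  finally show ?thesis .
qed

lemma gmap_hom:
  assumes "valid_gens (set gs)" "\<And>d y. d \<in> obj m \<Longrightarrow> y \<in> sp (free m (map fst gs)) d \<Longrightarrow> gmap gs d y \<in> W d"
  shows "is_hom m free_sc (free m (map fst gs)) sc (V\<lparr>sp := W\<rparr>) (gmap gs)"
  unfolding is_hom_def using assms by (simp add: gmap_add gmap_scale gmap_act)

text \<open>Restricting coefficients to positions below r leaves the first r generators, which
  identifies the filtration pieces with generated submodules.\<close>

lemma gmap_image:
  "gmap gs d ` {x \<in> sp (free m (map fst gs)) d. \<forall>i\<ge>r. \<forall>f. x i f = 0} = gsub (set (take r gs)) d"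
proof
  let ?Y = "{x \<in> sp (free m (map fst gs)) d. \<forall>i\<ge>r. \<forall>f. x i f = 0} :: 'k freev set"
  show "gmap gs d ` ?Y \<subseteq> gsub (set (take r gs)) d"
  proof (rule image_subsetI)
    fix y :: "'k freev" assume y: "y \<in> ?Y"
    have *: "gs ! i \<in> set (take r gs)" if "i < length gs" "i < r" for i
      using that nth_mem[of i "take r gs"] by simp
    have "sc (y i f) (act V (fst (gs ! i)) d f (snd (gs ! i))) \<in> gsub (set (take r gs)) d"
      if "i < length gs" "f \<in> hom m (fst (gs ! i)) d" for i f
    proof (cases "i < r")
      case True
      then have "act V (fst (gs ! i)) d f (snd (gs ! i)) \<in> gsub (set (take r gs)) d"
        using *[OF that(1) True] that(2) by (intro gsubI) simp_all
      then show ?thesis by (simp add: subspace_scale)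
    next
      case False
      then show ?thesis using y by (simp add: subspace_0)
    qed
    then show "gmap gs d y \<in> gsub (set (take r gs)) d"
      unfolding gmap_def by (intro subspace_sum[OF subspace_gsub]) auto
  qed
  show "gsub (set (take r gs)) d \<subseteq> gmap gs d ` ?Y"
  proof (rule gsub_least)
    show "subspace (gmap gs d ` ?Y)"
    proof (rule subspaceI)
      have "gmap gs d 0 = 0" by (simp add: gmap_def)
      moreover have "0 \<in> ?Y" by (simp add: free_sp)
      ultimately show "0 \<in> gmap gs d ` ?Y" by (rule image_eqI[OF sym])
    next
      fix u v assume "u \<in> gmap gs d ` ?Y" "v \<in> gmap gs d ` ?Y"
      then obtain y z where yz: "u = gmap gs d y" "v = gmap gs d z" "y \<in> ?Y" "z \<in> ?Y" by blast
      have "y + z \<in> ?Y" using yz(3,4) unfolding free_sp by (simp, metis add.right_neutral)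
      then show "u + v \<in> gmap gs d ` ?Y" unfolding yz(1,2) gmap_add[symmetric] by (rule imageI)
    next
      fix a u assume "u \<in> gmap gs d ` ?Y"
      then obtain y where y: "u = gmap gs d y" "y \<in> ?Y" by blast
      then have "free_sc a y \<in> ?Y" by (auto simp: free_sp free_sc_def)
      then show "sc a u \<in> gmap gs d ` ?Y" unfolding y(1) gmap_scale[symmetric] by (rule imageI)
    qed
  next
    fix c x f assume c: "(c, x) \<in> set (take r gs)" "f \<in> hom m c d"
    then obtain i where i: "i < length gs" "i < r" "gs ! i = (c, x)" by (auto simp: in_set_conv_nth)
    let ?y = "\<lambda>j h. if j = i \<and> h = f then 1 else 0 :: 'k"
    have yY: "?y \<in> ?Y" using i c by (auto simp: free_sp)
    have "gmap gs d ?y = act V c d f x"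
    proof -
      have "(\<Sum>h\<in>hom m (fst (gs ! j)) d. sc (?y j h) (act V (fst (gs ! j)) d h (snd (gs ! j))))
          = (if j = i then act V c d f x else 0)" for j
      proof (cases "j = i")
        case True
        then have "(\<Sum>h\<in>hom m (fst (gs ! j)) d. sc (?y j h) (act V (fst (gs ! j)) d h (snd (gs ! j))))
           = (\<Sum>h\<in>hom m c d. if h = f then act V c d h x else 0)"
          using i by (intro sum.cong) auto
        then show ?thesis using True c by simp
      qed simp
      then show ?thesis using i unfolding gmap_def by simp
    qed
    then show "act V c d f x \<in> gmap gs d ` ?Y" using yY by (rule image_eqI[OF sym])
  qed
qed

lemma filt_piece_gmap: "filt_piece m (map fst gs) (gmap gs) r d = gsub (set (take r gs)) d"
  unfolding filt_piece_def by (rule gmap_image)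

lemma gmap_image_full: "gmap gs d ` sp (free m (map fst gs)) d = gsub (set gs) d"
proof -
  have "{x \<in> sp (free m (map fst gs)) d. \<forall>i\<ge>length gs. \<forall>f. x i f = 0} = (sp (free m (map fst gs)) d :: 'k freev set)"
    by (fastforce simp: free_sp)
  then show ?thesis using gmap_image[of gs d "length gs"] by simp
qed


section \<open>Combinations of translates of one generator and their orbit components\<close>

definition comb :: "idx \<Rightarrow> 'v \<Rightarrow> (mor \<Rightarrow> 'k) \<Rightarrow> idx \<Rightarrow> 'v" where
  "comb c x \<alpha> d = (\<Sum>f\<in>hom m c d. sc (\<alpha> f) (act V c d f x))"

text \<open>The maps with the same range as \<open>h\<close> are the composites of \<open>h\<close>
  with automorphisms \<open>s\<close>. This is the part of the combination supported on that range,
  pulled back along \<open>h\<close> to degree c.\<close>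

definition orb :: "idx \<Rightarrow> 'v \<Rightarrow> (mor \<Rightarrow> 'k) \<Rightarrow> mor \<Rightarrow> 'v" where
  "orb c x \<alpha> h = (\<Sum>s\<in>hom m c c. sc (\<alpha> (mcomp m c h s)) (act V c c s x))"

lemma comb_add: "comb c x (\<lambda>f. \<alpha> f + \<beta> f) d = comb c x \<alpha> d + comb c x \<beta> d"
  by (simp add: comb_def scale_left_distrib sum.distrib)

lemma comb_diff: "comb c x (\<lambda>f. \<alpha> f - \<beta> f) d = comb c x \<alpha> d - comb c x \<beta> d"
  by (simp add: comb_def scale_left_diff_distrib sum_subtractf)

lemma comb_scale: "comb c x (\<lambda>f. a * \<alpha> f) d = sc a (comb c x \<alpha> d)"
  by (simp add: comb_def scale_sum_right)

lemma orb_add: "orb c x (\<lambda>f. \<alpha> f + \<beta> f) h = orb c x \<alpha> h + orb c x \<beta> h"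
  by (simp add: orb_def scale_left_distrib sum.distrib)

lemma orb_diff: "orb c x (\<lambda>f. \<alpha> f - \<beta> f) h = orb c x \<alpha> h - orb c x \<beta> h"
  by (simp add: orb_def scale_left_diff_distrib sum_subtractf)

lemma orb_scale: "orb c x (\<lambda>f. a * \<alpha> f) h = sc a (orb c x \<alpha> h)"
  by (simp add: orb_def scale_sum_right)

lemma comb_in: "comb c x \<alpha> d \<in> gsub (insert (c, x) G) d"
  unfolding comb_def by (intro subspace_sum subspace_scale subspace_gsub gsubI) auto

lemma gsub_insert_decomp:
  assumes "w \<in> gsub (insert (c, x) G) d"
  shows "\<exists>\<alpha>. w - comb c x \<alpha> d \<in> gsub G d"
proof -
  let ?T = "{w. \<exists>\<alpha>. w - comb c x \<alpha> d \<in> gsub G d}"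
  have "gsub (insert (c, x) G) d \<subseteq> ?T"
  proof (rule gsub_least)
    show "subspace ?T"
    proof (rule subspaceI)
      have "0 - comb c x (\<lambda>_. 0) d \<in> gsub G d" by (simp add: comb_def subspace_0)
      then show "0 \<in> ?T" by blast
    next
      fix u v assume "u \<in> ?T" "v \<in> ?T"
      then obtain \<alpha> \<beta> where ab: "u - comb c x \<alpha> d \<in> gsub G d" "v - comb c x \<beta> d \<in> gsub G d" by blast
      have "u + v - comb c x (\<lambda>f. \<alpha> f + \<beta> f) d = (u - comb c x \<alpha> d) + (v - comb c x \<beta> d)"
        by (simp add: comb_add)
      then have "u + v - comb c x (\<lambda>f. \<alpha> f + \<beta> f) d \<in> gsub G d" using ab by (simp only: subspace_add[OF subspace_gsub])
      then show "u + v \<in> ?T" by blast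
    next
      fix a u assume "u \<in> ?T"
      then obtain \<alpha> where ab: "u - comb c x \<alpha> d \<in> gsub G d" by blast
      have "sc a u - comb c x (\<lambda>f. a * \<alpha> f) d = sc a (u - comb c x \<alpha> d)"
        by (simp add: comb_scale scale_right_diff_distrib)
      then have "sc a u - comb c x (\<lambda>f. a * \<alpha> f) d \<in> gsub G d" using ab by (simp only: subspace_scale[OF subspace_gsub])
      then show "sc a u \<in> ?T" by blast
    qed
  next
    fix c' x' f assume f: "(c', x') \<in> insert (c, x) G" "f \<in> hom m c' d"
    show "act V c' d f x' \<in> ?T"
    proof (cases "(c', x') = (c, x)")
      case True
      have "comb c x (\<lambda>h. if h = f then 1 else 0) d = (\<Sum>h\<in>hom m c d. if h = f then act V c d h x else 0)"
        unfolding comb_def by (intro sum.cong) auto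
      also have "\<dots> = act V c d f x" using True f by simp
      finally have "act V c' d f x' - comb c x (\<lambda>h. if h = f then 1 else 0) d \<in> gsub G d"
        using True by (simp add: subspace_0)
      then show ?thesis by blast
    next
      case False
      then have "act V c' d f x' \<in> gsub G d" using f by (intro gsubI) auto
      then have "act V c' d f x' - comb c x (\<lambda>_. 0) d \<in> gsub G d" by (simp add: comb_def)
      then show ?thesis by blast
    qed
  qed
  then show ?thesis using assms by blast
qed

text \<open>Generators in \<open>G\<close> have at most as many points as c. A map from one of them
  that covers the range of \<open>h\<close> therefore has exactly that range and lifts through
  \<open>h\<close>, staying in the submodule; any other map lands in \<open>low\<close>.\<close>

lemma gsub_approx:
  assumes G: "valid_gens G" and le: "\<forall>p\<in>G. card (pts m (fst p)) \<le> card (pts m c)"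
    and c: "c \<in> obj m" and d: "d \<in> obj m" and h: "h \<in> hom m c d" and u: "u \<in> gsub G d"
  shows "\<exists>u'\<in>gsub G c. u - act V c d h u' \<in> low d (rng m c h)"
proof -
  let ?T = "{u. \<exists>u'\<in>gsub G c. u - act V c d h u' \<in> low d (rng m c h)}"
  note sub = subsetD[OF gsub_sub[OF G c]]
  have "gsub G d \<subseteq> ?T"
  proof (rule gsub_least)
    show "subspace ?T"
    proof (rule subspaceI)
      have "0 - act V c d h 0 \<in> low d (rng m c h)" using act_zero[OF c d h] by (simp add: subspace_0)
      then show "0 \<in> ?T" using subspace_0[OF subspace_gsub] by blast
    next
      fix y z assume "y \<in> ?T" "z \<in> ?T"
      then obtain w w' where w: "w \<in> gsub G c" "w' \<in> gsub G c" "y - act V c d h w \<in> low d (rng m c h)"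
        "z - act V c d h w' \<in> low d (rng m c h)" by blast
      have "y + z - act V c d h (w + w') = (y - act V c d h w) + (z - act V c d h w')"
        using act_add[OF c d h sub[OF w(1)] sub[OF w(2)]] by simp
      then have "y + z - act V c d h (w + w') \<in> low d (rng m c h)" using w(3,4) by (simp only: subspace_add[OF subspace_low])
      then show "y + z \<in> ?T" using subspace_add[OF subspace_gsub w(1,2)] by blast
    next
      fix a y assume "y \<in> ?T"
      then obtain w where w: "w \<in> gsub G c" "y - act V c d h w \<in> low d (rng m c h)" by blast
      have "sc a y - act V c d h (sc a w) = sc a (y - act V c d h w)"
        using act_scale[OF c d h sub[OF w(1)]] by (simp add: scale_right_diff_distrib)
      then have "sc a y - act V c d h (sc a w) \<in> low d (rng m c h)" using w(2) by (simp only: subspace_scale[OF subspace_low])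
      then show "sc a y \<in> ?T" using subspace_scale[OF subspace_gsub w(1)] by blast
    qed
  next
    fix c' x' f assume f: "(c', x') \<in> G" "f \<in> hom m c' d"
    have c': "c' \<in> obj m" "x' \<in> sp V c'" using G f by (auto simp: valid_gens_def)
    show "act V c' d f x' \<in> ?T"
    proof (cases "rng m c h \<subseteq> rng m c' f")
      case True
      then have "rng m c h = rng m c' f"
        using bspec[OF le f(1)] card_rng[OF h] card_rng[OF f(2)] by (intro card_seteq) auto
      then obtain k where k: "k \<in> hom m c' c" "mcomp m c' h k = f" using hom_factor[OF f(2) h] by blast
      have "act V c' d f x' - act V c d h (act V c' c k x') = 0" using act_comp[OF c'(1) c d k(1) h c'(2)] k(2) by simp
      then have "act V c' d f x' - act V c d h (act V c' c k x') \<in> low d (rng m c h)" by (simp add: subspace_0)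
      then show ?thesis using gsubI[OF f(1) k(1)] by blast
    next
      case False
      then have "act V c' d f x' - act V c d h 0 \<in> low d (rng m c h)"
        using lowI[OF c'(1) f(2) c'(2)] act_zero[OF c d h] by simp
      then show ?thesis using subspace_0[OF subspace_gsub] by blast
    qed
  qed
  then show ?thesis using u by blast
qed

text \<open>All maps from c hit equally many points, so a term whose range differs from that of
  \<open>h\<close> misses one of its points and lies in \<open>low\<close>. What remains is the
  orbit of \<open>h\<close> under automorphisms.\<close>

lemma comb_approx:
  assumes c: "c \<in> obj m" "x \<in> sp V c" and d: "d \<in> obj m" and h: "h \<in> hom m c d"
  shows "comb c x \<alpha> d - act V c d h (orb c x \<alpha> h) \<in> low d (rng m c h)"
proof -
  let ?H = "{f \<in> hom m c d. rng m c f = rng m c h}"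
  have H: "(\<lambda>s. mcomp m c h s) ` hom m c c = ?H"
  proof
    show "(\<lambda>s. mcomp m c h s) ` hom m c c \<subseteq> ?H"
    proof (rule image_subsetI)
      fix s assume s: "s \<in> hom m c c"
      have "rng m c s = pts m c" using hom_rng[OF s] card_rng[OF s] by (simp add: card_subset_eq)
      then show "mcomp m c h s \<in> ?H" using mcomp_hom[OF s h] by (simp add: rng_mcomp) (simp add: rng_def)
    qed
    show "?H \<subseteq> (\<lambda>s. mcomp m c h s) ` hom m c c"
    proof
      fix f assume f: "f \<in> ?H"
      then have "f \<in> hom m c d" "rng m c f \<subseteq> rng m c h" by auto
      then obtain k where "k \<in> hom m c c" "mcomp m c h k = f" using hom_factor[OF _ h] by blast
      then show "f \<in> (\<lambda>s. mcomp m c h s) ` hom m c c" by blast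
    qed
  qed
  have inj: "inj_on (\<lambda>s. mcomp m c h s) (hom m c c)"
    by (rule inj_onI) (rule mcomp_left_inj[OF h])
  have "act V c d h (orb c x \<alpha> h) = (\<Sum>s\<in>hom m c c. act V c d h (sc (\<alpha> (mcomp m c h s)) (act V c c s x)))"
    unfolding orb_def using c by (intro act_sum d h) (auto intro: act_in subspace_scale sp_subspace)
  also have "\<dots> = (\<Sum>s\<in>hom m c c. sc (\<alpha> (mcomp m c h s)) (act V c d (mcomp m c h s) x))"
    using c d h by (intro sum.cong refl) (simp add: act_scale act_in act_comp)
  also have "\<dots> = (\<Sum>f\<in>?H. sc (\<alpha> f) (act V c d f x))"
    unfolding H[symmetric] by (simp add: sum.reindex[OF inj])
  finally have 1: "act V c d h (orb c x \<alpha> h) = (\<Sum>f\<in>?H. sc (\<alpha> f) (act V c d f x))" .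
  have "comb c x \<alpha> d = (\<Sum>f\<in>hom m c d - ?H. sc (\<alpha> f) (act V c d f x)) + (\<Sum>f\<in>?H. sc (\<alpha> f) (act V c d f x))"
    unfolding comb_def by (rule sum.subset_diff) auto
  then have "comb c x \<alpha> d - act V c d h (orb c x \<alpha> h) = (\<Sum>f\<in>hom m c d - ?H. sc (\<alpha> f) (act V c d f x))"
    using 1 by simp
  also have "\<dots> \<in> low d (rng m c h)"
  proof (intro subspace_sum subspace_scale subspace_low)
    fix f assume f: "f \<in> hom m c d - ?H"
    then have "\<not> rng m c h \<subseteq> rng m c f"
      using card_rng[OF h] card_rng[of f m c d] card_subset_eq[of "rng m c f" "rng m c h"] by auto
    then show "act V c d f x \<in> low d (rng m c h)" using f c lowI by blast
  qed
  finally show ?thesis .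
qed

text \<open>The combination has two approximations along \<open>h\<close>, by its orbit component
  and by an element of the submodule. Torsion freeness cancels \<open>h\<close> from their
  difference, and the error in \<open>low c (pts m c)\<close> comes from degrees with fewer points,
  which \<open>G\<close> already fills. So a relation modulo \<open>G\<close> holds on each orbit
  separately, that is, the quotient is induced from degree c.\<close>

lemma orb_in_gsub:
  assumes G: "valid_gens G" and le: "\<forall>p\<in>G. card (pts m (fst p)) \<le> card (pts m c)"
    and lower: "\<And>e. e \<in> obj m \<Longrightarrow> card (pts m e) < card (pts m c) \<Longrightarrow> sp V e \<subseteq> gsub G e"
    and tf: "tfree c (pts m c)"
    and c: "c \<in> obj m" "x \<in> sp V c" and d: "d \<in> obj m" and h: "h \<in> hom m c d"
    and \<alpha>: "comb c x \<alpha> d \<in> gsub G d"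
  shows "orb c x \<alpha> h \<in> gsub G c"
proof -
  have orb: "orb c x \<alpha> h \<in> sp V c"
    unfolding orb_def using c by (intro subspace_sum subspace_scale sp_subspace act_in) auto
  obtain u' where u': "u' \<in> gsub G c" "comb c x \<alpha> d - act V c d h u' \<in> low d (rng m c h)"
    using gsub_approx[OF G le c(1) d h \<alpha>] by blast
  have u's: "u' \<in> sp V c" using u' gsub_sub[OF G c(1)] by blast
  have "(comb c x \<alpha> d - act V c d h u') - (comb c x \<alpha> d - act V c d h (orb c x \<alpha> h)) \<in> low d (rng m c h)"
    by (rule subspace_diff[OF subspace_low u'(2) comb_approx[OF c d h]])
  then have "act V c d h (orb c x \<alpha> h - u') \<in> low d (mapp h ` pts m c)"
    using act_diff[OF c(1) d h orb u's] by (simp add: rng_def)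
  then have "orb c x \<alpha> h - u' \<in> low c (pts m c)"
    using tf d h subspace_diff[OF sp_subspace[OF c(1)] orb u's] unfolding tfree_def by blast
  moreover have "low c (pts m c) \<subseteq> gsub G c"
  proof (rule low_least[OF subspace_gsub])
    fix e f v assume e: "e \<in> obj m" "f \<in> hom m e c" "v \<in> sp V e" "\<not> pts m c \<subseteq> rng m e f"
    have "rng m e f \<subset> pts m c" using e(4) hom_rng[OF e(2)] by blast
    then have "card (pts m e) < card (pts m c)" using card_rng[OF e(2)] psubset_card_mono[OF finite_pts] by metis
    then show "act V e c f v \<in> gsub G c" using lower[OF e(1)] e(3) gsub_act[OF G e(1) c(1) e(2)] by blast
  qed
  ultimately have "(orb c x \<alpha> h - u') + u' \<in> gsub G c" using u'(1) by (intro subspace_add subspace_gsub) auto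
  then show ?thesis by simp
qed

text \<open>The action of \<open>g\<close> on the coefficients of an element of M(c).\<close>

definition push :: "idx \<Rightarrow> idx \<Rightarrow> mor \<Rightarrow> (mor \<Rightarrow> 'k) \<Rightarrow> mor \<Rightarrow> 'k" where
  "push c d g \<alpha> h = (\<Sum>f\<in>{f \<in> hom m c d. mcomp m c g f = h}. \<alpha> f)"

lemma comb_push:
  assumes c: "c \<in> obj m" "x \<in> sp V c" and d: "d \<in> obj m" "e \<in> obj m" and g: "g \<in> hom m d e"
  shows "comb c x (push c d g \<alpha>) e = act V d e g (comb c x \<alpha> d)"
proof -
  have "valid_gens (set [(c, x)])" using c by (simp add: valid_gens_def)
  from gmap_act[OF this d g, of "\<lambda>_. \<alpha>"]
  show ?thesis unfolding gmap_def free_act comb_def push_def by simp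
qed

text \<open>Left cancellation of \<open>g\<close> leaves exactly one term in each pushed
  coefficient.\<close>

lemma orb_push:
  assumes d: "d \<in> obj m" and g: "g \<in> hom m d e" and h: "h \<in> hom m c d"
  shows "orb c x (push c d g \<alpha>) (mcomp m c g h) = orb c x \<alpha> h"
proof -
  have "push c d g \<alpha> (mcomp m c (mcomp m c g h) s) = \<alpha> (mcomp m c h s)" if s: "s \<in> hom m c c" for s
  proof -
    have hs: "mcomp m c h s \<in> hom m c d" by (rule mcomp_hom[OF s h])
    have eq: "mcomp m c (mcomp m c g h) s = mcomp m c g (mcomp m c h s)"
      by (rule mcomp_assoc[OF s h g, symmetric])
    have "{f \<in> hom m c d. mcomp m c g f = mcomp m c (mcomp m c g h) s} = {mcomp m c h s}"
      unfolding eq using hs mcomp_left_inj[OF g _ hs] by auto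
    then show ?thesis by (simp add: push_def)
  qed
  then show ?thesis unfolding orb_def by (intro sum.cong) auto
qed

text \<open>Automorphisms do not change ranges, so if a composite of \<open>h\<close> with some
  \<open>s\<close> factored through \<open>g\<close>, then \<open>h\<close> would as well. Hence
  every pushed coefficient involved is an empty sum.\<close>

lemma orb_push_zero:
  assumes g: "g \<in> hom m d e" and h: "h \<in> hom m c e" "h \<notin> mcomp m c g ` hom m c d"
  shows "orb c x (push c d g \<alpha>) h = 0"
proof -
  have "push c d g \<alpha> (mcomp m c h s) = 0" if s: "s \<in> hom m c c" for s
  proof -
    have "{f \<in> hom m c d. mcomp m c g f = mcomp m c h s} = {}"
    proof (rule ccontr)
      assume "\<not> ?thesis"
      then obtain f where f: "f \<in> hom m c d" "mcomp m c g f = mcomp m c h s" by blast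
      have rs: "rng m c s = pts m c" using hom_rng[OF s] card_rng[OF s] by (simp add: card_subset_eq)
      have "rng m c h = rng m c (mcomp m c h s)" unfolding rng_mcomp rs by (simp add: rng_def)
      also have "\<dots> \<subseteq> rng m d g" unfolding f(2)[symmetric] rng_mcomp using hom_rng[OF f(1)] by (auto simp: rng_def)
      finally obtain k where "k \<in> hom m c d" "mcomp m c g k = h" using hom_factor[OF h(1) g] by blast
      then show False using h(2) by blast
    qed
    then show ?thesis unfolding push_def by (simp only: sum.empty)
  qed
  then show ?thesis unfolding orb_def by simp
qed


text \<open>Maschke averaging: with t a linear section of the orbit map in degree c, the section of
  the whole quotient is the average over all h of the pushforwards along h of t applied to the
  h-component.\<close>

lemma quot_proj_step:
  assumes G: "valid_gens G" and le: "\<forall>p\<in>G. card (pts m (fst p)) \<le> card (pts m c)"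
    and lower: "\<And>e. e \<in> obj m \<Longrightarrow> card (pts m e) < card (pts m c) \<Longrightarrow> sp V e \<subseteq> gsub G e"
    and tf: "tfree c (pts m c)" and c: "c \<in> obj m" "x \<in> sp V c"
    and char: "(of_nat (card (hom m c c)) :: 'k) \<noteq> 0"
  shows "quot_proj m sc (V\<lparr>sp := gsub (insert (c, x) G)\<rparr>) (gsub G)"
proof -
  let ?H = "gsub (insert (c, x) G)" and ?C = "hom m c c"
  let ?z = "\<lambda>s. act V c c s x"
  let ?W = "span (gsub G c \<union> ?z ` ?C)"
  define \<nu> where "\<nu> = inverse (of_nat (card ?C) :: 'k)"
  have \<nu>: "\<nu> * of_nat (card ?C) = 1" using char by (simp add: \<nu>_def)
  obtain t :: "'v \<Rightarrow> mor \<Rightarrow> 'k" where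
    t_add: "\<And>w w'. \<lbrakk>w \<in> ?W; w' \<in> ?W\<rbrakk> \<Longrightarrow> t (w + w') = t w + t w'" and
    t_scale: "\<And>w r. w \<in> ?W \<Longrightarrow> t (sc r w) = (\<lambda>s. r * t w s)" and
    t_U: "\<And>u. u \<in> gsub G c \<Longrightarrow> t u = (\<lambda>_. 0)" and
    t_sec: "\<And>w. w \<in> ?W \<Longrightarrow> (\<Sum>s\<in>?C. sc (t w s) (?z s)) - w \<in> gsub G c"
    by (rule section_mod_subspace[OF subspace_gsub finite_hom, where z = ?z]) blast
  have orbW: "orb c x \<alpha> h \<in> ?W" for \<alpha> h
    unfolding orb_def by (intro span_sum span_scale span_base) auto
  have t_eq: "t w = t w'" if "w \<in> ?W" "w' \<in> ?W" "w - w' \<in> gsub G c" for w w'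
  proof -
    have "w - w' \<in> ?W" using that by (simp add: span_diff)
    then have "t ((w - w') + w') = t (w - w') + t w'" using that by (intro t_add)
    then show ?thesis using t_U[OF that(3)] by (simp add: fun_eq_iff)
  qed
  \<comment> \<open>The coefficient of k collects all ways of writing k as a composite of h and s.
    The weight \<open>\<nu>\<close> corrects for the fact that each range is the range of
    \<open>card ?C\<close> different maps h.\<close>
  define S :: "(mor \<Rightarrow> 'k) \<Rightarrow> idx \<Rightarrow> 'k freev" where
    "S \<alpha> d = (\<lambda>i k. if i = 0 \<and> k \<in> hom m c d then
       \<nu> * (\<Sum>h\<in>hom m c d. \<Sum>s\<in>?C. if mcomp m c h s = k then t (orb c x \<alpha> h) s else 0) else 0)" for \<alpha> d
  \<comment> \<open>\<open>S\<close> depends only on the class modulo \<open>G\<close>: by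
    \<open>orb_in_gsub\<close> congruent combinations have congruent orbit components, and
    \<open>t\<close> does not distinguish these.\<close>
  have S_eq: "S \<alpha> d = S \<beta> d" if d: "d \<in> obj m" and "comb c x \<alpha> d - comb c x \<beta> d \<in> gsub G d" for \<alpha> \<beta> d
  proof -
    have "t (orb c x \<alpha> h) = t (orb c x \<beta> h)" if h: "h \<in> hom m c d" for h
    proof (rule t_eq[OF orbW orbW])
      have "comb c x (\<lambda>f. \<alpha> f - \<beta> f) d \<in> gsub G d" using \<open>comb c x \<alpha> d - comb c x \<beta> d \<in> gsub G d\<close> by (simp add: comb_diff)
      from orb_in_gsub[OF G le lower tf c d h this] show "orb c x \<alpha> h - orb c x \<beta> h \<in> gsub G c"
        by (simp add: orb_diff)
    qed
    then show ?thesis unfolding S_def by (auto simp: fun_eq_iff intro!: arg_cong[where f = "(*) \<nu>"] sum.cong)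
  qed
  have S_add: "S (\<lambda>f. \<alpha> f + \<beta> f) d = S \<alpha> d + S \<beta> d" for \<alpha> \<beta> d
  proof -
    have "(if mcomp m c h s = k then t (orb c x (\<lambda>f. \<alpha> f + \<beta> f) h) s else 0) =
        (if mcomp m c h s = k then t (orb c x \<alpha> h) s else 0) + (if mcomp m c h s = k then t (orb c x \<beta> h) s else 0)" for h s k
      by (simp add: orb_add t_add[OF orbW orbW])
    then show ?thesis unfolding S_def by (auto simp: fun_eq_iff sum.distrib distrib_left)
  qed
  have S_scale: "S (\<lambda>f. a * \<alpha> f) d = free_sc a (S \<alpha> d)" for a \<alpha> d
  proof -
    have "(if mcomp m c h s = k then t (orb c x (\<lambda>f. a * \<alpha> f) h) s else 0) =
        a * (if mcomp m c h s = k then t (orb c x \<alpha> h) s else 0)" for h s k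
      by (simp add: orb_scale t_scale[OF orbW])
    then show ?thesis unfolding S_def free_sc_def by (auto simp: fun_eq_iff sum_distrib_left[symmetric] mult.left_commute)
  qed
  have S_sp: "S \<alpha> d \<in> sp (free m [c]) d" for \<alpha> d
    by (auto simp: free_sp S_def split: if_splits)
  have S_act: "S (push c d g \<alpha>) e = act (free m [c]) d e g (S \<alpha> d)"
    if d: "d \<in> obj m" "e \<in> obj m" and g: "g \<in> hom m d e" for \<alpha> d e g
  proof (intro ext)
    fix i k
    show "S (push c d g \<alpha>) e i k = act (free m [c]) d e g (S \<alpha> d) i k"
    proof (cases "i = 0 \<and> k \<in> hom m c e")
      case False
      have "{f \<in> hom m c d. mcomp m c g f = k} = {}" if "k \<notin> hom m c e"
        using mcomp_hom[OF _ g] that by blast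
      then have "i = 0 \<Longrightarrow> (\<Sum>f\<in>{f \<in> hom m c d. mcomp m c g f = k}. S \<alpha> d i f) = 0"
        using False by (simp only: sum.empty simp_thms)
      then show ?thesis using False unfolding free_act by (auto simp: S_def)
    next
      case True
      let ?T = "\<lambda>\<alpha> h s. t (orb c x \<alpha> h) s"
      have inj: "inj_on (mcomp m c g) (hom m c d)" by (rule inj_onI) (rule mcomp_left_inj[OF g])
      \<comment> \<open>Maps h that do not factor through g have zero orbit component by
        \<open>orb_push_zero\<close>, so the sum runs over the image of composition with g.\<close>
      have "(\<Sum>h\<in>hom m c e. \<Sum>s\<in>?C. if mcomp m c h s = k then ?T (push c d g \<alpha>) h s else 0)
          = (\<Sum>h\<in>mcomp m c g ` hom m c d. \<Sum>s\<in>?C. if mcomp m c h s = k then ?T (push c d g \<alpha>) h s else 0)"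
      proof (rule sum.mono_neutral_right)
        show "mcomp m c g ` hom m c d \<subseteq> hom m c e" using mcomp_hom[OF _ g] by blast
        show "\<forall>h\<in>hom m c e - mcomp m c g ` hom m c d.
          (\<Sum>s\<in>?C. if mcomp m c h s = k then ?T (push c d g \<alpha>) h s else 0) = 0"
        proof
          fix h assume "h \<in> hom m c e - mcomp m c g ` hom m c d"
          then have "orb c x (push c d g \<alpha>) h = 0" using orb_push_zero[OF g] by blast
          then show "(\<Sum>s\<in>?C. if mcomp m c h s = k then ?T (push c d g \<alpha>) h s else 0) = 0"
            using t_U[OF subspace_0[OF subspace_gsub]] by (intro sum.neutral) simp
        qed
      qed auto
      also have "\<dots> = (\<Sum>h\<in>hom m c d. \<Sum>s\<in>?C. if mcomp m c (mcomp m c g h) s = k then ?T \<alpha> h s else 0)"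
        unfolding sum.reindex[OF inj] o_def
        by (intro sum.cong refl) (simp add: orb_push[OF d(1) g])
      \<comment> \<open>The condition that g carries the composite of h and s to k says that this
        composite lies in the fibre of k; writing it as a sum over that fibre allows the summations
        to be exchanged.\<close>
      also have "\<dots> = (\<Sum>h\<in>hom m c d. \<Sum>s\<in>?C. \<Sum>f\<in>{f \<in> hom m c d. mcomp m c g f = k}. if mcomp m c h s = f then ?T \<alpha> h s else 0)"
      proof (intro sum.cong refl)
        fix h s assume h: "h \<in> hom m c d" and s: "s \<in> ?C"
        have "mcomp m c (mcomp m c g h) s = mcomp m c g (mcomp m c h s)" by (rule mcomp_assoc[OF s h g, symmetric])
        moreover have "mcomp m c h s \<in> hom m c d" by (rule mcomp_hom[OF s h])
        ultimately show "(if mcomp m c (mcomp m c g h) s = k then ?T \<alpha> h s else 0) =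
          (\<Sum>f\<in>{f \<in> hom m c d. mcomp m c g f = k}. if mcomp m c h s = f then ?T \<alpha> h s else 0)"
          by (subst sum.delta') simp_all
      qed
      also have "\<dots> = (\<Sum>f\<in>{f \<in> hom m c d. mcomp m c g f = k}. \<Sum>h\<in>hom m c d. \<Sum>s\<in>?C. if mcomp m c h s = f then ?T \<alpha> h s else 0)"
        by (simp only: sum.swap[of _ "{f \<in> hom m c d. mcomp m c g f = k}"])
      finally have "S (push c d g \<alpha>) e i k = (\<Sum>f\<in>{f \<in> hom m c d. mcomp m c g f = k}. \<nu> *
          (\<Sum>h\<in>hom m c d. \<Sum>s\<in>?C. if mcomp m c h s = f then ?T \<alpha> h s else 0))"
        using True unfolding S_def by (simp add: sum_distrib_left)
      then show ?thesis using True unfolding free_act by (simp add: S_def)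
    qed
  qed
  have S_sec: "comb c x (S \<alpha> d 0) d - comb c x \<alpha> d \<in> gsub G d" if d: "d \<in> obj m" for \<alpha> d
  proof -
    let ?T = "\<lambda>h s. t (orb c x \<alpha> h) s"
    have pull: "act V c d h (\<Sum>s\<in>?C. sc (b s) (?z s)) = (\<Sum>s\<in>?C. sc (b s) (act V c d (mcomp m c h s) x))"
      if h: "h \<in> hom m c d" for h b
    proof -
      have "act V c d h (\<Sum>s\<in>?C. sc (b s) (?z s)) = (\<Sum>s\<in>?C. act V c d h (sc (b s) (?z s)))"
        using c by (intro act_sum d h) (auto intro: act_in subspace_scale sp_subspace)
      also have "\<dots> = (\<Sum>s\<in>?C. sc (b s) (act V c d (mcomp m c h s) x))"
        using c d h by (intro sum.cong refl) (simp add: act_scale act_in act_comp)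
      finally show ?thesis .
    qed
    have "comb c x (S \<alpha> d 0) d = (\<Sum>k\<in>hom m c d. sc \<nu> (\<Sum>h\<in>hom m c d. \<Sum>s\<in>?C.
        if mcomp m c h s = k then sc (?T h s) (act V c d k x) else 0))"
      unfolding comb_def
    proof (intro sum.cong refl)
      fix k assume "k \<in> hom m c d"
      then have "S \<alpha> d 0 k = \<nu> * (\<Sum>h\<in>hom m c d. \<Sum>s\<in>?C. if mcomp m c h s = k then ?T h s else 0)" by (simp add: S_def)
      then have "sc (S \<alpha> d 0 k) (act V c d k x) = sc \<nu> (\<Sum>h\<in>hom m c d. \<Sum>s\<in>?C.
         sc (if mcomp m c h s = k then ?T h s else 0) (act V c d k x))"
        by (simp only: scale_scale[symmetric] scale_sum_left)
      also have "\<dots> = sc \<nu> (\<Sum>h\<in>hom m c d. \<Sum>s\<in>?C. if mcomp m c h s = k then sc (?T h s) (act V c d k x) else 0)"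
        by (intro arg_cong[where f = "sc \<nu>"] sum.cong refl) simp
      finally show "sc (S \<alpha> d 0 k) (act V c d k x) =
        sc \<nu> (\<Sum>h\<in>hom m c d. \<Sum>s\<in>?C. if mcomp m c h s = k then sc (?T h s) (act V c d k x) else 0)" .
    qed
    also have "\<dots> = sc \<nu> (\<Sum>k\<in>hom m c d. \<Sum>h\<in>hom m c d. \<Sum>s\<in>?C. if mcomp m c h s = k then sc (?T h s) (act V c d k x) else 0)"
      by (simp only: scale_sum_right)
    also have "\<dots> = sc \<nu> (\<Sum>h\<in>hom m c d. \<Sum>k\<in>hom m c d. \<Sum>s\<in>?C. if mcomp m c h s = k then sc (?T h s) (act V c d k x) else 0)"
      by (intro arg_cong[where f = "sc \<nu>"] sum.swap)
    also have "\<dots> = sc \<nu> (\<Sum>h\<in>hom m c d. \<Sum>s\<in>?C. \<Sum>k\<in>hom m c d. if mcomp m c h s = k then sc (?T h s) (act V c d k x) else 0)"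
      by (intro arg_cong[where f = "sc \<nu>"] sum.cong refl sum.swap)
    also have "\<dots> = sc \<nu> (\<Sum>h\<in>hom m c d. \<Sum>s\<in>?C. sc (?T h s) (act V c d (mcomp m c h s) x))"
    proof (intro arg_cong[where f = "sc \<nu>"] sum.cong refl)
      fix h s assume "h \<in> hom m c d" "s \<in> ?C"
      then have "mcomp m c h s \<in> hom m c d" using mcomp_hom by blast
      then show "(\<Sum>k\<in>hom m c d. if mcomp m c h s = k then sc (?T h s) (act V c d k x) else 0) =
        sc (?T h s) (act V c d (mcomp m c h s) x)" by simp
    qed
    also have "\<dots> = sc \<nu> (\<Sum>h\<in>hom m c d. act V c d h (\<Sum>s\<in>?C. sc (?T h s) (?z s)))"
      by (intro arg_cong[where f = "sc \<nu>"] sum.cong refl) (simp add: pull)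
    finally have 1: "comb c x (S \<alpha> d 0) d = sc \<nu> (\<Sum>h\<in>hom m c d. act V c d h (\<Sum>s\<in>?C. sc (?T h s) (?z s)))" .
    have "(\<Sum>h\<in>hom m c d. act V c d h (orb c x \<alpha> h))
        = (\<Sum>h\<in>hom m c d. \<Sum>s\<in>?C. sc (\<alpha> (mcomp m c h s)) (act V c d (mcomp m c h s) x))"
      unfolding orb_def by (intro sum.cong refl) (simp add: pull)
    also have "\<dots> = (\<Sum>s\<in>?C. \<Sum>h\<in>hom m c d. sc (\<alpha> (mcomp m c h s)) (act V c d (mcomp m c h s) x))"
      by (rule sum.swap)
    \<comment> \<open>For fixed s, precomposition with s permutes the maps from c to d, so each
      inner sum is the whole combination.\<close>
    also have "\<dots> = (\<Sum>s\<in>?C. comb c x \<alpha> d)"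
      unfolding comb_def
      by (rule sum.cong[OF refl], rule sum.reindex_bij_betw[OF mcomp_right_bij, where g = "\<lambda>f. sc (\<alpha> f) (act V c d f x)"])
    also have "\<dots> = sc (of_nat (card ?C)) (comb c x \<alpha> d)" by (rule sum_constant_scale)
    finally have 2: "comb c x \<alpha> d = sc \<nu> (\<Sum>h\<in>hom m c d. act V c d h (orb c x \<alpha> h))" using \<nu> by simp
    have orbs: "orb c x \<alpha> h \<in> sp V c" and Ts: "(\<Sum>s\<in>?C. sc (?T h s) (?z s)) \<in> sp V c" for h
      unfolding orb_def using c by (intro subspace_sum subspace_scale sp_subspace act_in; auto)+
    have "comb c x (S \<alpha> d 0) d - comb c x \<alpha> d =
        sc \<nu> (\<Sum>h\<in>hom m c d. act V c d h ((\<Sum>s\<in>?C. sc (?T h s) (?z s)) - orb c x \<alpha> h))"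
      unfolding 1 2 scale_right_diff_distrib[symmetric] sum_subtractf[symmetric]
      by (intro arg_cong[where f = "sc \<nu>"] sum.cong refl act_diff[symmetric] c d orbs Ts)
    also have "\<dots> \<in> gsub G d"
      by (intro subspace_scale subspace_sum subspace_gsub gsub_act[OF G c(1) d] t_sec orbW)
    finally show ?thesis .
  qed
  \<comment> \<open>Coefficients are chosen arbitrarily; \<open>S_eq\<close> makes the section
    independent of the choice, from which linearity and naturality follow.\<close>
  define alp where "alp d w = (SOME \<alpha>. w - comb c x \<alpha> d \<in> gsub G d)" for d w
  have alp: "w - comb c x (alp d w) d \<in> gsub G d" if "w \<in> ?H d" for d w
    unfolding alp_def by (rule someI_ex[OF gsub_insert_decomp[OF that]])
  have s_eq: "S (alp d w) d = S \<alpha> d" if "d \<in> obj m" "w \<in> ?H d" "w - comb c x \<alpha> d \<in> gsub G d" for d w \<alpha>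
  proof (rule S_eq[OF that(1)])
    have "(w - comb c x \<alpha> d) - (w - comb c x (alp d w) d) \<in> gsub G d"
      by (rule subspace_diff[OF subspace_gsub that(3) alp[OF that(2)]])
    then show "comb c x (alp d w) d - comb c x \<alpha> d \<in> gsub G d" by simp
  qed
  have vH: "valid_gens (insert (c, x) G)" using G c by (auto simp: valid_gens_def)
  have gm: "gmap [(c, x)] d y = comb c x (y 0) d" for d y by (simp add: gmap_def comb_def)
  show ?thesis unfolding quot_proj_def
  proof (intro exI conjI ballI)
    show "set [c] \<subseteq> obj m" using c by simp
    have "is_hom m free_sc (free m (map fst [(c, x)])) sc (V\<lparr>sp := ?H\<rparr>) (gmap [(c, x)])"
      using c by (intro gmap_hom) (auto simp: valid_gens_def gm comb_in)
    then show "is_hom m free_sc (free m [c]) sc (V\<lparr>sp := ?H\<rparr>) (gmap [(c, x)])" by simp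
    show "is_hom m sc (V\<lparr>sp := ?H\<rparr>) free_sc (free m [c]) (\<lambda>d w. S (alp d w) d)"
      unfolding is_hom_def
    proof (intro conjI ballI allI, goal_cases)
      case (1 d w)
      then show ?case by (simp add: S_sp)
    next
      case (2 d w w')
      then have w: "w \<in> ?H d" "w' \<in> ?H d" by auto
      have "(w - comb c x (alp d w) d) + (w' - comb c x (alp d w') d) \<in> gsub G d"
        by (rule subspace_add[OF subspace_gsub alp[OF w(1)] alp[OF w(2)]])
      then have "(w + w') - comb c x (\<lambda>f. alp d w f + alp d w' f) d \<in> gsub G d"
        by (simp add: comb_add algebra_simps)
      then have "S (alp d (w + w')) d = S (\<lambda>f. alp d w f + alp d w' f) d"
        using w by (intro s_eq[OF 2(1)]) (simp_all add: subspace_add)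
      then show ?case by (simp only: S_add)
    next
      case (3 d a w)
      then have w: "w \<in> ?H d" by auto
      have "sc a (w - comb c x (alp d w) d) \<in> gsub G d" by (rule subspace_scale[OF subspace_gsub alp[OF w]])
      then have "sc a w - comb c x (\<lambda>f. a * alp d w f) d \<in> gsub G d"
        by (simp add: comb_scale scale_right_diff_distrib)
      then have "S (alp d (sc a w)) d = S (\<lambda>f. a * alp d w f) d"
        using w by (intro s_eq[OF 3(1)]) (simp_all add: subspace_scale)
      then show ?case by (simp only: S_scale)
    next
      case (4 d e g w)
      then have w: "w \<in> ?H d" by auto
      have cs: "comb c x (alp d w) d \<in> sp V d" and ws: "w \<in> sp V d"
        using comb_in[of c x _ d G] w gsub_sub[OF vH 4(1)] by blast+
      have "act V d e g (w - comb c x (alp d w) d) \<in> gsub G e" by (rule gsub_act[OF G 4(1-3) alp[OF w]])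
      then have "act V d e g w - comb c x (push c d g (alp d w)) e \<in> gsub G e"
        using act_diff[OF 4(1-3) ws cs] comb_push[OF c 4(1-3)] by simp
      then have "S (alp e (act V d e g w)) e = S (push c d g (alp d w)) e"
        by (intro s_eq[OF 4(2)] gsub_act[OF vH 4(1-3) w])
      then show ?case using S_act[OF 4(1-3)] by simp
    qed
    fix d assume d: "d \<in> obj m"
    show "S (alp d u) d = 0" if u: "u \<in> gsub G d" for u
    proof -
      have uH: "u \<in> ?H d" using u gsub_mono[of G "insert (c, x) G"] by blast
      \<comment> \<open>The zero coefficients are written as a multiple by 0 so that
        \<open>S_scale\<close> evaluates \<open>S\<close> on them.\<close>
      have "u - comb c x (\<lambda>f. 0 * alp d u f) d \<in> gsub G d" using u by (simp add: comb_def)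
      then have "S (alp d u) d = S (\<lambda>f. 0 * alp d u f) d" by (rule s_eq[OF d uH])
      then show ?thesis unfolding S_scale by (simp add: free_sc_def fun_eq_iff)
    qed
    show "gmap [(c, x)] d (S (alp d v) d) - v \<in> gsub G d" if "v \<in> sp (V\<lparr>sp := ?H\<rparr>) d" for v
    proof -
      have "v \<in> ?H d" using that by simp
      then have "(comb c x (S (alp d v) d 0) d - comb c x (alp d v) d) - (v - comb c x (alp d v) d) \<in> gsub G d"
        by (rule subspace_diff[OF subspace_gsub S_sec[OF d] alp])
      then show ?thesis by (simp add: gm)
    qed
  qed
qed

text \<open>The generators are spanning sets of all degrees with fewer than n points, sorted by
  number of points. When a generator of degree c is reached, every degree with fewer points is
  already completely generated, which is the condition in \<open>quot_proj_step\<close>.\<close>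

theorem filtered_if_tfree:
  assumes fd: "fin_dim" and gen: "gen_below n" and tf: "\<And>c. c \<in> obj m \<Longrightarrow> tfree c (pts m c)"
    and char: "\<And>c. (of_nat (card (hom m c c)) :: 'k) \<noteq> 0"
  shows "filtered m sc V"
proof -
  obtain B where B: "\<forall>c\<in>obj m. finite (B c) \<and> B c \<subseteq> sp V c \<and> sp V c \<subseteq> span (B c)"
    using bchoice[OF fd[unfolded fin_dim_def]] by blast
  let ?k = "\<lambda>p. card (pts m (fst p))"
  define GS where "GS = Sigma {c \<in> obj m. card (pts m c) < n} B"
  have "finite GS" unfolding GS_def using finite_objs_card B by (intro finite_SigmaI) auto
  then obtain l where l: "set l = GS" using finite_list by blast
  define gs where "gs = sort_key ?k l"
  have gs: "set gs = GS" "sorted (map ?k gs)" using l by (simp_all add: gs_def)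
  have val: "valid_gens (set gs)" using B unfolding gs by (auto simp: valid_gens_def GS_def)
  have surj: "gsub (set gs) d = sp V d" if d: "d \<in> obj m" for d
  proof
    have "sp V d \<subseteq> span {act V e d f v | e f v. e \<in> obj m \<and> card (pts m e) < n \<and> f \<in> hom m e d \<and> v \<in> sp V e}"
      using gen d unfolding gen_below_def by blast
    also have "\<dots> \<subseteq> gsub (set gs) d"
    proof (rule span_minimal[OF _ subspace_gsub], rule subsetI, elim CollectE exE conjE)
      fix y e f v assume y: "y = act V e d f v" "e \<in> obj m" "card (pts m e) < n" "f \<in> hom m e d" "v \<in> sp V e"
      show "y \<in> gsub (set gs) d" unfolding y(1)
      proof (rule act_span[OF y(2) d y(4) subspace_gsub])
        show "B e \<subseteq> sp V e" "v \<in> span (B e)" using B y by blast+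
        show "act V e d f b \<in> gsub (set gs) d" if "b \<in> B e" for b
          using that y(2,3,4) by (intro gsubI) (auto simp: gs GS_def)
      qed
    qed
    finally show "sp V d \<subseteq> gsub (set gs) d" .
  qed (rule gsub_sub[OF val d])
  show ?thesis unfolding filtered_def
  proof (intro conjI exI ballI)
    show "is_fim m sc V" by (rule fim)
    show "set (map fst gs) \<subseteq> obj m" using val by (auto simp: valid_gens_def)
    have "is_hom m free_sc (free m (map fst gs)) sc (V\<lparr>sp := sp V\<rparr>) (gmap gs)"
      using surj gmap_image_full by (intro gmap_hom[OF val]) blast
    then show "is_hom m free_sc (free m (map fst gs)) sc V (gmap gs)" by simp
    show "gmap gs d ` sp (free m (map fst gs)) d = sp V d" if "d \<in> obj m" for d
      using gmap_image_full surj[OF that] by simp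
    fix r assume "r \<in> {1..length (map fst gs)}"
    then obtain q where q: "r = Suc q" "q < length gs" by (cases r) auto
    obtain c x where cx: "gs ! q = (c, x)" by (cases "gs ! q")
    have mem: "(c, x) \<in> set gs" using q cx nth_mem by metis
    have set_r: "set (take r gs) = insert (c, x) (set (take q gs))"
      using q cx by (simp add: take_Suc_conv_app_nth)
    have piece: "filt_piece m (map fst gs) (gmap gs) r' = gsub (set (take r' gs))" for r'
      by (rule ext) (rule filt_piece_gmap)
    have key: "?k (gs ! i) \<le> ?k (gs ! j)" if "i \<le> j" "j < length gs" for i j
      using sorted_nth_mono[OF gs(2) that(1)] that by simp
    have "quot_proj m sc (V\<lparr>sp := gsub (insert (c, x) (set (take q gs)))\<rparr>) (gsub (set (take q gs)))"
    proof (rule quot_proj_step)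
      show "valid_gens (set (take q gs))" using val set_take_subset[of q gs] unfolding valid_gens_def by blast
      show "\<forall>p\<in>set (take q gs). ?k p \<le> card (pts m c)"
      proof
        fix p assume "p \<in> set (take q gs)"
        then obtain i where "i < q" "p = gs ! i" by (auto simp: in_set_conv_nth)
        then show "?k p \<le> card (pts m c)" using key[of i q] q cx by simp
      qed
      show "c \<in> obj m" "x \<in> sp V c" using mem val by (auto simp: valid_gens_def)
      then show "tfree c (pts m c)" using tf by blast
      show "(of_nat (card (hom m c c)) :: 'k) \<noteq> 0" by (rule char)
      fix e assume e: "e \<in> obj m" "card (pts m e) < card (pts m c)"
      have "card (pts m c) < n" using mem unfolding gs GS_def by auto
      have "b \<in> gsub (set (take q gs)) e" if b: "b \<in> B e" for b
      proof -
        have "(e, b) \<in> set gs" using b e \<open>card (pts m c) < n\<close> unfolding gs GS_def by auto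
        then obtain i where i: "i < length gs" "gs ! i = (e, b)" by (auto simp: in_set_conv_nth)
        \<comment> \<open>A strictly smaller key puts every spanning vector of degree e before
          position q.\<close>
        have "i < q" using key[of q i] i q cx e(2) by (cases "i < q") auto
        then have "(e, b) \<in> set (take q gs)" using i by (auto simp: in_set_conv_nth intro!: exI[of _ i])
        then have "act V e e (idm m e) b \<in> gsub (set (take q gs)) e" by (intro gsubI) auto
        moreover have "b \<in> sp V e" using B e(1) b by blast
        ultimately show ?thesis using act_id[OF e(1)] by simp
      qed
      then have "span (B e) \<subseteq> gsub (set (take q gs)) e" by (intro span_minimal subsetI) auto
      then show "sp V e \<subseteq> gsub (set (take q gs)) e" using B e(1) by blast
    qed
    then show "quot_proj m sc (V\<lparr>sp := filt_piece m (map fst gs) (gmap gs) r\<rparr>) (filt_piece m (map fst gs) (gmap gs) (r - 1))"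
      unfolding piece set_r using q by simp
  qed
qed

end

section \<open>Homomorphisms and quotients\<close>

lemma is_homD:
  assumes "is_hom m s1 V s2 W \<phi>" "d \<in> obj m"
  shows "v \<in> sp V d \<Longrightarrow> \<phi> d v \<in> sp W d"
    and "v \<in> sp V d \<Longrightarrow> w \<in> sp V d \<Longrightarrow> \<phi> d (v + w) = \<phi> d v + \<phi> d w"
    and "v \<in> sp V d \<Longrightarrow> \<phi> d (s1 a v) = s2 a (\<phi> d v)"
    and "e \<in> obj m \<Longrightarrow> f \<in> hom m d e \<Longrightarrow> v \<in> sp V d \<Longrightarrow> \<phi> e (act V d e f v) = act W d e f (\<phi> d v)"
  using assms by (auto simp: is_hom_def)

lemma is_hom_comp:
  assumes "is_hom m s1 U s2 V \<phi>" "is_hom m s2 V s3 W \<psi>"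
  shows "is_hom m s1 U s3 W (\<lambda>d x. \<psi> d (\<phi> d x))"
  using assms by (simp add: is_hom_def)

lemma vector_space_jsc: "vector_space jsc"
  by unfold_locales (auto simp: jsc_def fun_eq_iff algebra_simps)

locale fim_hom = V: fim_module s1 m V + W: fim_module s2 m W
  for s1 :: "'k::field \<Rightarrow> 'v::ab_group_add \<Rightarrow> 'v" and m V
  and s2 :: "'k \<Rightarrow> 'w::ab_group_add \<Rightarrow> 'w" and W +
  fixes \<phi> :: "idx \<Rightarrow> 'v \<Rightarrow> 'w"
  assumes hom: "is_hom m s1 V s2 W \<phi>"
begin

lemma hom_0: "d \<in> obj m \<Longrightarrow> \<phi> d 0 = 0"
  using is_homD(3)[OF hom, of d 0 0] V.subspace_0[OF V.sp_subspace] by simp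

lemma hom_diff:
  assumes "d \<in> obj m" "x \<in> sp V d" "y \<in> sp V d"
  shows "\<phi> d (x - y) = \<phi> d x - \<phi> d y"
  using is_homD(2)[OF hom assms(1), of "x - y" y] assms V.subspace_diff[OF V.sp_subspace]
  by (simp add: algebra_simps)

lemma hom_span:
  assumes d: "d \<in> obj m" and T: "W.subspace T" and S: "S \<subseteq> sp V d" "\<And>x. x \<in> S \<Longrightarrow> \<phi> d x \<in> T"
    and v: "v \<in> V.span S"
  shows "\<phi> d v \<in> T"
proof -
  have "V.subspace {x \<in> sp V d. \<phi> d x \<in> T}"
    using V.sp_subspace[OF d] T is_homD(2,3)[OF hom d] hom_0[OF d]
    by (intro V.subspaceI) (auto simp: V.subspace_0 V.subspace_add V.subspace_scale W.subspace_0 W.subspace_add W.subspace_scale)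
  then have "V.span S \<subseteq> {x \<in> sp V d. \<phi> d x \<in> T}" using S by (intro V.span_minimal) auto
  then show ?thesis using v by blast
qed

lemma surj_fin_dim:
  assumes surj: "\<And>d. d \<in> obj m \<Longrightarrow> \<phi> d ` sp V d = sp W d" and fd: "V.fin_dim"
  shows "W.fin_dim"
  unfolding W.fin_dim_def
proof
  fix d assume d: "d \<in> obj m"
  obtain S where S: "finite S" "S \<subseteq> sp V d" "sp V d \<subseteq> V.span S" using fd d unfolding V.fin_dim_def by blast
  have "\<phi> d ` sp V d \<subseteq> W.span (\<phi> d ` S)"
  proof (rule image_subsetI)
    fix v assume "v \<in> sp V d"
    then have "v \<in> V.span S" using S(3) by blast
    then show "\<phi> d v \<in> W.span (\<phi> d ` S)"
      by (rule hom_span[OF d W.subspace_span S(2), rotated]) (rule W.span_base, rule imageI)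
  qed
  then show "\<exists>S. finite S \<and> S \<subseteq> sp W d \<and> sp W d \<subseteq> W.span S"
    using S(1,2) unfolding surj[OF d, symmetric]
    by (intro exI[of _ "\<phi> d ` S"] conjI) (simp_all add: image_mono)
qed

lemma surj_gen_below:
  assumes surj: "\<And>d. d \<in> obj m \<Longrightarrow> \<phi> d ` sp V d = sp W d" and gen: "V.gen_below n"
  shows "W.gen_below n"
  unfolding W.gen_below_def
proof
  fix d assume d: "d \<in> obj m"
  let ?GV = "{act V e d f v | e f v. e \<in> obj m \<and> card (pts m e) < n \<and> f \<in> hom m e d \<and> v \<in> sp V e}"
  let ?GW = "{act W e d f v | e f v. e \<in> obj m \<and> card (pts m e) < n \<and> f \<in> hom m e d \<and> v \<in> sp W e}"
  have "\<phi> d ` sp V d \<subseteq> W.span ?GW"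
  proof (rule image_subsetI)
    fix v assume v: "v \<in> sp V d"
    show "\<phi> d v \<in> W.span ?GW"
    proof (rule hom_span[OF d W.subspace_span])
      show "?GV \<subseteq> sp V d" using V.act_in d by blast
      show "v \<in> V.span ?GV" using gen d v unfolding V.gen_below_def by blast
      fix x assume "x \<in> ?GV"
      then obtain e f u where e: "x = act V e d f u" "e \<in> obj m" "card (pts m e) < n" "f \<in> hom m e d" "u \<in> sp V e" by blast
      have "\<phi> d x = act W e d f (\<phi> e u)" unfolding e(1) by (rule is_homD(4)[OF hom e(2) d e(4,5)])
      then have "\<phi> d x \<in> ?GW" using e is_homD(1)[OF hom e(2,5)] by blast
      then show "\<phi> d x \<in> W.span ?GW" by (rule W.span_base)
    qed
  qed
  then show "sp W d \<subseteq> W.span ?GW" using surj[OF d] by simp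
qed

end

context fim_module
begin

text \<open>The quotient is realised inside the space of sequences by coordinates with respect to a finite
  spanning set.\<close>

lemma quotient_exists:
  assumes fd: "fin_dim" and U: "\<And>d. d \<in> obj m \<Longrightarrow> subspace (U d)" "\<And>d. d \<in> obj m \<Longrightarrow> U d \<subseteq> sp V d"
    "\<And>d e f v. \<lbrakk>d \<in> obj m; e \<in> obj m; f \<in> hom m d e; v \<in> U d\<rbrakk> \<Longrightarrow> act V d e f v \<in> U e"
  obtains Q :: "(nat \<Rightarrow> 'k) fim" and \<pi> where "fim_hom sc m V jsc Q \<pi>"
    "\<And>d. d \<in> obj m \<Longrightarrow> \<pi> d ` sp V d = sp Q d"
    "\<And>d v. d \<in> obj m \<Longrightarrow> v \<in> sp V d \<Longrightarrow> \<pi> d v = 0 \<longleftrightarrow> v \<in> U d"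
proof -
  have "\<exists>t :: 'v \<Rightarrow> nat \<Rightarrow> 'k. (\<forall>w\<in>sp V d. \<forall>w'\<in>sp V d. t (w + w') = t w + t w') \<and>
     (\<forall>w\<in>sp V d. \<forall>r. t (sc r w) = jsc r (t w)) \<and> (\<forall>w\<in>sp V d. t w = 0 \<longleftrightarrow> w \<in> U d)" if d: "d \<in> obj m" for d
  proof -
    obtain S where S: "finite S" "S \<subseteq> sp V d" "sp V d \<subseteq> span S" using fd d unfolding fin_dim_def by blast
    obtain l where l: "set l = S" using finite_list[OF S(1)] by blast
    let ?G = "{..<length l}"
    have lS: "(!) l ` ?G = S" using l by (auto simp: set_conv_nth)
    have "U d \<union> (!) l ` ?G \<subseteq> sp V d" using U(2)[OF d] S(2) lS by blast
    then have "span (U d \<union> (!) l ` ?G) \<subseteq> sp V d" by (rule span_minimal[OF _ sp_subspace[OF d]])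
    moreover have "sp V d \<subseteq> span (U d \<union> (!) l ` ?G)" using S(3) lS span_mono[of S "U d \<union> S"] by auto
    ultimately have W: "span (U d \<union> (!) l ` ?G) = sp V d" by blast
    \<comment> \<open>Coordinates modulo \<open>U d\<close>, indexed by positions in a spanning
      list, embed the degree d part of the quotient into sequences.\<close>
    obtain t :: "'v \<Rightarrow> nat \<Rightarrow> 'k" where t:
      "\<And>w w'. \<lbrakk>w \<in> span (U d \<union> (!) l ` ?G); w' \<in> span (U d \<union> (!) l ` ?G)\<rbrakk> \<Longrightarrow> t (w + w') = t w + t w'"
      "\<And>w r. w \<in> span (U d \<union> (!) l ` ?G) \<Longrightarrow> t (sc r w) = (\<lambda>s. r * t w s)"
      "\<And>u. u \<in> U d \<Longrightarrow> t u = (\<lambda>_. 0)"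
      "\<And>w. w \<in> span (U d \<union> (!) l ` ?G) \<Longrightarrow> (\<Sum>s\<in>?G. sc (t w s) (l ! s)) - w \<in> U d"
      by (rule section_mod_subspace[OF U(1)[OF d] finite_lessThan, where z = "(!) l"]) blast
    \<comment> \<open>Vanishing coordinates give the zero combination, so the section property
      leaves the negative of \<open>w\<close> in \<open>U d\<close>.\<close>
    have "w \<in> U d" if w: "w \<in> sp V d" "t w = 0" for w
    proof -
      have "0 - w \<in> U d" using t(4)[unfolded W, OF w(1)] w(2) by simp
      then have "- (0 - w) \<in> U d" by (rule subspace_neg[OF U(1)[OF d]])
      then show ?thesis by simp
    qed
    then have "\<forall>w\<in>sp V d. t w = 0 \<longleftrightarrow> w \<in> U d" using t(3) by (auto simp: fun_eq_iff)
    then show ?thesis using t(1,2)[unfolded W] by (intro exI[of _ t]) (auto simp: jsc_def)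
  qed
  then have "\<forall>d\<in>obj m. \<exists>t :: 'v \<Rightarrow> nat \<Rightarrow> 'k. (\<forall>w\<in>sp V d. \<forall>w'\<in>sp V d. t (w + w') = t w + t w') \<and>
     (\<forall>w\<in>sp V d. \<forall>r. t (sc r w) = jsc r (t w)) \<and> (\<forall>w\<in>sp V d. t w = 0 \<longleftrightarrow> w \<in> U d)" by blast
  then obtain \<pi> where pi0: "\<forall>d\<in>obj m. (\<forall>w\<in>sp V d. \<forall>w'\<in>sp V d. \<pi> d (w + w') = \<pi> d w + \<pi> d w') \<and>
     (\<forall>w\<in>sp V d. \<forall>r. \<pi> d (sc r w) = jsc r (\<pi> d w)) \<and> (\<forall>w\<in>sp V d. \<pi> d w = (0::nat \<Rightarrow> 'k) \<longleftrightarrow> w \<in> U d)"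
    by (rule bchoice[THEN exE])
  then have pi_add: "\<And>d w w'. \<lbrakk>d \<in> obj m; w \<in> sp V d; w' \<in> sp V d\<rbrakk> \<Longrightarrow> \<pi> d (w + w') = \<pi> d w + \<pi> d w'"
    and pi_scale: "\<And>d w r. \<lbrakk>d \<in> obj m; w \<in> sp V d\<rbrakk> \<Longrightarrow> \<pi> d (sc r w) = jsc r (\<pi> d w)"
    and pi_ker: "\<And>d w. \<lbrakk>d \<in> obj m; w \<in> sp V d\<rbrakk> \<Longrightarrow> \<pi> d w = 0 \<longleftrightarrow> w \<in> U d" by blast+
  have pi_diff: "\<pi> d (w - w') = \<pi> d w - \<pi> d w'" if "d \<in> obj m" "w \<in> sp V d" "w' \<in> sp V d" for d w w'
    using pi_add[OF that(1) subspace_diff[OF sp_subspace[OF that(1)] that(2,3)] that(3)] by (simp add: algebra_simps)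
  \<comment> \<open>The action picks an arbitrary preimage; since the structure maps preserve
    \<open>U\<close>, the kernel of \<open>\<pi>\<close>, the result does not depend on it.\<close>
  define Q :: "(nat \<Rightarrow> 'k) fim" where
    "Q = \<lparr>sp = \<lambda>d. \<pi> d ` sp V d, act = \<lambda>d e f y. \<pi> e (act V d e f (SOME v. v \<in> sp V d \<and> \<pi> d v = y))\<rparr>"
  have Qsp: "sp Q d = \<pi> d ` sp V d" for d by (simp add: Q_def)
  have Qact: "act Q d e f (\<pi> d v) = \<pi> e (act V d e f v)"
    if d: "d \<in> obj m" "e \<in> obj m" "f \<in> hom m d e" and v: "v \<in> sp V d" for d e f v
  proof -
    define v' where "v' = (SOME v'. v' \<in> sp V d \<and> \<pi> d v' = \<pi> d v)"
    have v': "v' \<in> sp V d \<and> \<pi> d v' = \<pi> d v" unfolding v'_def by (rule someI[of _ v]) (simp add: v)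
    then have "\<pi> d (v' - v) = 0" using pi_diff[OF d(1) _ v] by simp
    moreover have "v' - v \<in> sp V d" using v' v subspace_diff[OF sp_subspace[OF d(1)]] by blast
    ultimately have "act V d e f (v' - v) \<in> U e" using U(3)[OF d] pi_ker[OF d(1)] by blast
    moreover have "act V d e f v' \<in> sp V e" "act V d e f v \<in> sp V e" using act_in[OF d] v v' by blast+
    ultimately have "\<pi> e (act V d e f v') - \<pi> e (act V d e f v) = 0"
      using act_diff[OF d _ v] v' pi_ker[OF d(2)] pi_diff[OF d(2)] subspace_diff[OF sp_subspace[OF d(2)]] by metis
    then show ?thesis by (simp add: Q_def v'_def)
  qed
  interpret J: vector_space "jsc :: 'k \<Rightarrow> _" by (rule vector_space_jsc)
  have "is_fim m jsc Q" unfolding is_fim_def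
  proof (intro conjI ballI allI, goal_cases)
    case 1 show ?case by (rule vector_space_jsc)
  next
    case (2 d)
    have "0 \<in> sp V d" by (rule subspace_0[OF sp_subspace[OF 2]])
    moreover have "\<pi> d 0 = 0" using pi_ker[OF 2 calculation] subspace_0[OF U(1)[OF 2]] by simp
    ultimately show ?case unfolding Qsp by (metis imageI)
  next
    case (3 d x y)
    then obtain v w where v: "v \<in> sp V d" "x = \<pi> d v" "w \<in> sp V d" "y = \<pi> d w" unfolding Qsp by blast
    then have "x + y = \<pi> d (v + w)" using pi_add[OF 3(1)] by simp
    then show ?case unfolding Qsp using subspace_add[OF sp_subspace[OF 3(1)] v(1,3)] by blast
  next
    case (4 d a x)
    then obtain v where v: "v \<in> sp V d" "x = \<pi> d v" unfolding Qsp by blast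
    then have "jsc a x = \<pi> d (sc a v)" using pi_scale[OF 4(1)] by simp
    then show ?case unfolding Qsp using subspace_scale[OF sp_subspace[OF 4(1)] v(1)] by blast
  next
    case (5 d e f x)
    then obtain v where v: "v \<in> sp V d" "x = \<pi> d v" unfolding Qsp by blast
    then show ?case using Qact[OF 5(1-3) v(1)] act_in[OF 5(1-3) v(1)] unfolding Qsp by blast
  next
    case (6 d e f x y)
    then obtain v w where v: "v \<in> sp V d" "x = \<pi> d v" "w \<in> sp V d" "y = \<pi> d w" unfolding Qsp by blast
    have vw: "v + w \<in> sp V d" by (rule subspace_add[OF sp_subspace[OF 6(1)] v(1,3)])
    show ?case unfolding v(2,4) pi_add[OF 6(1) v(1,3), symmetric] Qact[OF 6(1-3) vw] Qact[OF 6(1-3) v(1)] Qact[OF 6(1-3) v(3)]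
      act_add[OF 6(1-3) v(1,3)] by (rule pi_add[OF 6(2) act_in[OF 6(1-3) v(1)] act_in[OF 6(1-3) v(3)]])
  next
    case (7 d e f a x)
    then obtain v where v: "v \<in> sp V d" "x = \<pi> d v" unfolding Qsp by blast
    have av: "sc a v \<in> sp V d" by (rule subspace_scale[OF sp_subspace[OF 7(1)] v(1)])
    show ?case unfolding v(2) pi_scale[OF 7(1) v(1), symmetric] Qact[OF 7(1-3) av] Qact[OF 7(1-3) v(1)]
      act_scale[OF 7(1-3) v(1)] by (rule pi_scale[OF 7(2) act_in[OF 7(1-3) v(1)]])
  next
    case (8 d x)
    then obtain v where v: "v \<in> sp V d" "x = \<pi> d v" unfolding Qsp by blast
    then show ?case using Qact[OF 8(1) 8(1) idm_hom_self v(1)] act_id[OF 8(1) v(1)] by simp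
  next
    case (9 d e c f g x)
    then obtain v where v: "v \<in> sp V d" "x = \<pi> d v" unfolding Qsp by blast
    show ?case unfolding v(2) Qact[OF 9(1,3) mcomp_hom[OF 9(4,5)] v(1)] Qact[OF 9(1,2,4) v(1)]
      Qact[OF 9(2,3,5) act_in[OF 9(1,2,4) v(1)]] act_comp[OF 9(1-5) v(1)] ..
  qed
  then interpret Q: fim_module jsc m Q by unfold_locales
  have "is_hom m sc V jsc Q \<pi>"
    unfolding is_hom_def Qsp by (auto simp: pi_add pi_scale Qact)
  then have "fim_hom sc m V jsc Q \<pi>" by unfold_locales
  then show ?thesis using Qsp pi_ker that by metis
qed

end

section \<open>Resolutions\<close>

definition unit_vec :: "nat \<Rightarrow> mor \<Rightarrow> ('k::field) freev" where
  "unit_vec i f = (\<lambda>j h. if j = i \<and> h = f then 1 else 0)"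

lemma unit_vec_sp: "i < length cs \<Longrightarrow> f \<in> hom m (cs ! i) d \<Longrightarrow> unit_vec i f \<in> sp (free m cs) d"
  by (auto simp: free_sp unit_vec_def)

text \<open>The basis vector at \<open>f\<close> is the translate of the one at the identity, so a
  map out of a free module is determined by the images of the latter.\<close>

lemma unit_vec_act:
  assumes i: "i < length cs" and f: "f \<in> hom m (cs ! i) d"
  shows "act (free m cs) (cs ! i) d f (unit_vec i (idm m (cs ! i))) = unit_vec i f"
proof (intro ext)
  fix j h
  show "act (free m cs) (cs ! i) d f (unit_vec i (idm m (cs ! i))) j h = unit_vec i f j h"
  proof (cases "j = i")
    case True
    then show ?thesis using i mcomp_idm_right[OF f] unfolding free_act unit_vec_def by auto
  next
    case False
    then show ?thesis by (simp add: free_act unit_vec_def)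
  qed
qed

lemma fin_gen_fim_module: "fin_gen m sc V \<Longrightarrow> fim_module sc m V"
  by (simp add: fin_gen_def fim_module_def fim_module_axioms_def is_fim_def)

text \<open>Induction on the size of the support removes one coefficient at a time, and each basis
  vector goes to a translate of a generator.\<close>

lemma free_image_in_span:
  assumes V: "fim_module sc m V" and hom: "is_hom m free_sc (free m cs) sc V \<Phi>"
    and cs: "set cs \<subseteq> obj m" and d: "d \<in> obj m" and y: "y \<in> sp (free m cs) d"
  shows "\<Phi> d y \<in> module.span sc ((\<lambda>(i, f). act V (cs ! i) d f (\<Phi> (cs ! i) (unit_vec i (idm m (cs ! i)))))
     ` Sigma {..<length cs} (\<lambda>i. hom m (cs ! i) d))"
proof -
  interpret V: fim_module sc m V by (rule V)
  let ?I = "Sigma {..<length cs} (\<lambda>i. hom m (cs ! i) d)"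
  let ?a = "\<lambda>(i, f). act V (cs ! i) d f (\<Phi> (cs ! i) (unit_vec i (idm m (cs ! i))))"
  have finI: "finite ?I" by (intro finite_SigmaI) auto
  have unit: "\<Phi> d (unit_vec i f) \<in> V.span (?a ` ?I)" if i: "i < length cs" "f \<in> hom m (cs ! i) d" for i f
  proof -
    have ci: "cs ! i \<in> obj m" using cs i(1) nth_mem by blast
    have "\<Phi> d (unit_vec i f) = act V (cs ! i) d f (\<Phi> (cs ! i) (unit_vec i (idm m (cs ! i))))"
      unfolding unit_vec_act[OF i, symmetric]
      by (rule is_homD(4)[OF hom ci d i(2) unit_vec_sp[OF i(1) idm_hom_self]])
    also have "\<dots> = ?a (i, f)" by simp
    also have "\<dots> \<in> V.span (?a ` ?I)" by (intro V.span_base imageI) (use i in auto)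
    finally show ?thesis .
  qed
  show ?thesis using y
  proof (induction "card {(i, f). y i f \<noteq> 0}" arbitrary: y rule: less_induct)
    case less
    have sub: "{(i, f). y i f \<noteq> 0} \<subseteq> ?I" using less.prems by (auto simp: free_sp)
    then have fin: "finite {(i, f). y i f \<noteq> 0}" using finI by (rule finite_subset)
    show ?case
    proof (cases "y = 0")
      case True
      have "\<Phi> d (free_sc 0 0) = sc 0 (\<Phi> d 0)" by (rule is_homD(3)[OF hom d]) (simp add: free_sp)
      then have "\<Phi> d y = 0" using True by (simp add: free_sc_def zero_fun_def)
      then show ?thesis by (simp add: V.span_zero)
    next
      case False
      then obtain i f where if0: "y i f \<noteq> 0" by (auto simp: fun_eq_iff)
      then have i: "i < length cs" "f \<in> hom m (cs ! i) d" using less.prems by (auto simp: free_sp)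
      define z where "z = (\<lambda>j h. if j = i \<and> h = f then 0 else y j h)"
      have zsp: "z \<in> sp (free m cs) d" using less.prems by (auto simp: free_sp z_def)
      have "{(i, f). z i f \<noteq> 0} \<subset> {(i, f). y i f \<noteq> 0}"
        using if0 by (auto simp: z_def psubset_eq set_eq_iff split: if_splits)
      then have "card {(i, f). z i f \<noteq> 0} < card {(i, f). y i f \<noteq> 0}" by (rule psubset_card_mono[OF fin])
      then have zs: "\<Phi> d z \<in> V.span (?a ` ?I)" using less.hyps zsp by blast
      have usp: "free_sc (y i f) (unit_vec i f) \<in> sp (free m cs) d"
        using i by (auto simp: free_sp free_sc_def unit_vec_def split: if_splits)
      have yz: "z + free_sc (y i f) (unit_vec i f) = y"
        by (intro ext) (auto simp: z_def free_sc_def unit_vec_def)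
      have "\<Phi> d y = \<Phi> d z + sc (y i f) (\<Phi> d (unit_vec i f))"
        using is_homD(2)[OF hom d zsp usp] unfolding yz is_homD(3)[OF hom d unit_vec_sp[OF i]] .
      then show ?thesis using zs unit[OF i] by (simp add: V.span_add V.span_scale)
    qed
  qed
qed

text \<open>Each degree is spanned by the translates of the generators, and these are finitely many
  because hom sets are finite. The two properties obtained here are what the induction on
  resolutions carries along.\<close>

lemma fin_gen_bounds:
  assumes fg: "fin_gen m sc V"
  shows "fim_module.fin_dim sc m V \<and> (\<exists>n. fim_module.gen_below sc m V n)"
proof -
  interpret V: fim_module sc m V by (rule fin_gen_fim_module[OF fg])
  obtain cs \<Phi> where *: "set cs \<subseteq> obj m \<and> is_hom m free_sc (free m cs) sc V \<Phi> \<and>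
        (\<forall>d\<in>obj m. \<Phi> d ` sp (free m cs) d = sp V d)"
    using fg[unfolded fin_gen_def, THEN conjunct2] by (elim exE) (rule that)
  then have cs: "set cs \<subseteq> obj m" and hom: "is_hom m free_sc (free m cs) sc V \<Phi>"
    and surj: "\<And>d. d \<in> obj m \<Longrightarrow> \<Phi> d ` sp (free m cs) d = sp V d" by simp_all
  let ?I = "\<lambda>d. Sigma {..<length cs} (\<lambda>i. hom m (cs ! i) d)"
  let ?x = "\<lambda>i. \<Phi> (cs ! i) (unit_vec i (idm m (cs ! i)))"
  let ?a = "\<lambda>d (i, f). act V (cs ! i) d f (?x i)"
  have ci: "cs ! i \<in> obj m" "?x i \<in> sp V (cs ! i)" if "i < length cs" for i
  proof -
    show o: "cs ! i \<in> obj m" using cs that nth_mem by blast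
    show "?x i \<in> sp V (cs ! i)" by (rule is_homD(1)[OF hom o unit_vec_sp[OF that idm_hom_self]])
  qed
  have sp: "sp V d \<subseteq> V.span (?a d ` ?I d)" if d: "d \<in> obj m" for d
    unfolding surj[OF d, symmetric] using free_image_in_span[OF V.fim_module_axioms hom cs d] by blast
  have "V.fin_dim" unfolding V.fin_dim_def
  proof
    fix d assume d: "d \<in> obj m"
    have "finite (?I d)" by (intro finite_SigmaI) auto
    moreover have "?a d ` ?I d \<subseteq> sp V d" using ci V.act_in d by auto
    ultimately show "\<exists>S. finite S \<and> S \<subseteq> sp V d \<and> sp V d \<subseteq> V.span S"
      using sp[OF d] by (intro exI[of _ "?a d ` ?I d"] conjI) simp_all
  qed
  \<comment> \<open>The sum is a crude bound for all generator sizes; the successor accounts for the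
    strict inequality in \<open>gen_below\<close>.\<close>
  moreover define n where "n = Suc (\<Sum>i<length cs. card (pts m (cs ! i)))"
  have "V.gen_below n" unfolding V.gen_below_def
  proof
    fix d assume d: "d \<in> obj m"
    let ?G = "{act V e d f v | e f v. e \<in> obj m \<and> card (pts m e) < n \<and> f \<in> hom m e d \<and> v \<in> sp V e}"
    have "?a d ` ?I d \<subseteq> ?G"
    proof (rule image_subsetI)
      fix p assume "p \<in> ?I d"
      then obtain i f where p: "p = (i, f)" "i < length cs" "f \<in> hom m (cs ! i) d" by blast
      have "card (pts m (cs ! i)) \<le> (\<Sum>i<length cs. card (pts m (cs ! i)))"
        using p(2) by (intro member_le_sum) auto
      then have "card (pts m (cs ! i)) < n" by (simp add: n_def)
      then have "act V (cs ! i) d f (?x i) \<in> ?G" using ci[OF p(2)] p(3) by blast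
      then show "?a d p \<in> ?G" by (simp add: p(1))
    qed
    then show "sp V d \<subseteq> V.span ?G" using sp[OF d] V.span_mono by blast
  qed
  ultimately show ?thesis by blast
qed

text \<open>Hom(c, c) is a finite nonempty group, and characteristic 0 makes its order invertible,
  as the averaging requires.\<close>

lemma card_hom_self_nonzero: "(of_nat (card (hom m c c)) :: 'k::field_char_0) \<noteq> 0"
proof -
  have "hom m c c \<noteq> {}" using idm_hom_self by blast
  then show ?thesis by (simp add: card_eq_0_iff)
qed

text \<open>Every degree c + a lies above \<open>a\<close>, where all derivatives of V are torsion
  free; so the shift has this property in all degrees along the full set of points.\<close>

lemma eventually_filtered:
  fixes sc :: "'k::field_char_0 \<Rightarrow> 'v::ab_group_add \<Rightarrow> 'v"
  assumes V: "fim_module sc m V" and fd: "fim_module.fin_dim sc m V" and gen: "fim_module.gen_below sc m V n"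
  obtains a where "a \<in> obj m" "filtered m sc (shift m a V)"
    "\<forall>d\<in>obj m. \<forall>e\<in>obj m. \<forall>g\<in>hom m d e. le_idx m a d \<longrightarrow> inj_on (act V d e g) (sp V d)"
proof -
  interpret V: fim_module sc m V by (rule V)
  obtain a where a: "a \<in> obj m" and tf: "\<And>d A. d \<in> obj m \<Longrightarrow> le_idx m a d \<Longrightarrow> A \<subseteq> pts m d \<Longrightarrow> V.tfree d A"
    using V.eventually_tfree[OF gen fd] by blast
  interpret S: fim_module sc m "shift m a V" by (rule V.shift_fim[OF a])
  have "filtered m sc (shift m a V)"
  proof (rule S.filtered_if_tfree[OF V.shift_fin_dim[OF a fd] V.shift_gen_below[OF a gen] _ card_hom_self_nonzero])
    fix c assume c: "c \<in> obj m"
    show "S.tfree c (pts m c)"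
      by (intro V.shift_tfree[OF a c] tf idx_add_obj[OF c a] le_idx_add pts_add_old order_refl)
  qed
  moreover have "inj_on (act V d e g) (sp V d)" if d: "d \<in> obj m" "e \<in> obj m" "g \<in> hom m d e" "le_idx m a d" for d e g
  proof (rule inj_onI)
    fix v w assume v: "v \<in> sp V d" "w \<in> sp V d" "act V d e g v = act V d e g w"
    have vw: "v - w \<in> sp V d" by (rule V.subspace_diff[OF V.sp_subspace[OF d(1)] v(1,2)])
    \<comment> \<open>No range fails to contain the empty set, so \<open>low\<close> at
      \<open>{}\<close> is zero, and torsion freeness along \<open>{}\<close> is
      injectivity.\<close>
    have "act V d e g (v - w) \<in> V.low e (mapp g ` {})"
      using V.act_diff[OF d(1-3) v(1,2)] v(3) by (simp add: V.subspace_0)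
    then have "v - w \<in> V.low d {}" using tf[OF d(1,4), of "{}"] d(2,3) vw unfolding V.tfree_def by blast
    then show "v = w" by (simp add: V.low_def)
  qed
  ultimately show ?thesis using a by (intro that[of a]) blast+
qed

text \<open>At \<open>i = N\<close> the guard makes the left side all of \<open>J N\<close>, so the
  condition there is surjectivity of the last map. Composites vanish in all degrees; exactness is
  asked from \<open>D\<close> on.\<close>

definition filtered_resolution ::
  "nat \<Rightarrow> ('k::field \<Rightarrow> 'v::ab_group_add \<Rightarrow> 'v) \<Rightarrow> 'v fim \<Rightarrow> nat \<Rightarrow> (nat \<Rightarrow> (nat \<Rightarrow> 'k) fim)
    \<Rightarrow> (idx \<Rightarrow> 'v \<Rightarrow> (nat \<Rightarrow> 'k)) \<Rightarrow> (nat \<Rightarrow> idx \<Rightarrow> (nat \<Rightarrow> 'k) \<Rightarrow> (nat \<Rightarrow> 'k)) \<Rightarrow> bool" where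
  "filtered_resolution m sc V N J \<delta>0 \<delta> \<longleftrightarrow>
       (\<forall>i\<le>N. filtered m jsc (J i)) \<and>
       is_hom m sc V jsc (J 0) \<delta>0 \<and>
       (\<forall>i<N. is_hom m jsc (J i) jsc (J (Suc i)) (\<delta> i)) \<and>
       (0 < N \<longrightarrow> (\<forall>d\<in>obj m. \<forall>x\<in>sp V d. \<delta> 0 d (\<delta>0 d x) = 0)) \<and>
       (\<forall>i. Suc i < N \<longrightarrow> (\<forall>d\<in>obj m. \<forall>x\<in>sp (J i) d. \<delta> (Suc i) d (\<delta> i d x) = 0)) \<and>
       (\<exists>D. \<forall>d\<in>obj m. le_idx m D d \<longrightarrow>
          inj_on (\<delta>0 d) (sp V d) \<and>
          (\<forall>i\<le>N. {y \<in> sp (J i) d. i < N \<longrightarrow> \<delta> i d y = 0} =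
                 (if i = 0 then \<delta>0 d ` sp V d else \<delta> (i - 1) d ` sp (J (i - 1)) d)))"

lemma filtered_resolutionD:
  assumes "filtered_resolution m sc V N J \<delta>0 \<delta>"
  shows "\<And>i. i \<le> N \<Longrightarrow> filtered m jsc (J i)" "is_hom m sc V jsc (J 0) \<delta>0"
    "\<And>i. i < N \<Longrightarrow> is_hom m jsc (J i) jsc (J (Suc i)) (\<delta> i)"
    "\<And>d x. 0 < N \<Longrightarrow> d \<in> obj m \<Longrightarrow> x \<in> sp V d \<Longrightarrow> \<delta> 0 d (\<delta>0 d x) = 0"
    "\<And>i d x. Suc i < N \<Longrightarrow> d \<in> obj m \<Longrightarrow> x \<in> sp (J i) d \<Longrightarrow> \<delta> (Suc i) d (\<delta> i d x) = 0"
    "\<exists>D. \<forall>d\<in>obj m. le_idx m D d \<longrightarrow>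
          inj_on (\<delta>0 d) (sp V d) \<and>
          (\<forall>i\<le>N. {y \<in> sp (J i) d. i < N \<longrightarrow> \<delta> i d y = 0} =
                 (if i = 0 then \<delta>0 d ` sp V d else \<delta> (i - 1) d ` sp (J (i - 1)) d))"
  using assms unfolding filtered_resolution_def by simp_all

text \<open>Only the augmentation and its image involve V, so precomposing with an isomorphism
  leaves everything else unchanged. This allows an arbitrary ambient space for V.\<close>

lemma resolution_transport:
  assumes V: "fim_hom sc m V jsc W \<pi>" and iso: "\<And>d. d \<in> obj m \<Longrightarrow> \<pi> d ` sp V d = sp W d"
    "\<And>d. d \<in> obj m \<Longrightarrow> inj_on (\<pi> d) (sp V d)"
    and res: "filtered_resolution m jsc W N J \<delta>0 \<delta>"
  shows "filtered_resolution m sc V N J (\<lambda>d x. \<delta>0 d (\<pi> d x)) \<delta>"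
proof -
  interpret fim_hom sc m V jsc W \<pi> by (rule V)
  obtain D where D: "\<forall>d\<in>obj m. le_idx m D d \<longrightarrow> inj_on (\<delta>0 d) (sp W d) \<and>
          (\<forall>i\<le>N. {y \<in> sp (J i) d. i < N \<longrightarrow> \<delta> i d y = 0} =
                 (if i = 0 then \<delta>0 d ` sp W d else \<delta> (i - 1) d ` sp (J (i - 1)) d))"
    using filtered_resolutionD(6)[OF res] by (elim exE) (rule that)
  have inj: "inj_on (\<lambda>x. \<delta>0 d (\<pi> d x)) (sp V d)" if "d \<in> obj m" "le_idx m D d" for d
    using comp_inj_on[OF iso(2)[OF that(1)], of "\<delta>0 d"] D that iso(1)[OF that(1)] by (simp add: o_def)
  have img: "(\<lambda>x. \<delta>0 d (\<pi> d x)) ` sp V d = \<delta>0 d ` sp W d" if "d \<in> obj m" for d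
    unfolding iso(1)[OF that, symmetric] by (simp add: image_image)
  have "is_hom m sc V jsc (J 0) (\<lambda>d x. \<delta>0 d (\<pi> d x))"
    by (rule is_hom_comp[OF hom filtered_resolutionD(2)[OF res]])
  moreover have "\<delta> 0 d (\<delta>0 d (\<pi> d x)) = 0" if "0 < N" "d \<in> obj m" "x \<in> sp V d" for d x
    by (rule filtered_resolutionD(4)[OF res that(1,2) is_homD(1)[OF hom that(2,3)]])
  moreover have "\<exists>D. \<forall>d\<in>obj m. le_idx m D d \<longrightarrow> inj_on (\<lambda>x. \<delta>0 d (\<pi> d x)) (sp V d) \<and>
          (\<forall>i\<le>N. {y \<in> sp (J i) d. i < N \<longrightarrow> \<delta> i d y = 0} =
                 (if i = 0 then (\<lambda>x. \<delta>0 d (\<pi> d x)) ` sp V d else \<delta> (i - 1) d ` sp (J (i - 1)) d))"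
    using D inj img by (intro exI[of _ D]) simp
  ultimately show ?thesis unfolding filtered_resolution_def
    using filtered_resolutionD(1,3,5)[OF res] by (intro conjI allI impI ballI) simp_all
qed

lemma shift_inclusion_hom:
  assumes V: "fim_module sc m V" and a: "a \<in> obj m"
  shows "fim_hom sc m V sc (shift m a V) (\<lambda>d. act V d (idx_add d a) (idm m d))"
proof -
  interpret V: fim_module sc m V by (rule V)
  interpret S: fim_module sc m "shift m a V" by (rule V.shift_fim[OF a])
  note inc = idm_hom[OF le_idx_add(1)]
  show ?thesis
  proof unfold_locales
    show "is_hom m sc V sc (shift m a V) (\<lambda>d. act V d (idx_add d a) (idm m d))"
      unfolding is_hom_def
    proof (intro conjI ballI allI, goal_cases)
      case (4 d e f x)
      show ?case
        using V.act_comp[OF 4(1,2) idx_add_obj[OF 4(2) a] 4(3) inc 4(4)]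
          V.act_comp[OF 4(1) idx_add_obj[OF 4(1) a] idx_add_obj[OF 4(2) a] inc shift_mor_hom[OF 4(3)] 4(4)]
          shift_mor_natural[OF 4(3)] by simp
    qed (use a in \<open>simp_all add: V.act_in V.act_add V.act_scale idx_add_obj inc\<close>)
  qed
qed

text \<open>A generator of the shifted module in a degree as large as that of its source comes from the
  unshifted module, so the cokernel of the inclusion is generated in strictly smaller degrees.\<close>

lemma coker_gen_below:
  assumes V: "fim_module sc m V" and a: "a \<in> obj m" and gen: "fim_module.gen_below sc m V (Suc n)"
    and Q: "fim_hom sc m (shift m a V) jsc Q \<pi>"
    and surj: "\<And>d. d \<in> obj m \<Longrightarrow> \<pi> d ` sp (shift m a V) d = sp Q d"
    and ker: "\<And>d v. d \<in> obj m \<Longrightarrow> v \<in> sp V d \<Longrightarrow> \<pi> d (act V d (idx_add d a) (idm m d) v) = 0"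
  shows "fim_module.gen_below jsc m Q n"
proof -
  interpret V: fim_module sc m V by (rule V)
  interpret S: fim_hom sc m "shift m a V" jsc Q \<pi> by (rule Q)
  show ?thesis unfolding S.W.gen_below_def
  proof
    fix d assume d: "d \<in> obj m"
    have da: "idx_add d a \<in> obj m" by (rule idx_add_obj[OF d a])
    let ?GV = "{act V e (idx_add d a) f v | e f v. e \<in> obj m \<and> card (pts m e) < Suc n \<and> f \<in> hom m e (idx_add d a) \<and> v \<in> sp V e}"
    let ?GQ = "{act Q e d f v | e f v. e \<in> obj m \<and> card (pts m e) < n \<and> f \<in> hom m e d \<and> v \<in> sp Q e}"
    have "\<pi> d w \<in> S.W.span ?GQ" if w: "w \<in> sp (shift m a V) d" for w
    proof (rule S.hom_span[OF d S.W.subspace_span])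
      show "?GV \<subseteq> sp (shift m a V) d" using V.act_in da by auto
      show "w \<in> V.span ?GV" using gen w da unfolding V.gen_below_def shift_sp by blast
      fix x assume "x \<in> ?GV"
      then obtain e f u where e: "x = act V e (idx_add d a) f u" "e \<in> obj m" "card (pts m e) < Suc n"
        "f \<in> hom m e (idx_add d a)" "u \<in> sp V e" by blast
      obtain c g k where c: "c \<in> obj m" "g \<in> hom m c d" "rng m c g = rng m e f \<inter> pts m d"
        "k \<in> hom m e (idx_add c a)" "mcomp m e (shift_mor m a c d g) k = f" by (rule shift_factor[OF e(4)])
      have ca: "idx_add c a \<in> obj m" by (rule idx_add_obj[OF c(1) a])
      show "\<pi> d x \<in> S.W.span ?GQ"
      proof (cases "card (pts m c) < n")
        case True
        let ?u = "act V e (idx_add c a) k u"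
        have u: "?u \<in> sp (shift m a V) c" using V.act_in[OF e(2) ca c(4) e(5)] by simp
        have "x = act (shift m a V) c d g ?u"
          using e(1) c(5) V.act_comp[OF e(2) ca da c(4) shift_mor_hom[OF c(2)] e(5)] by simp
        then have "\<pi> d x = act Q c d g (\<pi> c ?u)" using is_homD(4)[OF S.hom c(1) d c(2) u] by simp
        then have "\<pi> d x \<in> ?GQ" using True c(1,2) is_homD(1)[OF S.hom c(1) u] by blast
        then show ?thesis by (rule S.W.span_base)
      next
        case False
        \<comment> \<open>Here c has at least n points and e at most n, so every point hit by f lies
          in d and f passes through the inclusion of d.\<close>
        then have "card (rng m e f) \<le> card (rng m e f \<inter> pts m d)"
          using card_rng[OF c(2)] card_rng[OF e(4)] c(3) e(3) by simp
        then have "rng m e f \<inter> pts m d = rng m e f" by (intro card_seteq) auto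
        then have "rng m e f \<subseteq> rng m d (idm m d)" unfolding rng_idm by blast
        then obtain k' where k': "k' \<in> hom m e d" "mcomp m e (idm m d) k' = f"
          by (rule hom_factor[OF e(4) idm_hom[OF le_idx_add(1)]])
        have "x = act V d (idx_add d a) (idm m d) (act V e d k' u)"
          using e(1) k'(2) V.act_comp[OF e(2) d da k'(1) idm_hom[OF le_idx_add(1)] e(5)] by simp
        then have "\<pi> d x = 0" using ker[OF d V.act_in[OF e(2) d k'(1) e(5)]] by simp
        then show ?thesis by (simp add: S.W.span_zero)
      qed
    qed
    then show "sp Q d \<subseteq> S.W.span ?GQ" unfolding surj[OF d, symmetric] by blast
  qed
qed

text \<open>The ambient space is fixed as the space of sequences so that the cokernel has the same
  type as V and the induction hypothesis applies to it.\<close>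

lemma resolution_exists:
  fixes V :: "(nat \<Rightarrow> 'k::field_char_0) fim"
  assumes "fim_module jsc m V" "fim_module.fin_dim jsc m V" "fim_module.gen_below jsc m V n"
  shows "\<exists>N J \<delta>0 \<delta>. filtered_resolution m jsc V N J \<delta>0 \<delta>"
  using assms
proof (induction n arbitrary: V)
  case 0
  interpret V: fim_module jsc m V by (rule 0)
  have zero: "sp V d = {0}" if "d \<in> obj m" for d
  proof -
    have "sp V d \<subseteq> V.span {}" using 0(3) that unfolding V.gen_below_def by simp
    then show ?thesis using V.subspace_0[OF V.sp_subspace[OF that]] by auto
  qed
  \<comment> \<open>V is zero, hence torsion free, and serves as the only term of its own
    resolution.\<close>
  have "filtered m jsc V"
    using zero by (intro V.filtered_if_tfree[OF 0(2,3)] card_hom_self_nonzero) (auto simp: V.tfree_def V.subspace_0)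
  moreover have "is_hom m jsc V jsc V (\<lambda>d x. x)" by (simp add: is_hom_def)
  ultimately have "filtered_resolution m jsc V 0 (\<lambda>_. V) (\<lambda>d x. x) (\<lambda>_ d x. x)"
    unfolding filtered_resolution_def by (simp add: inj_on_def)
  then show ?case by blast
next
  case (Suc n)
  note V = Suc.prems(1) and fd = Suc.prems(2) and gen = Suc.prems(3)
  interpret V: fim_module jsc m V by (rule V)
  obtain a where a: "a \<in> obj m" "filtered m jsc (shift m a V)" 
    and inj0: "\<forall>d\<in>obj m. \<forall>e\<in>obj m. \<forall>g\<in>hom m d e. le_idx m a d \<longrightarrow> inj_on (act V d e g) (sp V d)"
    by (rule eventually_filtered[OF V fd gen])
  define \<iota> where "\<iota> d = act V d (idx_add d a) (idm m d)" for d
  interpret I: fim_hom jsc m V jsc "shift m a V" \<iota> unfolding \<iota>_def by (rule shift_inclusion_hom[OF V a(1)])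
  define U where "U d = \<iota> d ` sp V d" for d
  obtain Q \<pi> where Q: "fim_hom jsc m (shift m a V) jsc Q \<pi>"
    and surj: "\<And>d. d \<in> obj m \<Longrightarrow> \<pi> d ` sp (shift m a V) d = sp Q d"
    and ker: "\<And>d v. d \<in> obj m \<Longrightarrow> v \<in> sp (shift m a V) d \<Longrightarrow> \<pi> d v = 0 \<longleftrightarrow> v \<in> U d"
  proof (rule I.W.quotient_exists[OF V.shift_fin_dim[OF a(1) fd], of U])
    fix d assume d: "d \<in> obj m"
    show "U d \<subseteq> sp (shift m a V) d" unfolding U_def using is_homD(1)[OF I.hom d] by blast
    show "V.subspace (U d)"
    proof (rule V.subspaceI)
      show "0 \<in> U d" unfolding U_def using I.hom_0[OF d] V.subspace_0[OF V.sp_subspace[OF d]] by (metis imageI)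
    next
      fix x y assume "x \<in> U d" "y \<in> U d"
      then obtain v w where v: "v \<in> sp V d" "w \<in> sp V d" "x = \<iota> d v" "y = \<iota> d w" unfolding U_def by blast
      then have "x + y = \<iota> d (v + w)" using is_homD(2)[OF I.hom d] by simp
      then show "x + y \<in> U d" unfolding U_def using V.subspace_add[OF V.sp_subspace[OF d] v(1,2)] by blast
    next
      fix r x assume "x \<in> U d"
      then obtain v where v: "v \<in> sp V d" "x = \<iota> d v" unfolding U_def by blast
      then have "jsc r x = \<iota> d (jsc r v)" using is_homD(3)[OF I.hom d] by simp
      then show "jsc r x \<in> U d" unfolding U_def using V.subspace_scale[OF V.sp_subspace[OF d] v(1)] by blast
    qed
    fix e f v assume e: "e \<in> obj m" "f \<in> hom m d e" "v \<in> U d"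
    then obtain w where w: "w \<in> sp V d" "v = \<iota> d w" unfolding U_def by blast
    then have "act (shift m a V) d e f v = \<iota> e (act V d e f w)" using is_homD(4)[OF I.hom d e(1,2)] by simp
    then show "act (shift m a V) d e f v \<in> U e" unfolding U_def using V.act_in[OF d e(1,2) w(1)] by blast
  qed blast
  interpret Q: fim_hom jsc m "shift m a V" jsc Q \<pi> by (rule Q)
  have pi_iota: "\<pi> d (\<iota> d v) = 0" if "d \<in> obj m" "v \<in> sp V d" for d v
    using ker[OF that(1) is_homD(1)[OF I.hom that]] that unfolding U_def by blast
  have genQ: "Q.W.gen_below n"
    by (rule coker_gen_below[OF V a(1) gen Q surj]) (use pi_iota in \<open>simp_all add: \<iota>_def\<close>)
  obtain N J \<delta>0 \<delta> where res: "filtered_resolution m jsc Q N J \<delta>0 \<delta>"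
    using Suc.IH[OF Q.W.fim_module_axioms Q.surj_fin_dim[OF surj V.shift_fin_dim[OF a(1) fd]] genQ] by blast
  note resD = filtered_resolutionD[OF res]
  obtain D where "\<forall>d\<in>obj m. le_idx m D d \<longrightarrow> inj_on (\<delta>0 d) (sp Q d) \<and>
          (\<forall>i\<le>N. {y \<in> sp (J i) d. i < N \<longrightarrow> \<delta> i d y = 0} =
                 (if i = 0 then \<delta>0 d ` sp Q d else \<delta> (i - 1) d ` sp (J (i - 1)) d))"
    using resD(6) by (elim exE) (rule that)
  then have D: "\<And>d. d \<in> obj m \<Longrightarrow> le_idx m D d \<Longrightarrow> inj_on (\<delta>0 d) (sp Q d)"
    "\<And>d i. d \<in> obj m \<Longrightarrow> le_idx m D d \<Longrightarrow> i \<le> N \<Longrightarrow> {y \<in> sp (J i) d. i < N \<longrightarrow> \<delta> i d y = 0} =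
                 (if i = 0 then \<delta>0 d ` sp Q d else \<delta> (i - 1) d ` sp (J (i - 1)) d)"
    by simp_all
  have zero0: "\<delta>0 d 0 = 0" if "d \<in> obj m" for d
    using is_homD(3)[OF resD(2) that, of 0 0] V.subspace_0[OF Q.W.sp_subspace[OF that]]
    by (simp add: jsc_def zero_fun_def)
  define J' where "J' = case_nat (shift m a V) J"
  \<comment> \<open>The new first differential is the projection onto the cokernel followed by the
    augmentation of its resolution.\<close>
  define \<delta>' where "\<delta>' = case_nat (\<lambda>d y. \<delta>0 d (\<pi> d y)) \<delta>"
  have J': "J' 0 = shift m a V" "J' (Suc i) = J i" for i by (simp_all add: J'_def)
  have \<delta>': "\<delta>' 0 = (\<lambda>d y. \<delta>0 d (\<pi> d y))" "\<delta>' (Suc i) = \<delta> i" for i by (simp_all add: \<delta>'_def)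
  have "filtered_resolution m jsc V (Suc N) J' \<iota> \<delta>'"
    unfolding filtered_resolution_def
  proof (intro conjI allI impI ballI)
    fix i assume "i \<le> Suc N"
    then show "filtered m jsc (J' i)" using a(2) resD(1) by (cases i) (simp_all add: J')
  next
    show "is_hom m jsc V jsc (J' 0) \<iota>" using I.hom by (simp add: J')
  next
    fix i assume "i < Suc N"
    then show "is_hom m jsc (J' i) jsc (J' (Suc i)) (\<delta>' i)"
      using is_hom_comp[OF Q.hom resD(2)] resD(3) by (cases i) (simp_all add: J' \<delta>')
  next
    fix d x assume "d \<in> obj m" "x \<in> sp V d"
    then show "\<delta>' 0 d (\<iota> d x) = 0" by (simp add: \<delta>' pi_iota zero0)
  next
    fix i d x assume i: "Suc i < Suc N" and d: "d \<in> obj m" and x: "x \<in> sp (J' i) d"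
    show "\<delta>' (Suc i) d (\<delta>' i d x) = 0"
    proof (cases i)
      case 0
      then have "\<pi> d x \<in> sp Q d" using x is_homD(1)[OF Q.hom d] by (simp add: J')
      then show ?thesis using 0 i d resD(4) by (simp add: \<delta>')
    next
      case (Suc i')
      then show ?thesis using i d x resD(5) by (simp add: J' \<delta>')
    qed
  next
    show "\<exists>D. \<forall>d\<in>obj m. le_idx m D d \<longrightarrow> inj_on (\<iota> d) (sp V d) \<and>
          (\<forall>i\<le>Suc N. {y \<in> sp (J' i) d. i < Suc N \<longrightarrow> \<delta>' i d y = 0} =
                 (if i = 0 then \<iota> d ` sp V d else \<delta>' (i - 1) d ` sp (J' (i - 1)) d))"
    \<comment> \<open>Above \<open>a\<close> the inclusion into the shift is injective, above
      \<open>D\<close> the resolution of the cokernel is exact; the sum dominates both.\<close>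
    proof (intro exI[of _ "idx_add a D"] ballI impI conjI allI)
      fix d assume d: "d \<in> obj m" and le: "le_idx m (idx_add a D) d"
      have leD: "le_idx m a d" "le_idx m D d" using le le_idx_trans le_idx_add by blast+
      show "inj_on (\<iota> d) (sp V d)" unfolding \<iota>_def
        using inj0 d idx_add_obj[OF d a(1)] leD(1) idm_hom[OF le_idx_add(1)] by blast
      fix i assume i: "i \<le> Suc N"
      show "{y \<in> sp (J' i) d. i < Suc N \<longrightarrow> \<delta>' i d y = 0} =
                 (if i = 0 then \<iota> d ` sp V d else \<delta>' (i - 1) d ` sp (J' (i - 1)) d)"
      proof (cases i)
        case 0
        \<comment> \<open>In these degrees \<open>\<delta>0\<close> is injective, so the spliced map
          has the same kernel as \<open>\<pi>\<close>, namely the image of V.\<close>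
        have "\<delta>0 d (\<pi> d y) = 0 \<longleftrightarrow> y \<in> U d" if y: "y \<in> sp (shift m a V) d" for y
        proof -
          have "\<delta>0 d (\<pi> d y) = 0 \<longleftrightarrow> \<pi> d y = 0"
            using inj_onD[OF D(1)[OF d leD(2)], of "\<pi> d y" 0] zero0[OF d] is_homD(1)[OF Q.hom d y]
              V.subspace_0[OF Q.W.sp_subspace[OF d]] by auto
          then show ?thesis using ker[OF d y] by simp
        qed
        moreover have "U d \<subseteq> sp (shift m a V) d" unfolding U_def using is_homD(1)[OF I.hom d] by blast
        ultimately have "{y \<in> sp (shift m a V) d. \<delta>0 d (\<pi> d y) = 0} = U d" by blast
        then show ?thesis using 0 unfolding U_def by (simp add: J' \<delta>')
      next
        case (Suc i')
        have "(\<lambda>y. \<delta>0 d (\<pi> d y)) ` sp (shift m a V) d = \<delta>0 d ` sp Q d"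
          unfolding surj[OF d, symmetric] by (simp add: image_image)
        then show ?thesis using D(2)[OF d leD(2), of i'] i Suc by (cases i') (simp_all add: J' \<delta>')
      qed
    qed
  qed
  then show ?case by blast
qed

theorem theorem2p5:
  fixes m :: nat and sc :: "'k::field_char_0 \<Rightarrow> 'v::ab_group_add \<Rightarrow> 'v" and V :: "'v fim"
  assumes "fin_gen m sc V"
  shows "(\<exists>a\<in>obj m. filtered m sc (shift m a V)) \<and>
    (\<exists>(N::nat) (J :: nat \<Rightarrow> (nat \<Rightarrow> 'k) fim) (\<delta>0 :: idx \<Rightarrow> 'v \<Rightarrow> (nat \<Rightarrow> 'k))
        (\<delta> :: nat \<Rightarrow> idx \<Rightarrow> (nat \<Rightarrow> 'k) \<Rightarrow> (nat \<Rightarrow> 'k)).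
       (\<forall>i\<le>N. filtered m jsc (J i)) \<and>
       is_hom m sc V jsc (J 0) \<delta>0 \<and>
       (\<forall>i<N. is_hom m jsc (J i) jsc (J (Suc i)) (\<delta> i)) \<and>
       (0 < N \<longrightarrow> (\<forall>d\<in>obj m. \<forall>x\<in>sp V d. \<delta> 0 d (\<delta>0 d x) = 0)) \<and>
       (\<forall>i. Suc i < N \<longrightarrow> (\<forall>d\<in>obj m. \<forall>x\<in>sp (J i) d. \<delta> (Suc i) d (\<delta> i d x) = 0)) \<and>
       (\<exists>D. \<forall>d\<in>obj m. le_idx m D d \<longrightarrow>
          inj_on (\<delta>0 d) (sp V d) \<and>
          (\<forall>i\<le>N. {y \<in> sp (J i) d. i < N \<longrightarrow> \<delta> i d y = 0} =
                 (if i = 0 then \<delta>0 d ` sp V d else \<delta> (i - 1) d ` sp (J (i - 1)) d))))"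
proof -
  interpret V: fim_module sc m V by (rule fin_gen_fim_module[OF assms])
  obtain n where fd: "V.fin_dim" and gen: "V.gen_below n" using fin_gen_bounds[OF assms] by blast
  have "\<exists>a\<in>obj m. filtered m sc (shift m a V)"
    by (rule eventually_filtered[OF V.fim_module_axioms fd gen]) blast
  moreover have "\<exists>N J \<delta>0 \<delta>. filtered_resolution m sc V N J \<delta>0 \<delta>"
  proof -
    \<comment> \<open>Dividing by the zero submodule gives an isomorphic copy of V inside the
      sequences, where the resolution is built.\<close>
    obtain W :: "(nat \<Rightarrow> 'k) fim" and \<pi> where W: "fim_hom sc m V jsc W \<pi>"
      and surj: "\<And>d. d \<in> obj m \<Longrightarrow> \<pi> d ` sp V d = sp W d"
      and ker: "\<And>d v. d \<in> obj m \<Longrightarrow> v \<in> sp V d \<Longrightarrow> \<pi> d v = 0 \<longleftrightarrow> v \<in> {0}"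
    proof (rule V.quotient_exists[OF fd, of "\<lambda>_. {0}"])
      show "{0} \<subseteq> sp V d" if "d \<in> obj m" for d using V.subspace_0[OF V.sp_subspace[OF that]] by simp
    qed (simp_all add: V.act_zero)
    interpret W: fim_hom sc m V jsc W \<pi> by (rule W)
    have inj: "inj_on (\<pi> d) (sp V d)" if d: "d \<in> obj m" for d
    proof (rule inj_onI)
      fix v w assume v: "v \<in> sp V d" "w \<in> sp V d" "\<pi> d v = \<pi> d w"
      then have "\<pi> d (v - w) = 0" using W.hom_diff[OF d] by simp
      then show "v = w" using ker[OF d V.subspace_diff[OF V.sp_subspace[OF d] v(1,2)]] by simp
    qed
    obtain N J \<delta>0 \<delta> where "filtered_resolution m jsc W N J \<delta>0 \<delta>"
      using resolution_exists[OF W.W.fim_module_axioms W.surj_fin_dim[OF surj fd] W.surj_gen_below[OF surj gen]] by blast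
    from resolution_transport[OF W surj inj this] show ?thesis by blast
  qed
  ultimately show ?thesis unfolding filtered_resolution_def by (rule conjI)
qed

end
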